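(* For each positive integer $n$, let $X_n$ be the finite graph in the plane defined in the context. Then for each $n\ge 1$, $K(X_n)$ has size $n$.
   Context: A continuum is a nonempty compact connected metric space. For a continuum $X$, $C(X)$ is the set of nonempty closed connected subsets of $X$ with the Hausdorff metric, and for $p\in X$, $C(p,X)=\{A\in C(X):p\in A\}$. $K(X)=\{C(x,X):x\in X\}$. On $K(X)$ consider the equivalence relation $C(p,X)\sim C(q,X)$ if and only if $C(p,X)$ is homeomorphic to $C(q,X)$. $K(X)$ has size $n$ if the quotient $K(X)/\sim$ has cardinality $n$. A finite graph is a continuum that is the union of finitely many arcs, any two of which are either disjoint or intersect only in one or both of their end points. A simple triod is the union of three arcs emanating from a single point and otherwise disjoint from each other. Definition of $X_n$. In $\mathbb{R}^2$, for each $n\in\mathbb{N}$ let: $I_n=[n-1,n]\times\{0\}$; $C_n$ the circle of radius $\frac14$ and center $(n,\frac14)$; $C$ the circle of radius $\frac18$ and center $(2,\frac18)$; for each $i\in\mathbb{N}$, $l^{(n)}_i$ the linear segment joining $(n,0)$ and $(n-\frac1i,-1)$; and, for $n\ge 3$, $S_n=I_n\cup C_n\cup\bigcup_{i=1}^{2n} l^{(n)}_i$. Let $P_1=I_2\cup C_2\cup C$; $P_2=I_2\cup C_1\cup C_2\cup C$; $P_3=I_2\cup C_2\cup C\cup\bigcup_{i=1}^{3} l^{(1)}_i$; $P_4=I_2\cup C_1\cup C_2\cup C\cup l^{(1)}_1$; $P_5=I_2\cup C_2\cup C\cup l^{(1)}_1\cup l^{(1)}_2\cup l^{(2)}_1\cup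 l^{(2)}_2$. Then: $X_1$ is a simple closed curve, $X_2$ is an arc, $X_3$ is a simple triod; $X_{i+3}=P_i$ for $i\in\{1,2,3,4,5\}$; and for each $n\ge 9$, writing $n=5(k+1)+r$ with $k$ a positive integer and $r\in\{-1,0,1,2,3\}$, $X_n$ is defined recursively by $X_n=X_{5k+r}\cup S_{k+2}$. *)

theory Defs
  imports "HOL-Analysis.Analysis"
begin

section \<open>Hyperspaces of continua\<close>

text \<open>The value 0 outside the nonempty bounded sets is arbitrary; it makes the distance nonnegative
  everywhere, as the locale \<^locale>\<open>Metric_space\<close> requires.\<close>

definition hausdorff_dist :: "'a::metric_space set \<Rightarrow> 'a set \<Rightarrow> real" where
  "hausdorff_dist A B =
     (if A \<noteq> {} \<and> B \<noteq> {} \<and> bounded A \<and> bounded B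
      then max (SUP a\<in>A. infdist a B) (SUP b\<in>B. infdist b A) else 0)"

text \<open>\<open>subcontinua X\<close> is the set underlying the hyperspace \<open>C(X)\<close> of a continuum \<open>X\<close>.\<close>

definition subcontinua :: "'a::metric_space set \<Rightarrow> 'a set set" where
  "subcontinua X = {A. A \<noteq> {} \<and> closedin (top_of_set X) A \<and> connected A}"

definition hyperspace :: "'a::metric_space set \<Rightarrow> 'a set topology" where
  "hyperspace X = Metric_space.mtopology (subcontinua X) hausdorff_dist"

definition subcontinua_at :: "'a::metric_space \<Rightarrow> 'a set \<Rightarrow> 'a set set" where
  "subcontinua_at p X = {A \<in> subcontinua X. p \<in> A}"

definition KX :: "'a::metric_space set \<Rightarrow> 'a set set set" where
  "KX X = (\<lambda>x. subcontinua_at x X) ` X"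

definition KX_rel :: "'a::metric_space set \<Rightarrow> ('a set set \<times> 'a set set) set" where
  "KX_rel X = {(A, B). A \<in> KX X \<and> B \<in> KX X \<and>
     subtopology (hyperspace X) A homeomorphic_space subtopology (hyperspace X) B}"

definition KX_has_size :: "'a::metric_space set \<Rightarrow> nat \<Rightarrow> bool" where
  "KX_has_size X n \<longleftrightarrow> finite (KX X // KX_rel X) \<and> card (KX X // KX_rel X) = n"

lemma equiv_KX_rel: "equiv (KX X) (KX_rel X)"
proof (rule equivI)
  show "KX_rel X \<subseteq> KX X \<times> KX X"
    unfolding KX_rel_def by blast
  show "refl_on (KX X) (KX_rel X)"
    unfolding refl_on_def KX_rel_def using homeomorphic_space_refl by blast
  show "sym (KX_rel X)"
    unfolding KX_rel_def by (rule symI) (use homeomorphic_space_sym in blast)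
  show "trans (KX_rel X)"
    unfolding KX_rel_def by (rule transI) (use homeomorphic_space_trans in blast)
qed

lemma infdist_le_hausdorff_dist:
  assumes "bounded A" "bounded B" "B \<noteq> {}" "a \<in> A"
  shows "infdist a B \<le> hausdorff_dist A B"
proof -
  obtain b where b: "b \<in> B" using assms by blast
  obtain r where r: "\<And>x. x \<in> A \<Longrightarrow> dist b x \<le> r"
    using assms(1) bounded_any_center[of A b] by blast
  have "bdd_above ((\<lambda>a. infdist a B) ` A)"
  proof (rule bdd_aboveI2[where M = r])
    fix x assume "x \<in> A"
    then show "infdist x B \<le> r"
      using r[of x] infdist_le[OF b, of x] by (simp add: dist_commute)
  qed
  then have "infdist a B \<le> (SUP a\<in>A. infdist a B)"
    using assms by (intro cSUP_upper)
  then show ?thesis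
    using assms by (auto simp: hausdorff_dist_def)
qed

lemma hausdorff_dist_nonneg: "0 \<le> hausdorff_dist A B"
proof (cases "A \<noteq> {} \<and> B \<noteq> {} \<and> bounded A \<and> bounded B")
  case True
  then obtain a where "a \<in> A" by blast
  then show ?thesis
    using True infdist_le_hausdorff_dist[of A B a] infdist_nonneg[of a B] by simp
qed (auto simp: hausdorff_dist_def)

lemma hausdorff_dist_commute: "hausdorff_dist A B = hausdorff_dist B A"
  unfolding hausdorff_dist_def by (simp add: max.commute conj_ac)

lemma infdist_triangle_hausdorff_dist:
  assumes "bounded A" "bounded B" "bounded C" "B \<noteq> {}" "C \<noteq> {}" "a \<in> A"
  shows "infdist a C \<le> hausdorff_dist A B + hausdorff_dist B C"
proof -
  have "infdist a C - hausdorff_dist B C \<le> (INF b\<in>B. dist a b)"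
  proof (rule cINF_greatest)
    fix b assume "b \<in> B"
    then show "infdist a C - hausdorff_dist B C \<le> dist a b"
      using infdist_triangle[of a C b] infdist_le_hausdorff_dist[of B C b] assms by simp
  qed (use assms in auto)
  then show ?thesis
    using infdist_le_hausdorff_dist[of A B a] assms by (simp add: infdist_notempty)
qed

lemma Metric_space_hausdorff_dist:
  "Metric_space {A :: 'a::metric_space set. A \<noteq> {} \<and> closed A \<and> bounded A} hausdorff_dist"
proof
  fix A B :: "'a set"
  show "0 \<le> hausdorff_dist A B"
    by (rule hausdorff_dist_nonneg)
  show "hausdorff_dist A B = hausdorff_dist B A"
    by (rule hausdorff_dist_commute)
next
  fix A B :: "'a set"
  assume A: "A \<in> {A. A \<noteq> {} \<and> closed A \<and> bounded A}"
    and B: "B \<in> {A. A \<noteq> {} \<and> closed A \<and> bounded A}"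
  have sub: "A' \<subseteq> B'" if "hausdorff_dist A' B' = 0" "bounded A'" "bounded B'" "closed B'" "B' \<noteq> {}"
    for A' B' :: "'a set"
  proof
    fix a assume "a \<in> A'"
    then have "infdist a B' = 0"
      using that infdist_le_hausdorff_dist[of A' B' a] infdist_nonneg[of a B'] by simp
    then show "a \<in> B'"
      using that by (simp add: in_closed_iff_infdist_zero)
  qed
  show "hausdorff_dist A B = 0 \<longleftrightarrow> A = B"
  proof
    assume "hausdorff_dist A B = 0"
    then show "A = B"
      using A B sub[of A B] sub[of B A] hausdorff_dist_commute[of A B] by simp
  qed (use A in \<open>simp add: hausdorff_dist_def\<close>)
next
  fix A B C :: "'a set"
  assume "A \<in> {A. A \<noteq> {} \<and> closed A \<and> bounded A}" "B \<in> {A. A \<noteq> {} \<and> closed A \<and> bounded A}"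
    "C \<in> {A. A \<noteq> {} \<and> closed A \<and> bounded A}"
  then have ABC: "A \<noteq> {}" "bounded A" "B \<noteq> {}" "bounded B" "C \<noteq> {}" "bounded C"
    by auto
  have "(SUP a\<in>A. infdist a C) \<le> hausdorff_dist A B + hausdorff_dist B C"
    using ABC by (intro cSUP_least infdist_triangle_hausdorff_dist)
  moreover have "(SUP c\<in>C. infdist c A) \<le> hausdorff_dist C B + hausdorff_dist B A"
    using ABC by (intro cSUP_least infdist_triangle_hausdorff_dist)
  ultimately have "max (SUP a\<in>A. infdist a C) (SUP c\<in>C. infdist c A)
      \<le> hausdorff_dist A B + hausdorff_dist B C"
    by (simp add: hausdorff_dist_commute[of C B] hausdorff_dist_commute[of B A])
  then show "hausdorff_dist A C \<le> hausdorff_dist A B + hausdorff_dist B C"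
    using ABC by (simp add: hausdorff_dist_def[of A C])
qed

lemma Metric_space_subcontinua:
  assumes "compact X"
  shows "Metric_space (subcontinua X) hausdorff_dist"
proof (rule Metric_space.subspace[OF Metric_space_hausdorff_dist])
  show "subcontinua X \<subseteq> {A. A \<noteq> {} \<and> closed A \<and> bounded A}"
    using closedin_compact[OF assms] compact_imp_closed compact_imp_bounded
    unfolding subcontinua_def by blast
qed


section \<open>The graphs\<close>

definition is_arc :: "'a::topological_space set \<Rightarrow> bool" where
  "is_arc S \<longleftrightarrow> (\<exists>g. arc g \<and> path_image g = S)"

definition is_simple_closed_curve :: "'a::topological_space set \<Rightarrow> bool" where
  "is_simple_closed_curve S \<longleftrightarrow>
     (\<exists>g. simple_path g \<and> pathfinish g = pathstart g \<and> path_image g = S)"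

definition is_simple_triod :: "'a::topological_space set \<Rightarrow> bool" where
  "is_simple_triod S \<longleftrightarrow>
     (\<exists>f g h v. arc f \<and> arc g \<and> arc h \<and> pathstart f = v \<and> pathstart g = v \<and> pathstart h = v \<and>
        path_image f \<inter> path_image g = {v} \<and> path_image f \<inter> path_image h = {v} \<and>
        path_image g \<inter> path_image h = {v} \<and>
        S = path_image f \<union> path_image g \<union> path_image h)"

type_synonym plane = "real \<times> real"

definition edge :: "nat \<Rightarrow> plane set" where
  "edge n = {real n - 1..real n} \<times> {0}"

definition loop :: "nat \<Rightarrow> plane set" where
  "loop n = sphere (real n, 1/4) (1/4)"

definition small_loop :: "plane set" where
  "small_loop = sphere (2, 1/8) (1/8)"

definition leg :: "nat \<Rightarrow> nat \<Rightarrow> plane set" where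
  "leg n i = closed_segment (real n, 0) (real n - 1 / real i, -1)"

definition S_graph :: "nat \<Rightarrow> plane set" where
  "S_graph n = edge n \<union> loop n \<union> (\<Union>i\<in>{1..2 * n}. leg n i)"

definition P1 :: "plane set" where
  "P1 = edge 2 \<union> loop 2 \<union> small_loop"

definition P2 :: "plane set" where
  "P2 = edge 2 \<union> loop 1 \<union> loop 2 \<union> small_loop"

definition P3 :: "plane set" where
  "P3 = edge 2 \<union> loop 2 \<union> small_loop \<union> (\<Union>i\<in>{1..3}. leg 1 i)"

definition P4 :: "plane set" where
  "P4 = edge 2 \<union> loop 1 \<union> loop 2 \<union> small_loop \<union> leg 1 1"

definition P5 :: "plane set" where
  "P5 = edge 2 \<union> loop 2 \<union> small_loop \<union> leg 1 1 \<union> leg 1 2 \<union> leg 2 1 \<union> leg 2 2"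

text \<open>The first three graphs are only prescribed up to homeomorphism, so the sequence is described by
  a predicate. The index \<open>r\<close> may be \<open>-1\<close>, hence the integer arithmetic in the recursion.\<close>

definition graph_sequence :: "(nat \<Rightarrow> plane set) \<Rightarrow> bool" where
  "graph_sequence X \<longleftrightarrow>
     is_simple_closed_curve (X 1) \<and> is_arc (X 2) \<and> is_simple_triod (X 3) \<and>
     X 4 = P1 \<and> X 5 = P2 \<and> X 6 = P3 \<and> X 7 = P4 \<and> X 8 = P5 \<and>
     (\<forall>n\<ge>9. \<forall>k\<ge>1. \<forall>r\<in>{-1..3::int}. int n = 5 * (int k + 1) + r \<longrightarrow>
        X n = X (nat (5 * int k + r)) \<union> S_graph (k + 2))"

lemma graph_sequence_exists: "\<exists>X. graph_sequence X"
proof -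
  define f g h :: "real \<Rightarrow> plane" where
    "f = linepath (0, 0) (1, 0)" and "g = linepath (0, 0) (0, 1)" and "h = linepath (0, 0) (-1, 0)"
  have 2: "is_arc (path_image f)"
    unfolding is_arc_def f_def by (rule exI[of _ "linepath (0, 0) (1, 0)"]) simp
  have 3: "is_simple_triod (path_image f \<union> path_image g \<union> path_image h)"
    unfolding is_simple_triod_def
    by (rule exI[of _ f], rule exI[of _ g], rule exI[of _ h], rule exI[of _ "(0, 0)"])
      (auto simp: f_def g_def h_def closed_segment_def)
  have "is_simple_closed_curve (path_image (rectpath 0 (Complex 1 1)))"
    unfolding is_simple_closed_curve_def
    by (rule exI[of _ "rectpath 0 (Complex 1 1)"]) (auto intro!: simple_path_rectpath)
  then obtain c :: "real \<Rightarrow> complex" where c: "simple_path c" "pathfinish c = pathstart c"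
    by (auto simp: is_simple_closed_curve_def)
  define e :: "complex \<Rightarrow> plane" where "e = (\<lambda>z. (Re z, Im z))"
  have "simple_path (e \<circ> c)"
    by (rule simple_path_continuous_image[OF c(1)])
      (auto simp: e_def inj_on_def complex_eq_iff intro!: continuous_intros)
  then have 1: "is_simple_closed_curve (path_image (e \<circ> c))"
    unfolding is_simple_closed_curve_def using c by (auto simp: pathfinish_compose pathstart_compose)
  define base :: "nat \<Rightarrow> plane set" where
    "base = (\<lambda>n. if n = 1 then path_image (e \<circ> c) else if n = 2 then path_image f
       else if n = 3 then path_image f \<union> path_image g \<union> path_image h
       else if n = 4 then P1 else if n = 5 then P2 else if n = 6 then P3 else if n = 7 then P4 else P5)"
  define X where "X = wfrec less_than (\<lambda>X n. if n < 9 then base n else X (n - 5) \<union> S_graph ((n + 1) div 5 + 1))"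
  have X: "X n = (if n < 9 then base n else X (n - 5) \<union> S_graph ((n + 1) div 5 + 1))" for n
    unfolding X_def by (subst wfrec) (auto simp: cut_def)
  have small: "X n = base n" if "n < 9" for n
    using X[of n] that by simp
  have large: "X n = X (nat (5 * int k + r)) \<union> S_graph (k + 2)"
    if "n \<ge> 9" "k \<ge> 1" "r \<in> {-1..3}" "int n = 5 * (int k + 1) + r" for n k and r :: int
  proof -
    have "-1 \<le> r" "r \<le> 3"
      using that by auto
    have "nat (5 * int k + r) = n - 5"
      using that(4) by (simp add: algebra_simps)
    moreover have "5 * (k + 1) \<le> n + 1"
      using \<open>-1 \<le> r\<close> that(4) by presburger
    moreover have "n + 1 < 5 * Suc (k + 1)"
      using \<open>r \<le> 3\<close> that(4) by presburger
    ultimately have "nat (5 * int k + r) = n - 5" "(n + 1) div 5 + 1 = k + 2"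
      by (simp_all add: div_nat_eqI)
    then show ?thesis
      using X[of n] \<open>n \<ge> 9\<close> by simp
  qed
  have "X 1 = path_image (e \<circ> c)" "X 2 = path_image f"
    "X 3 = path_image f \<union> path_image g \<union> path_image h"
    "X 4 = P1" "X 5 = P2" "X 6 = P3" "X 7 = P4" "X 8 = P5"
    by (simp_all add: small base_def)
  with 1 2 3 large have "graph_sequence X"
    unfolding graph_sequence_def by metis
  then show ?thesis by blast
qed

end

theory Submission
  imports Defs "HOL-Homology.Invariance_of_Domain"
begin

text \<open>
  The graphs in the sequence are, from the fourth on, finite graphs whose vertices (branch points)
  have pairwise different degrees, all at least three. For every such graph \<open>X\<close> two points \<open>p\<close>,
  \<open>q\<close> have homeomorphic hyperspaces \<open>C(p,X)\<close>, \<open>C(q,X)\<close> exactly if they are of the same type: the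
  same vertex, or inner points of edges with the same ends, of loops at the same vertex or of legs
  at the same vertex, or tips of legs at the same vertex (\<open>rigid_graph.KX_size\<close>). So the size of
  \<open>K(X)\<close> counts the vertices, the pairs of adjacent vertices, the vertices with loops and, twice,
  the vertices with legs. Attaching \<open>S_graph\<close> at the last vertex adds one new vertex with loops and
  legs and one new adjacent pair, which makes five new types, and it keeps the degrees different.

  Points of the same type are exchanged by a homeomorphism of \<open>X\<close> that swaps two edges and slides
  points along an edge. To separate the types, \<open>p\<close> is made a vertex by subdividing its edge. A
  subcontinuum \<open>A\<close> that contains \<open>p\<close> consists of its set \<open>J\<close> of vertices, of initial pieces of the
  edge germs (darts) at \<open>J\<close>, and of the edges that hold it together. After tiny gaps have been opened
  in all edges but those of a spanning tree of \<open>J\<close>, the remaining darts at \<open>J\<close> have free ends, and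
  moving these ends sweeps out a cell in the hyperspace. Its dimension is the sum of the degrees of
  \<open>J\<close> minus \<open>2 * (card J - 1)\<close>, and by invariance of domain there are no larger cells near \<open>A\<close>. This
  local dimension (\<open>ldim_hyperspace_at\<close>) is a topological invariant. Its least value is the degree of
  \<open>p\<close>, attained where \<open>p\<close> is the only vertex in \<open>A\<close>; the values on the closure of that part reveal
  the degrees of the vertices at the ends of the edge of \<open>p\<close>, hence the vertices.

  Only a leg and a loop at the same vertex \<open>v\<close> remain to be told apart. The subcontinua whose vertices
  are \<open>p\<close> and \<open>v\<close> form, for a leg, a single cell with part of its boundary, so its manifold points
  are connected. For a loop there are two ways to join \<open>p\<close> to \<open>v\<close>, and the two resulting parts meet
  only in subcontinua containing the whole loop. These are limits of boundary points of one part,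
  hence not manifold points, and the manifold points are disconnected.

  The first three graphs are treated separately: a simple closed curve is homogeneous, an arc has no
  branch points, and a simple triod is a vertex with three legs.
\<close>

section \<open>The topology of the hyperspace\<close>

lemma subcontinua_iff:
  assumes "compact X"
  shows "A \<in> subcontinua X \<longleftrightarrow> A \<noteq> {} \<and> compact A \<and> connected A \<and> A \<subseteq> X"
  using assms closedin_compact_eq[OF assms] unfolding subcontinua_def by auto

lemma topspace_hyperspace:
  assumes "compact X"
  shows "topspace (hyperspace X) = subcontinua X"
  unfolding hyperspace_def
  by (rule Metric_space.topspace_mtopology[OF Metric_space_subcontinua[OF assms]])

lemma openin_hyperspace:
  assumes "compact X"
  shows "openin (hyperspace X) U \<longleftrightarrow> U \<subseteq> subcontinua X \<and>
    (\<forall>A\<in>U. \<exists>r>0. \<forall>B\<in>subcontinua X. hausdorff_dist A B < r \<longrightarrow> B \<in> U)"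
proof -
  interpret Metric_space "subcontinua X" hausdorff_dist
    by (rule Metric_space_subcontinua[OF assms])
  have "mball A r \<subseteq> U \<longleftrightarrow> (\<forall>B\<in>subcontinua X. hausdorff_dist A B < r \<longrightarrow> B \<in> U)"
    if "A \<in> subcontinua X" for A r
    using that by auto
  then show ?thesis
    unfolding hyperspace_def openin_mtopology by blast
qed

lemma hausdorff_dist_le:
  assumes "A \<noteq> {}" "B \<noteq> {}" "0 \<le> e"
    and "\<And>a. a \<in> A \<Longrightarrow> \<exists>b\<in>B. dist a b \<le> e"
    and "\<And>b. b \<in> B \<Longrightarrow> \<exists>a\<in>A. dist b a \<le> e"
  shows "hausdorff_dist A B \<le> e"
proof -
  have "infdist a B \<le> e" if "a \<in> A" for a
    using assms(4)[OF that] infdist_le order_trans by metis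
  moreover have "infdist b A \<le> e" if "b \<in> B" for b
    using assms(5)[OF that] infdist_le order_trans by metis
  ultimately have "(SUP a\<in>A. infdist a B) \<le> e" "(SUP b\<in>B. infdist b A) \<le> e"
    using assms(1,2) by (auto intro: cSUP_least)
  then show ?thesis
    using assms(3) by (simp add: hausdorff_dist_def)
qed

lemma hausdorff_dist_less_imp_near:
  assumes "compact X" "A \<in> subcontinua X" "B \<in> subcontinua X" "hausdorff_dist A B < r" "a \<in> A"
  shows "\<exists>b\<in>B. dist a b < r"
proof -
  have "infdist a B < r"
    using infdist_le_hausdorff_dist[of A B a] assms compact_imp_bounded
    by (fastforce simp: subcontinua_iff[OF assms(1)])
  moreover have "B \<noteq> {}"
    using assms by (simp add: subcontinua_iff[OF assms(1)])
  ultimately have "(INF b\<in>B. dist a b) < r"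
    by (simp add: infdist_notempty)
  then show ?thesis
    using cINF_less_iff[of B "dist a" r] \<open>B \<noteq> {}\<close> by fastforce
qed

text \<open>Meeting a fixed open set and missing a fixed point are open conditions on a subcontinuum. All
  other conditions that have to be open below are derived from these two.\<close>

lemma openin_hyperspace_hit:
  assumes "compact X" "openin (top_of_set X) W"
  shows "openin (hyperspace X) {B \<in> subcontinua X. B \<inter> W \<noteq> {}}"
  unfolding openin_hyperspace[OF assms(1)]
proof (intro conjI ballI)
  fix A assume A: "A \<in> {B \<in> subcontinua X. B \<inter> W \<noteq> {}}"
  then obtain a where a: "a \<in> A" "a \<in> W" by auto
  obtain r where r: "r > 0" "\<And>y. y \<in> X \<Longrightarrow> dist y a < r \<Longrightarrow> y \<in> W"
    using assms(2) a(2) unfolding openin_euclidean_subtopology_iff by blast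
  have "B \<inter> W \<noteq> {}" if B: "B \<in> subcontinua X" "hausdorff_dist A B < r" for B
  proof -
    obtain b where b: "b \<in> B" "dist a b < r"
      using hausdorff_dist_less_imp_near[OF assms(1) _ B a(1)] A by blast
    then show ?thesis
      using r(2)[of b] B(1) by (auto simp: dist_commute subcontinua_iff[OF assms(1)])
  qed
  then show "\<exists>r>0. \<forall>B\<in>subcontinua X. hausdorff_dist A B < r \<longrightarrow> B \<in> {B \<in> subcontinua X. B \<inter> W \<noteq> {}}"
    using r(1) by blast
qed auto

lemma openin_hyperspace_miss:
  assumes "compact X"
  shows "openin (hyperspace X) {B \<in> subcontinua X. x \<notin> B}"
  unfolding openin_hyperspace[OF assms(1)]
proof (intro conjI ballI)
  fix A assume A: "A \<in> {B \<in> subcontinua X. x \<notin> B}"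
  then have "closed A" "A \<noteq> {}"
    by (auto simp: subcontinua_iff[OF assms] compact_imp_closed)
  then have r: "infdist x A > 0"
    using A by (simp add: infdist_pos_not_in_closed)
  have "x \<notin> B" if B: "B \<in> subcontinua X" "hausdorff_dist A B < infdist x A" for B
  proof
    assume "x \<in> B"
    then obtain a where "a \<in> A" "dist x a < infdist x A"
      using hausdorff_dist_less_imp_near[OF assms B(1), of A "infdist x A" x] B A
      by (auto simp: hausdorff_dist_commute[of A B])
    then show False
      using infdist_le[of a A x] by simp
  qed
  then show "\<exists>r>0. \<forall>B\<in>subcontinua X. hausdorff_dist A B < r \<longrightarrow> B \<in> {B \<in> subcontinua X. x \<notin> B}"
    using r by blast
qed auto

lemma openin_hyperspace_not_supset:
  assumes "compact X"
  shows "openin (hyperspace X) {B \<in> subcontinua X. \<not> S \<subseteq> B}"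
proof -
  have "{B \<in> subcontinua X. \<not> S \<subseteq> B} = (\<Union>x\<in>S. {B \<in> subcontinua X. x \<notin> B})"
    by auto
  then show ?thesis
    using openin_hyperspace_miss[OF assms] by (metis (no_types, lifting) image_iff openin_Union)
qed

abbreviation hyperspace_at :: "'a::metric_space \<Rightarrow> 'a set \<Rightarrow> 'a set topology" where
  "hyperspace_at p X \<equiv> subtopology (hyperspace X) (subcontinua_at p X)"

lemma topspace_hyperspace_at:
  assumes "compact X"
  shows "topspace (hyperspace_at p X) = subcontinua_at p X"
  using topspace_hyperspace[OF assms] by (auto simp: subcontinua_at_def)

section \<open>Finite graphs\<close>

text \<open>An edge is described by its darts: a dart is a simple path that leaves a vertex and meets
  the vertices at most in its ends. An edge between two vertices carries two darts, which are
  reversals of each other; a loop also carries two. An edge with a loose end carries only the dart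
  that starts at its vertex: its tip is not counted as a vertex. So a graph with tips need not have
  vertices of degree one; and as long as the degrees are at least two, a further vertex in a
  subcontinuum never lowers the dimension of the cells around it.\<close>

locale finite_graph =
  fixes X :: "'a::metric_space set" and V :: "'a set" and D :: "(real \<Rightarrow> 'a) set"
  assumes finite_V: "finite V" and finite_D: "finite D"
    and simple: "h \<in> D \<Longrightarrow> simple_path h"
    and start: "h \<in> D \<Longrightarrow> pathstart h \<in> V"
    and inner: "h \<in> D \<Longrightarrow> 0 < u \<Longrightarrow> u < 1 \<Longrightarrow> h u \<notin> V"
    and rev: "h \<in> D \<Longrightarrow> pathfinish h \<in> V \<Longrightarrow> reversepath h \<in> D"
    and disjoint: "h \<in> D \<Longrightarrow> h' \<in> D \<Longrightarrow> h' \<noteq> h \<Longrightarrow> h' \<noteq> reversepath h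
      \<Longrightarrow> path_image h \<inter> path_image h' \<subseteq> V"
    and space_eq: "X = V \<union> (\<Union>h\<in>D. path_image h)"
begin

lemma continuous_dart: "h \<in> D \<Longrightarrow> continuous_on {0..1} h"
  using simple by (simp add: simple_path_def path_def)

lemma dart_loop_free:
  "h \<in> D \<Longrightarrow> u \<in> {0..1} \<Longrightarrow> u' \<in> {0..1} \<Longrightarrow> h u = h u'
    \<Longrightarrow> u = u' \<or> u = 0 \<and> u' = 1 \<or> u = 1 \<and> u' = 0"
  using simple unfolding simple_path_def loop_free_def by blast

lemma compact_dart_image:
  assumes "h \<in> D" "0 \<le> a" "b \<le> 1"
  shows "compact (h ` {a..b})"
proof -
  have "continuous_on {a..b} h"
    by (rule continuous_on_subset[OF continuous_dart]) (use assms in auto)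
  then show ?thesis
    by (rule compact_continuous_image) simp
qed

lemma connected_dart_image:
  assumes "h \<in> D" "0 \<le> a" "b \<le> 1"
  shows "connected (h ` {a..b})"
proof -
  have "continuous_on {a..b} h"
    by (rule continuous_on_subset[OF continuous_dart]) (use assms in auto)
  then show ?thesis
    by (rule connected_continuous_image) simp
qed

lemma compact_path_image_dart: "h \<in> D \<Longrightarrow> compact (path_image h)"
  using compact_dart_image[of h 0 1] by (simp add: path_image_def)

lemma dart_image_subset: "h \<in> D \<Longrightarrow> path_image h \<subseteq> X"
  using space_eq by auto

lemma dart_in_X: "h \<in> D \<Longrightarrow> u \<in> {0..1} \<Longrightarrow> h u \<in> X"
  using dart_image_subset[of h] by (auto simp: path_image_def)

lemma V_subset: "V \<subseteq> X"
  using space_eq by auto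

lemma compact_X: "compact X"
  unfolding space_eq
  by (intro compact_Un finite_imp_compact finite_V compact_UN finite_D compact_path_image_dart)

lemma rev_neq: "h \<in> D \<Longrightarrow> reversepath h \<noteq> h"
  using dart_loop_free[of h "1/4" "3/4"] fun_cong[of "reversepath h" h "1/4"]
  unfolding reversepath_def by fastforce

lemma dart_point_unique:
  assumes h: "h \<in> D" "h' \<in> D" and u: "u \<in> {0..1}" "u' \<in> {0..1}"
    and eq: "h u = h' u'" and notin: "h u \<notin> V"
  shows "h' = h \<and> u' = u \<or> h' = reversepath h \<and> u' = 1 - u"
proof -
  have u0: "u \<noteq> 0"
    using start[OF h(1)] notin by (auto simp: pathstart_def)
  have u0': "u' \<noteq> 0"
    using start[OF h(2)] notin eq by (auto simp: pathstart_def)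
  have "h' = h \<or> h' = reversepath h"
    using disjoint[OF h] u eq notin by (fastforce simp: path_image_def)
  then show ?thesis
  proof
    assume "h' = h"
    then show ?thesis
      using dart_loop_free[OF h(1) u] eq u0 u0' by auto
  next
    assume hr: "h' = reversepath h"
    then have "h u = h (1 - u')"
      using eq by (simp add: reversepath_def)
    moreover have "u' \<noteq> 1 \<or> u \<noteq> 0" "h 0 \<in> V"
      using u0 start[OF h(1)] by (auto simp: pathstart_def)
    ultimately show ?thesis
      using dart_loop_free[OF h(1) u(1), of "1 - u'"] u eq u0 u0' hr notin by force
  qed
qed

lemma openin_dart_image:
  assumes h: "h \<in> D" and S: "openin (top_of_set {0..1}) S" and notin: "h ` S \<inter> V = {}"
  shows "openin (top_of_set X) (h ` S)"
proof -
  define K where "K = V \<union> (\<Union>h'\<in>D - {h, reversepath h}. path_image h') \<union> h ` ({0..1} - S)"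
  have S01: "S \<subseteq> {0..1}"
    using S openin_imp_subset by blast
  have "compact ({0..1} - S)"
    using S by (metis closedin_compact closedin_diff closedin_topspace compact_Icc topspace_euclidean_subtopology)
  moreover have "continuous_on ({0..1} - S) h"
    by (rule continuous_on_subset[OF continuous_dart[OF h]]) auto
  ultimately have "compact (h ` ({0..1} - S))"
    by (rule compact_continuous_image[rotated])
  moreover have "compact (\<Union>h'\<in>D - {h, reversepath h}. path_image h')"
    using finite_D compact_path_image_dart by (intro compact_UN) auto
  ultimately have "compact K"
    unfolding K_def by (simp add: compact_Un finite_imp_compact finite_V)
  moreover have "X - h ` S = K"
  proof
    show "X - h ` S \<subseteq> K"
    proof
      fix x assume x: "x \<in> X - h ` S"
      then consider "x \<in> V" | h' where "h' \<in> D" "x \<in> path_image h'"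
        unfolding space_eq by auto
      then show "x \<in> K"
      proof cases
        case 2
        show ?thesis
        proof (cases "h' = h \<or> h' = reversepath h")
          case True
          then have "x \<in> path_image h" using 2 by auto
          then obtain u where "u \<in> {0..1}" "x = h u" by (auto simp: path_image_def)
          then show ?thesis using x by (auto simp: K_def)
        qed (use 2 in \<open>auto simp: K_def\<close>)
      qed (simp add: K_def)
    qed
    have "x \<notin> h ` S" if "x \<in> K" for x
    proof
      assume "x \<in> h ` S"
      then obtain u where u: "u \<in> S" "x = h u" "h u \<notin> V"
        using notin by auto
      have "h u \<in> K" "u \<in> {0..1}" using that u S01 by auto
      then consider h' where "h' \<in> D" "h' \<noteq> h" "h' \<noteq> reversepath h" "h u \<in> path_image h'"
        | "h u \<in> h ` ({0..1} - S)"
        using u unfolding K_def by blast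
      then show False
      proof cases
        case 1
        then show False
          using disjoint[OF h, of h'] u \<open>u \<in> {0..1}\<close> unfolding path_image_def by blast
      next
        case 2
        then obtain u' where "u' \<in> {0..1}" "u' \<notin> S" "h u = h u'" by blast
        then show False
          using dart_point_unique[OF h h, of u u'] u \<open>u \<in> {0..1}\<close> rev_neq[OF h] by metis
      qed
    qed
    moreover have "K \<subseteq> X"
      unfolding K_def space_eq using h by (auto simp: path_image_def)
    ultimately show "K \<subseteq> X - h ` S"
      by auto
  qed
  ultimately have "closedin (top_of_set X) (X - h ` S)"
    using compact_imp_closed closed_subset by (metis Diff_subset)
  moreover have "h ` S \<subseteq> X"
    using S01 dart_in_X[OF h] by auto
  ultimately show ?thesis
    by (metis openin_closedin_eq topspace_euclidean_subtopology)
qed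

lemma openin_dart_interval:
  assumes "h \<in> D" "0 \<le> a" "b \<le> 1"
  shows "openin (top_of_set X) (h ` {a<..<b})"
proof (rule openin_dart_image[OF assms(1)])
  show "openin (top_of_set {0..1}) {a<..<b}"
    using assms by (intro open_subset) auto
  show "h ` {a<..<b} \<inter> V = {}"
    using inner[OF assms(1)] assms(2,3) by fastforce
qed

text \<open>A subcontinuum that contains a vertex cannot have gaps on both sides of a point on an edge: the
  piece between the gaps would be open and closed in it.\<close>

lemma subcontinuum_order:
  assumes A: "A \<in> subcontinua X" and p: "p \<in> A" "p \<in> V"
    and h: "h \<in> D" and u: "u \<in> {0..1}" "h u \<in> A"
  shows "h ` {0..u} \<subseteq> A \<or> pathfinish h \<in> V \<and> h ` {u..1} \<subseteq> A"
proof (rule ccontr)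
  assume neg: "\<not> ?thesis"
  then have "\<not> h ` {0..u} \<subseteq> A" by blast
  then obtain u1 where "u1 \<in> {0..u}" "h u1 \<notin> A" by blast
  then have u1: "0 \<le> u1" "u1 \<le> u" "h u1 \<notin> A" by auto
  then have u1': "u1 < u" using u by (cases "u1 = u") auto
  have A': "connected A" "A \<subseteq> X"
    using A subcontinua_iff[OF compact_X] by auto
  have no: False if S: "openin (top_of_set {0..1}) S" "u \<in> S" "h ` S \<inter> V = {}"
    and K: "K \<subseteq> {0..1}" "compact K" "A \<inter> h ` S = A \<inter> h ` K" for S K
  proof -
    have "openin (top_of_set A) (A \<inter> h ` S)"
      using openin_dart_image[OF h S(1,3)] A'(2) openin_subtopology_Int2
      by (metis inf.absorb_iff2 openin_Int_open openin_subtopology subtopology_subtopology inf_commute)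
    moreover have "compact (h ` K)"
      by (rule compact_continuous_image[OF continuous_on_subset[OF continuous_dart[OF h] K(1)] K(2)])
    then have "closedin (top_of_set A) (A \<inter> h ` S)"
      unfolding K(3) by (intro closedin_closed_Int compact_imp_closed)
    ultimately have "A \<inter> h ` S = {} \<or> A \<inter> h ` S = A"
      using A'(1) unfolding connected_clopen by blast
    then show False
      using S u p by auto
  qed
  show False
  proof (cases "pathfinish h \<in> V")
    case True
    then have "\<not> h ` {u..1} \<subseteq> A" using neg by blast
    then obtain u2 where "u2 \<in> {u..1}" "h u2 \<notin> A" by blast
    then have u2: "u \<le> u2" "u2 \<le> 1" "h u2 \<notin> A" by auto
    then have u2': "u < u2" using u by (cases "u2 = u") auto
    show False
    proof (rule no[of "{u1<..<u2}" "{u1..u2}"])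
      show "openin (top_of_set {0..1}) {u1<..<u2}"
        using u1 u2 by (intro open_subset) auto
      show "h ` {u1<..<u2} \<inter> V = {}"
        using inner[OF h] u1 u2 by fastforce
      have "x \<in> A \<inter> h ` {u1<..<u2}" if x: "x \<in> A \<inter> h ` {u1..u2}" for x
      proof -
        obtain y where y: "x = h y" "y \<in> {u1..u2}" using x by auto
        then have "y \<noteq> u1" "y \<noteq> u2" using x u1 u2 by auto
        then show ?thesis using x y by auto
      qed
      then show "A \<inter> h ` {u1<..<u2} = A \<inter> h ` {u1..u2}" by fastforce
    qed (use u1 u1' u2 u2' in auto)
  next
    case False
    show False
    proof (rule no[of "{u1<..1}" "{u1..1}"])
      have "{u1<..1} = {0..1} \<inter> {u1<..}" using u1 by auto
      then show "openin (top_of_set {0..1}) {u1<..1}"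
        by (metis open_greaterThan openin_open)
      show "h ` {u1<..1} \<inter> V = {}"
        using inner[OF h] u1 False by (force simp: pathfinish_def order.order_iff_strict)
      have "x \<in> A \<inter> h ` {u1<..1}" if x: "x \<in> A \<inter> h ` {u1..1}" for x
      proof -
        obtain y where y: "x = h y" "y \<in> {u1..1}" using x by auto
        then have "y \<noteq> u1" using x u1 by auto
        then show ?thesis using x y by auto
      qed
      then show "A \<inter> h ` {u1<..1} = A \<inter> h ` {u1..1}" by fastforce
    qed (use u u1 u1' in auto)
  qed
qed

definition extent :: "'a set \<Rightarrow> (real \<Rightarrow> 'a) \<Rightarrow> real" where
  "extent A h = Sup {u \<in> {0..1}. h ` {0..u} \<subseteq> A}"

lemma extent_props:
  assumes A: "A \<in> subcontinua X" and h: "h \<in> D" and s: "pathstart h \<in> A"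
  shows "extent A h \<in> {0..1}" "h ` {0..extent A h} \<subseteq> A"
    "\<And>u. u \<in> {0..1} \<Longrightarrow> h ` {0..u} \<subseteq> A \<longleftrightarrow> u \<le> extent A h"
proof -
  define S where "S = {u \<in> {0..1}. h ` {0..u} \<subseteq> A}"
  have ext: "extent A h = Sup S"
    by (simp add: extent_def S_def)
  have 0: "0 \<in> S"
    using s unfolding S_def pathstart_def by (simp del: image_subset_iff)
  have bdd: "bdd_above S"
    unfolding S_def by (rule bdd_aboveI[of _ 1]) auto
  have "Sup S \<le> 1"
    by (rule cSup_least) (use 0 in blast, simp add: S_def)
  moreover have "0 \<le> Sup S"
    using 0 bdd by (rule cSup_upper)
  ultimately show r: "extent A h \<in> {0..1}"
    by (simp add: ext)
  have lt: "h v \<in> A" if "0 \<le> v" "v < Sup S" for v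
  proof -
    have "\<exists>u\<in>S. v < u"
      using that less_cSup_iff[OF _ bdd, of v] 0 by auto
    then obtain u where "u \<in> S" "v < u"
      by auto
    then show ?thesis
      using that unfolding S_def by auto
  qed
  have cl: "closed A"
    using A subcontinua_iff[OF compact_X] compact_imp_closed by blast
  have "h (Sup S) \<in> A"
  proof (cases "Sup S = 0")
    case True
    then show ?thesis using s by (simp add: pathstart_def)
  next
    case False
    have "continuous_on {0..Sup S} h"
      by (rule continuous_on_subset[OF continuous_dart[OF h]]) (use r ext in auto)
    moreover have "closure {0..<Sup S} = {0..Sup S}"
      using False \<open>0 \<le> Sup S\<close> by simp
    ultimately have "h ` closure {0..<Sup S} \<subseteq> A"
      by (intro image_closure_subset[OF _ cl]) (use lt in auto)
    then show ?thesis
      using False \<open>0 \<le> Sup S\<close> by auto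
  qed
  show sub: "h ` {0..extent A h} \<subseteq> A"
  proof (rule image_subsetI)
    fix v assume "v \<in> {0..extent A h}"
    then have "0 \<le> v" "v < Sup S \<or> v = Sup S"
      by (auto simp: ext)
    then show "h v \<in> A"
      using lt \<open>h (Sup S) \<in> A\<close> by blast
  qed
  fix u :: real assume u: "u \<in> {0..1}"
  show "h ` {0..u} \<subseteq> A \<longleftrightarrow> u \<le> extent A h"
  proof
    assume "h ` {0..u} \<subseteq> A"
    then show "u \<le> extent A h"
      unfolding ext by (intro cSup_upper bdd) (use u in \<open>simp add: S_def\<close>)
  next
    assume "u \<le> extent A h"
    then show "h ` {0..u} \<subseteq> A"
      using sub by (auto simp: image_subset_iff)
  qed
qed

lemma reversepath_image: "reversepath h ` {0..u} = h ` {1-u..1}"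
proof -
  have "{1-u..1} = (\<lambda>v. 1 - v) ` {0..u}"
    by simp
  then show ?thesis
    unfolding reversepath_def by (metis image_image)
qed

lemma extent_eq_1_iff:
  assumes "A \<in> subcontinua X" "h \<in> D" "pathstart h \<in> A"
  shows "extent A h = 1 \<longleftrightarrow> path_image h \<subseteq> A"
  using extent_props(1)[OF assms] extent_props(3)[OF assms, of 1] unfolding path_image_def by auto

lemma subcontinuum_eq_extents:
  assumes A: "A \<in> subcontinua X" and p: "p \<in> A" "p \<in> V"
  shows "A = (A \<inter> V) \<union> (\<Union>h\<in>{h\<in>D. pathstart h \<in> A}. h ` {0..extent A h})"
proof
  show "(A \<inter> V) \<union> (\<Union>h\<in>{h\<in>D. pathstart h \<in> A}. h ` {0..extent A h}) \<subseteq> A"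
    using extent_props(2)[OF A] by blast
  show "A \<subseteq> (A \<inter> V) \<union> (\<Union>h\<in>{h\<in>D. pathstart h \<in> A}. h ` {0..extent A h})"
  proof
    fix x assume x: "x \<in> A"
    show "x \<in> (A \<inter> V) \<union> (\<Union>h\<in>{h\<in>D. pathstart h \<in> A}. h ` {0..extent A h})"
    proof (cases "x \<in> V")
      case False
      have "x \<in> X"
        using A x subcontinua_iff[OF compact_X] by auto
      then obtain h u where h: "h \<in> D" "u \<in> {0..1}" "x = h u"
        using False unfolding space_eq path_image_def by auto
      have *: "x \<in> g ` {0..extent A g} \<and> pathstart g \<in> A"
        if "g \<in> D" "v \<in> {0..1}" "x = g v" "g ` {0..v} \<subseteq> A" for g v
      proof -
        have "pathstart g \<in> A"
          using that by (auto simp: pathstart_def)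
        then show ?thesis
          using extent_props(3)[OF A \<open>g \<in> D\<close>, of v] that by auto
      qed
      consider "h ` {0..u} \<subseteq> A" | "pathfinish h \<in> V" "h ` {u..1} \<subseteq> A"
        using subcontinuum_order[OF A p h(1,2)] x h(3) by auto
      then show ?thesis
      proof cases
        case 1
        then show ?thesis using *[OF h] h(1) by blast
      next
        case 2
        then have "reversepath h \<in> D" using rev h(1) by blast
        have "reversepath h ` {0..1 - u} \<subseteq> A" "x = reversepath h (1 - u)"
          using 2 h by (simp_all add: reversepath_image) (simp add: reversepath_def)
        then show ?thesis
          using *[of "reversepath h" "1 - u"] h(2) \<open>reversepath h \<in> D\<close> by auto
      qed
    qed (use x in auto)
  qed
qed

end

context finite_graph
begin

section \<open>Spanning trees and cells of subcontinua\<close>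

definition darts_at :: "'a set \<Rightarrow> (real \<Rightarrow> 'a) set" where
  "darts_at J = {h \<in> D. pathstart h \<in> J}"

definition degree :: "'a \<Rightarrow> nat" where
  "degree v = card {h \<in> D. pathstart h = v}"

definition full :: "'a set \<Rightarrow> (real \<Rightarrow> 'a) set" where
  "full A = {h \<in> D. path_image h \<subseteq> A}"

text \<open>A spanning tree of \<open>J\<close> with \<open>n\<close> vertices has \<open>n - 1\<close> edges, hence \<open>2 * (n - 1)\<close> darts.\<close>

definition tree :: "'a set \<Rightarrow> (real \<Rightarrow> 'a) set \<Rightarrow> bool" where
  "tree J F \<longleftrightarrow> J \<subseteq> V \<and> J \<noteq> {} \<and> F \<subseteq> D \<and>
     (\<forall>h\<in>F. pathstart h \<in> J \<and> pathfinish h \<in> J \<and> reversepath h \<in> F) \<and>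
     connected (J \<union> (\<Union>h\<in>F. path_image h)) \<and> card F + 2 = 2 * card J"

lemma vertex_on_dart:
  assumes "h \<in> D" "u \<in> {0..1}" "h u \<in> V"
  shows "u = 0 \<or> u = 1"
  using inner[OF assms(1), of u] assms(2,3) by force

lemma full_imp_rev_full:
  assumes "h \<in> full A" "pathfinish h \<in> V"
  shows "reversepath h \<in> full A"
  using assms rev by (auto simp: full_def)

lemma full_imp_ends:
  assumes "h \<in> full A"
  shows "pathstart h \<in> A" "pathfinish h \<in> A"
  using assms by (auto simp: full_def)

lemma full_of_extents:
  assumes A: "A \<in> subcontinua X" and h: "h \<in> D" "pathstart h \<in> A"
    and f: "pathfinish h \<in> V" "pathfinish h \<in> A"
    and le: "1 \<le> extent A h + extent A (reversepath h)"
  shows "h \<in> full A"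
proof -
  have r: "reversepath h \<in> D" "pathstart (reversepath h) \<in> A"
    using rev h f by auto
  have 1: "h ` {0..extent A h} \<subseteq> A"
    by (rule extent_props(2)[OF A h])
  have 2: "h ` {1 - extent A (reversepath h)..1} \<subseteq> A"
    using extent_props(2)[OF A r] by (simp only: reversepath_image)
  have "h u \<in> A" if "u \<in> {0..1}" for u
  proof (cases "u \<le> extent A h")
    case True
    then show ?thesis using 1 that by (auto simp: image_subset_iff)
  next
    case False
    then show ?thesis using 2 le that by (auto simp: image_subset_iff)
  qed
  then show ?thesis
    using h by (auto simp: full_def path_image_def)
qed

text \<open>If no edge inside \<open>A\<close> left \<open>R\<close>, the parts of \<open>A\<close> hanging on \<open>R\<close> and on the other vertices
  would disconnect \<open>A\<close>.\<close>

lemma exists_full_dart_leaving: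
  assumes A: "A \<in> subcontinua X" and R: "R \<subseteq> A \<inter> V" "R \<noteq> {}" "R \<noteq> A \<inter> V"
  shows "\<exists>h\<in>full A. pathstart h \<in> R \<and> pathfinish h \<in> A \<inter> V - R"
proof (rule ccontr)
  assume neg: "\<not> ?thesis"
  obtain p where p: "p \<in> R" using R by auto
  have p': "p \<in> A" "p \<in> V" using p R by auto
  define part where "part Q = Q \<union> (\<Union>h\<in>darts_at Q. h ` {0..extent A h})" for Q
  have ext: "extent A h \<in> {0..1}" "h ` {0..extent A h} \<subseteq> A" if "h \<in> D" "pathstart h \<in> A" for h
    using extent_props[OF A that] by auto
  have clos: "closed (part Q)" if "Q \<subseteq> A \<inter> V" for Q
  proof -
    have "finite Q" using that finite_V finite_subset by blast
    moreover have "finite (darts_at Q)" unfolding darts_at_def using finite_D by auto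
    moreover have "compact (h ` {0..extent A h})" if "h \<in> darts_at Q" for h
      using compact_dart_image[of h 0 "extent A h"] ext(1)[of h] that \<open>Q \<subseteq> A \<inter> V\<close>
      by (auto simp: darts_at_def)
    ultimately have "compact (part Q)"
      unfolding part_def by (simp add: compact_Un compact_UN finite_imp_compact)
    then show ?thesis by (rule compact_imp_closed)
  qed
  have V_part: "x \<in> Q \<or> (\<exists>h\<in>full A. pathstart h \<in> Q \<and> pathfinish h = x)"
    if Q: "Q \<subseteq> A \<inter> V" and x: "x \<in> part Q" "x \<in> V" for Q x
  proof (cases "x \<in> Q")
    case False
    then obtain h u where h: "h \<in> D" "pathstart h \<in> Q" "u \<in> {0..extent A h}" "x = h u"
      using x(1) unfolding part_def darts_at_def by auto
    have s: "pathstart h \<in> A" using h Q by auto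
    have "u \<in> {0..1}" using h ext(1)[OF h(1) s] by auto
    then have "u = 0 \<or> u = 1" using vertex_on_dart h x by blast
    then have "u = 1" using False h by (auto simp: pathstart_def)
    then have "extent A h = 1" using h ext(1)[OF h(1) s] by auto
    then have "h \<in> full A" using extent_eq_1_iff[OF A h(1) s] h(1) by (auto simp: full_def)
    then show ?thesis using h \<open>u = 1\<close> by (auto simp: pathfinish_def)
  qed auto
  let ?S = "A \<inter> V - R"
  have "part R \<inter> part ?S = {}"
  proof (rule ccontr)
    assume "part R \<inter> part ?S \<noteq> {}"
    then obtain x where x: "x \<in> part R" "x \<in> part ?S" by auto
    show False
    proof (cases "x \<in> V")
      case True
      have xA: "x \<in> A"
        using x ext(2) R unfolding part_def darts_at_def by auto
      have 1: "x \<in> R"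
        using V_part[OF R(1) x(1) True] neg xA True by auto
      have "?S \<subseteq> A \<inter> V" by auto
      then obtain h where h: "h \<in> full A" "pathstart h \<in> ?S" "pathfinish h = x"
        using V_part[OF _ x(2) True] 1 by auto
      then have "reversepath h \<in> full A"
        using full_imp_rev_full True by auto
      then show False
        using neg h 1 by (auto dest!: bspec[of _ _ "reversepath h"])
    next
      case False
      then have nR: "x \<notin> R" "x \<notin> ?S" using R by auto
      obtain h u where h: "h \<in> D" "pathstart h \<in> R" "u \<in> {0..extent A h}" "x = h u"
        using x(1) nR unfolding part_def darts_at_def by auto
      obtain h' u' where h': "h' \<in> D" "pathstart h' \<in> ?S" "u' \<in> {0..extent A h'}" "x = h' u'"
        using x(2) nR unfolding part_def darts_at_def by auto
      have s: "pathstart h \<in> A" "pathstart h' \<in> A" using h h' R by auto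
      have u: "u \<in> {0..1}" "u' \<in> {0..1}"
        using h h' ext(1)[OF h(1) s(1)] ext(1)[OF h'(1) s(2)] by auto
      have "h' \<noteq> h" using h h' by auto
      then have hr: "h' = reversepath h" "u' = 1 - u"
        using dart_point_unique[OF h(1) h'(1) u] h h' False by auto
      then have "pathfinish h \<in> ?S" using h' by simp
      moreover have "h \<in> full A"
      proof (rule full_of_extents[OF A h(1) s(1)])
        show "1 \<le> extent A h + extent A (reversepath h)"
          using hr h h' by auto
      qed (use \<open>pathfinish h \<in> ?S\<close> in auto)
      ultimately show False using neg h by blast
    qed
  qed
  moreover have "A = part R \<union> part ?S"
  proof -
    have "darts_at R \<union> darts_at ?S = {h \<in> D. pathstart h \<in> A}"
      unfolding darts_at_def using R start by auto
    then have "part R \<union> part ?S = (A \<inter> V) \<union> (\<Union>h\<in>{h \<in> D. pathstart h \<in> A}. h ` {0..extent A h})"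
      using R(1) unfolding part_def by blast
    then show ?thesis
      using subcontinuum_eq_extents[OF A p'] by simp
  qed
  moreover have "connected A"
    using A subcontinua_iff[OF compact_X] by auto
  moreover have "closed (part R)" "closed (part ?S)"
    using clos[of R] clos[of ?S] R by auto
  moreover have "part R \<noteq> {}" "part ?S \<noteq> {}"
    using R unfolding part_def by auto
  ultimately show False
    using connected_closedD[of A "part R" "part ?S"] by auto
qed

text \<open>The tree is grown from \<open>p\<close> by one vertex and one edge at a time.\<close>

lemma exists_spanning_tree:
  assumes A: "A \<in> subcontinua X" and p: "p \<in> A" "p \<in> V"
  shows "\<exists>F. tree (A \<inter> V) F \<and> F \<subseteq> full A"
proof -
  let ?J = "A \<inter> V"
  have finJ: "finite ?J" using finite_V by auto
  have "\<exists>R F. R \<subseteq> ?J \<and> card R = Suc n \<and> tree R F \<and> F \<subseteq> full A" if "n < card ?J" for n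
    using that
  proof (induction n)
    case 0
    have "tree {p} {}"
      using p by (auto simp: tree_def)
    then show ?case
      using p by (intro exI[of _ "{p}"] exI[of _ "{}"]) auto
  next
    case (Suc n)
    then obtain R F where RF: "R \<subseteq> ?J" "card R = Suc n" "tree R F" "F \<subseteq> full A"
      by auto
    have "R \<noteq> {}" "R \<noteq> ?J" using RF Suc.prems by auto
    then obtain h where h: "h \<in> full A" "pathstart h \<in> R" "pathfinish h \<in> ?J - R"
      using exists_full_dart_leaving[OF A RF(1)] by blast
    define R' where "R' = insert (pathfinish h) R"
    define F' where "F' = insert h (insert (reversepath h) F)"
    have hD: "h \<in> D" using h by (simp add: full_def)
    have rh: "reversepath h \<in> full A" "reversepath h \<in> D"
      using full_imp_rev_full[OF h(1)] h by (auto simp: full_def)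
    have finR: "finite R" using RF(1) finJ finite_subset by blast
    have finF: "finite F" using RF(3) finite_D finite_subset unfolding tree_def by blast
    have nin: "h \<notin> F" "reversepath h \<notin> F" "reversepath h \<noteq> h"
      using RF(3) h rev_neq[OF hD] unfolding tree_def by auto
    have cR: "card R' = Suc (Suc n)" using RF(2) h finR by (simp add: R'_def)
    have "tree R' F'"
      unfolding tree_def
    proof (intro conjI)
      have "(J \<union> \<Union> (path_image ` F)) \<union> path_image h = insert (pathfinish h) J \<union> \<Union> (path_image ` F')" for J
        by (auto simp: F'_def)
      moreover have "connected ((R \<union> \<Union> (path_image ` F)) \<union> path_image h)"
      proof (rule connected_Un)
        show "connected (R \<union> \<Union> (path_image ` F))" using RF(3) by (simp add: tree_def)
        show "connected (path_image h)"
          using connected_dart_image[OF hD, of 0 1] by (simp add: path_image_def)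
        show "(R \<union> \<Union> (path_image ` F)) \<inter> path_image h \<noteq> {}"
          using h by auto
      qed
      ultimately show "connected (R' \<union> \<Union> (path_image ` F'))"
        by (simp add: R'_def)
      have "card F' = card F + 2"
        using nin finF unfolding F'_def by (subst card_insert_disjoint; force)+
      then show "card F' + 2 = 2 * card R'"
        using RF(2,3) cR by (simp add: tree_def)
      show "R' \<subseteq> V" "R' \<noteq> {}" using RF(1) h by (auto simp: R'_def)
      show "F' \<subseteq> D" using RF(3) hD rh by (auto simp: F'_def tree_def)
      show "\<forall>h\<in>F'. pathstart h \<in> R' \<and> pathfinish h \<in> R' \<and> reversepath h \<in> F'"
        using RF(3) h by (auto simp: F'_def R'_def tree_def)
    qed
    moreover have "R' \<subseteq> ?J" using RF(1) h by (auto simp: R'_def)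
    moreover have "F' \<subseteq> full A" using RF(4) h rh by (auto simp: F'_def)
    ultimately show ?case using cR by blast
  qed
  moreover have "card ?J - 1 < card ?J" "Suc (card ?J - 1) = card ?J"
  proof -
    have "0 < card ?J" using p finJ by (auto simp: card_gt_0_iff)
    then show "card ?J - 1 < card ?J" "Suc (card ?J - 1) = card ?J" by simp_all
  qed
  ultimately obtain R F where R: "R \<subseteq> ?J" "card R = card ?J" "tree R F" "F \<subseteq> full A"
    by metis
  then have "R = ?J" using finJ by (simp add: card_subset_eq)
  then show ?thesis using R by auto
qed

text \<open>Given a spanning tree \<open>F\<close> of \<open>J\<close>, a subcontinuum with vertex set \<open>J\<close> that contains \<open>F\<close> is
  determined by how far it reaches along the remaining darts. These lengths are the coordinates
  of a cell in the hyperspace.\<close>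

definition free :: "'a set \<Rightarrow> (real \<Rightarrow> 'a) set \<Rightarrow> (real \<Rightarrow> 'a) set" where
  "free J F = darts_at J - F"

definition cell :: "'a set \<Rightarrow> (real \<Rightarrow> 'a) set \<Rightarrow> ((real \<Rightarrow> 'a) \<Rightarrow> real) \<Rightarrow> 'a set" where
  "cell J F x = J \<union> (\<Union>h\<in>F. path_image h) \<union> (\<Union>h\<in>free J F. h ` {0..x h})"

text \<open>The lengths on the two darts of one edge sum to at most one. If the sum is less than one, the
  two pieces do not meet and the subcontinuum determines the lengths, even if some of them are zero;
  this holds for \<open>half_params\<close>. Only in \<open>open_params\<close> can every length be varied in both directions.\<close>

definition closed_params :: "'a set \<Rightarrow> (real \<Rightarrow> 'a) set \<Rightarrow> ((real \<Rightarrow> 'a) \<Rightarrow> real) set" where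
  "closed_params J F = {x. \<forall>h\<in>free J F. 0 \<le> x h \<and> x h \<le> 1 \<and>
     (pathfinish h \<in> J \<longrightarrow> x h + x (reversepath h) \<le> 1)}"

definition half_params :: "'a set \<Rightarrow> (real \<Rightarrow> 'a) set \<Rightarrow> ((real \<Rightarrow> 'a) \<Rightarrow> real) set" where
  "half_params J F = {x. \<forall>h\<in>free J F. 0 \<le> x h \<and> x h < 1 \<and>
     (pathfinish h \<in> J \<longrightarrow> x h + x (reversepath h) < 1)}"

definition open_params :: "'a set \<Rightarrow> (real \<Rightarrow> 'a) set \<Rightarrow> ((real \<Rightarrow> 'a) \<Rightarrow> real) set" where
  "open_params J F = {x. \<forall>h\<in>free J F. 0 < x h \<and> x h < 1 \<and>
     (pathfinish h \<in> J \<longrightarrow> x h + x (reversepath h) < 1)}"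

lemma open_params_subset: "open_params J F \<subseteq> half_params J F"
  by (force simp: open_params_def half_params_def)

lemma half_params_subset: "half_params J F \<subseteq> closed_params J F"
  by (force simp: closed_params_def half_params_def)

lemma treeD:
  assumes "tree J F"
  shows "J \<subseteq> V" "J \<noteq> {}" "F \<subseteq> D" "h \<in> F \<Longrightarrow> pathstart h \<in> J" "h \<in> F \<Longrightarrow> pathfinish h \<in> J"
    "h \<in> F \<Longrightarrow> reversepath h \<in> F" "connected (J \<union> (\<Union>h\<in>F. path_image h))"
    "card F + 2 = 2 * card J" "F \<subseteq> darts_at J"
  using assms by (auto simp: tree_def darts_at_def)

lemma free_D: "h \<in> free J F \<Longrightarrow> h \<in> D \<and> pathstart h \<in> J \<and> h \<notin> F"
  by (auto simp: free_def darts_at_def)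

lemma rev_free:
  assumes "tree J F" "h \<in> free J F" "pathfinish h \<in> J"
  shows "reversepath h \<in> free J F"
  using assms rev[of h] treeD(1)[OF assms(1)] treeD(6)[OF assms(1), of "reversepath h"]
  by (auto simp: free_def darts_at_def)

lemma cell_in_subcontinua:
  assumes t: "tree J F" and x: "x \<in> closed_params J F"
  shows "cell J F x \<in> subcontinua X" "J \<subseteq> cell J F x"
proof -
  let ?B = "J \<union> (\<Union>h\<in>F. path_image h)"
  have I: "h \<in> D" "pathstart h \<in> J" "0 \<le> x h" "x h \<le> 1" if "h \<in> free J F" for h
    using that x by (auto simp: closed_params_def dest: free_D)
  have fin: "finite J" "finite F" "finite (free J F)"
    using t finite_V finite_D unfolding tree_def free_def darts_at_def by (auto intro: finite_subset)
  have "connected (\<Union>(insert ?B ((\<lambda>h. ?B \<union> h ` {0..x h}) ` free J F)))"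
  proof (rule connected_Union)
    show "\<Inter>(insert ?B ((\<lambda>h. ?B \<union> h ` {0..x h}) ` free J F)) \<noteq> {}"
      using treeD(2)[OF t] by blast
    have "connected (?B \<union> h ` {0..x h})" if h: "h \<in> free J F" for h
    proof (rule connected_Un[OF treeD(7)[OF t]])
      show "connected (h ` {0..x h})"
        using connected_dart_image[of h 0 "x h"] I[OF h] by simp
      have "h 0 \<in> ?B \<inter> h ` {0..x h}"
        using I[OF h] by (auto simp: pathstart_def)
      then show "?B \<inter> h ` {0..x h} \<noteq> {}" by blast
    qed
    then show "\<And>S. S \<in> insert ?B ((\<lambda>h. ?B \<union> h ` {0..x h}) ` free J F) \<Longrightarrow> connected S"
      using treeD(7)[OF t] by auto
  qed
  moreover have "\<Union>(insert ?B ((\<lambda>h. ?B \<union> h ` {0..x h}) ` free J F)) = cell J F x"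
    unfolding cell_def by blast
  ultimately have "connected (cell J F x)" by simp
  moreover have "compact (\<Union>h\<in>F. path_image h)"
    using fin treeD(3)[OF t] compact_path_image_dart by (intro compact_UN) auto
  moreover have "compact (\<Union>h\<in>free J F. h ` {0..x h})"
    using fin compact_dart_image I by (intro compact_UN) auto
  ultimately have "connected (cell J F x)" "compact (cell J F x)"
    unfolding cell_def using fin by (simp_all add: compact_Un finite_imp_compact)
  moreover have "h ` {0..x h} \<subseteq> X" if "h \<in> free J F" for h
    using dart_in_X[of h] I[OF that] by auto
  then have "cell J F x \<subseteq> X"
    unfolding cell_def using treeD(1,3)[OF t] V_subset dart_image_subset by blast
  moreover show "J \<subseteq> cell J F x"
    unfolding cell_def by auto
  ultimately show "cell J F x \<in> subcontinua X"
    using treeD(2)[OF t] by (auto simp: subcontinua_iff[OF compact_X])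
qed

lemma uniformly_continuous_darts:
  assumes "e > 0"
  shows "\<exists>d>0. \<forall>h\<in>D. \<forall>u\<in>{0..1}. \<forall>v\<in>{0..1}. \<bar>u - v\<bar> < d \<longrightarrow> dist (h u) (h v) < e"
proof -
  have "\<exists>d>0. \<forall>h\<in>E. \<forall>u\<in>{0..1}. \<forall>v\<in>{0..1}. \<bar>u - v\<bar> < d \<longrightarrow> dist (h u) (h v) < e"
    if "finite E" "E \<subseteq> D" for E
    using that
  proof (induction E)
    case empty
    then show ?case by (auto intro: exI[of _ 1])
  next
    case (insert h E)
    then obtain d where d: "d > 0"
      "\<forall>h\<in>E. \<forall>u\<in>{0..1}. \<forall>v\<in>{0..1}. \<bar>u - v\<bar> < d \<longrightarrow> dist (h u) (h v) < e"
      by auto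
    have "uniformly_continuous_on {0..1} h"
      using insert.prems by (intro compact_uniformly_continuous continuous_dart) auto
    then obtain d' where d': "d' > 0"
      "\<forall>u\<in>{0..1}. \<forall>v\<in>{0..1}. dist v u < d' \<longrightarrow> dist (h v) (h u) < e"
      using assms unfolding uniformly_continuous_on_def by meson
    then have "\<forall>u\<in>{0..1}. \<forall>v\<in>{0..1}. \<bar>u - v\<bar> < d' \<longrightarrow> dist (h u) (h v) < e"
      by (simp add: dist_real_def)
    then show ?case
      using d d'(1) by (intro exI[of _ "min d d'"]) auto
  qed
  then show ?thesis using finite_D by blast
qed

lemma cell_continuous:
  assumes t: "tree J F" and e: "e > 0"
  shows "\<exists>d>0. \<forall>x\<in>closed_params J F. \<forall>y\<in>closed_params J F.
    (\<forall>h\<in>free J F. \<bar>x h - y h\<bar> < d) \<longrightarrow> hausdorff_dist (cell J F x) (cell J F y) < e"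
proof -
  obtain d where d: "d > 0"
    "\<And>h u v. h \<in> D \<Longrightarrow> u \<in> {0..1} \<Longrightarrow> v \<in> {0..1} \<Longrightarrow> \<bar>u - v\<bar> < d \<Longrightarrow> dist (h u) (h v) < e/2"
    using uniformly_continuous_darts[of "e/2"] e by auto
  have near: "\<exists>b\<in>cell J F y. dist a b \<le> e/2"
    if x: "x \<in> closed_params J F" and y: "y \<in> closed_params J F"
      and xy: "\<forall>h\<in>free J F. \<bar>x h - y h\<bar> < d" and a: "a \<in> cell J F x" for x y a
  proof (cases "a \<in> J \<union> (\<Union>h\<in>F. path_image h)")
    case True
    then show ?thesis using e by (intro bexI[of _ a]) (auto simp: cell_def)
  next
    case False
    then obtain h u where h: "h \<in> free J F" "u \<in> {0..x h}" "a = h u"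
      using a unfolding cell_def by auto
    let ?v = "min u (y h)"
    have b: "0 \<le> x h" "x h \<le> 1" "0 \<le> y h" "y h \<le> 1" "\<bar>x h - y h\<bar> < d"
      using x y xy h(1) by (auto simp: closed_params_def)
    have "dist (h u) (h ?v) < e/2"
      by (rule d(2)) (use free_D[OF h(1)] h(2) b in auto)
    moreover have "h ?v \<in> h ` {0..y h}"
      using h(2) b by auto
    then have "h ?v \<in> cell J F y"
      using h(1) unfolding cell_def by blast
    ultimately show ?thesis using h(3) by (intro bexI[of _ "h ?v"]) auto
  qed
  have "hausdorff_dist (cell J F x) (cell J F y) < e"
    if x: "x \<in> closed_params J F" and y: "y \<in> closed_params J F"
      and xy: "\<forall>h\<in>free J F. \<bar>x h - y h\<bar> < d" for x y
  proof -
    have "cell J F x \<noteq> {}" "cell J F y \<noteq> {}"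
      using treeD(2)[OF t] by (auto simp: cell_def)
    moreover have "\<forall>h\<in>free J F. \<bar>y h - x h\<bar> < d"
      using xy by (simp add: abs_minus_commute)
    ultimately have "hausdorff_dist (cell J F x) (cell J F y) \<le> e/2"
      using near[OF x y xy] near[OF y x] e by (intro hausdorff_dist_le) auto
    then show ?thesis using e by simp
  qed
  then show ?thesis using d(1) by blast
qed

lemma cell_member_iff:
  assumes t: "tree J F" and x: "x \<in> closed_params J F"
    and h: "h \<in> D" "u \<in> {0..1}" "h u \<notin> V"
  shows "h u \<in> cell J F x \<longleftrightarrow> h \<in> F \<or> h \<in> free J F \<and> u \<le> x h \<or>
    reversepath h \<in> free J F \<and> 1 - u \<le> x (reversepath h)"
proof
  assume "h u \<in> cell J F x"
  then consider h' u' where "h' \<in> F" "u' \<in> {0..1}" "h u = h' u'"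
    | h' u' where "h' \<in> free J F" "u' \<in> {0..x h'}" "h u = h' u'"
    using h(3) treeD(1)[OF t] unfolding cell_def path_image_def by blast
  then show "h \<in> F \<or> h \<in> free J F \<and> u \<le> x h \<or>
    reversepath h \<in> free J F \<and> 1 - u \<le> x (reversepath h)"
  proof cases
    case 1
    then have "h' = h \<or> h' = reversepath h"
      using dart_point_unique[OF h(1) _ h(2), of h' u'] h(3) treeD(3)[OF t] by auto
    then show ?thesis
      using 1(1) treeD(6)[OF t, of h'] by auto
  next
    case 2
    have "0 \<le> x h'" "x h' \<le> 1" "h' \<in> D"
      using x 2(1) free_D[OF 2(1)] by (auto simp: closed_params_def)
    then have "h' = h \<and> u' = u \<or> h' = reversepath h \<and> u' = 1 - u"
      using dart_point_unique[OF h(1) _ h(2), of h' u'] h(3) 2 by auto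
    then show ?thesis
      using 2(1,2) by auto
  qed
next
  assume "h \<in> F \<or> h \<in> free J F \<and> u \<le> x h \<or> reversepath h \<in> free J F \<and> 1 - u \<le> x (reversepath h)"
  then consider "h \<in> F" | "h \<in> free J F" "u \<le> x h" | "reversepath h \<in> free J F" "1 - u \<le> x (reversepath h)"
    by blast
  then show "h u \<in> cell J F x"
  proof cases
    case 1
    then show ?thesis using h(2) unfolding cell_def path_image_def by blast
  next
    case 2
    then have "h u \<in> h ` {0..x h}" using h(2) by auto
    then show ?thesis using 2 unfolding cell_def by blast
  next
    case 3
    then have "1 - u \<in> {0..x (reversepath h)}" using h(2) by auto
    moreover have "h u = reversepath h (1 - u)" by (simp add: reversepath_def)
    ultimately have "h u \<in> reversepath h ` {0..x (reversepath h)}" by blast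
    then show ?thesis using 3 unfolding cell_def by blast
  qed
qed

lemma half_params_cell:
  assumes t: "tree J F" and x: "x \<in> half_params J F"
  shows "cell J F x \<inter> V = J" "h \<in> free J F \<Longrightarrow> extent (cell J F x) h = x h" "full (cell J F x) = F"
proof -
  have xc: "x \<in> closed_params J F" using x half_params_subset by blast
  note C = cell_in_subcontinua[OF t xc]
  have I: "h \<in> D" "pathstart h \<in> J" "0 \<le> x h" "x h < 1" if "h \<in> free J F" for h
    using that x by (auto simp: half_params_def dest: free_D)
  show V: "cell J F x \<inter> V = J"
  proof
    show "cell J F x \<inter> V \<subseteq> J"
    proof
      fix a assume a: "a \<in> cell J F x \<inter> V"
      show "a \<in> J"
      proof (rule ccontr)
        assume "a \<notin> J"
        then consider h u where "h \<in> F" "u \<in> {0..1}" "a = h u"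
          | h u where "h \<in> free J F" "u \<in> {0..x h}" "a = h u"
          using a unfolding cell_def path_image_def by blast
        then show False
        proof cases
          case 1
          then have "u = 0 \<or> u = 1"
            using vertex_on_dart[of h u] treeD(3)[OF t] a by auto
          then show False
            using 1 treeD(4,5)[OF t 1(1)] \<open>a \<notin> J\<close> by (auto simp: pathstart_def pathfinish_def)
        next
          case 2
          then have "u = 0 \<or> u = 1"
            using vertex_on_dart[of h u] I[OF 2(1)] a by auto
          then show False
            using 2 I[OF 2(1)] \<open>a \<notin> J\<close> by (auto simp: pathstart_def)
        qed
      qed
    qed
    show "J \<subseteq> cell J F x \<inter> V" using C treeD(1)[OF t] by auto
  qed
  show ext: "extent (cell J F x) h = x h" if h: "h \<in> free J F" for h
  proof -
    have s: "pathstart h \<in> cell J F x" using I[OF h] C by auto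
    note e = extent_props[OF C(1) I(1)[OF h] s]
    have "h ` {0..x h} \<subseteq> cell J F x" unfolding cell_def using h by blast
    then have ge: "x h \<le> extent (cell J F x) h" using e(3)[of "x h"] I[OF h] by auto
    define m where "m = (if reversepath h \<in> free J F then 1 - x (reversepath h) else 1)"
    have m: "x h < m" "m \<le> 1"
    proof -
      have "pathfinish h \<in> J" if "reversepath h \<in> free J F"
        using I(2)[OF that] by simp
      then show "x h < m" using x h I[OF h] by (auto simp: m_def half_params_def)
      show "m \<le> 1" using I(3)[of "reversepath h"] by (auto simp: m_def)
    qed
    have "h u \<notin> cell J F x" if u: "x h < u" "u < m" for u
    proof -
      have "h u \<notin> V" using inner[OF I(1)[OF h], of u] u m I[OF h] by auto
      moreover have "h \<notin> F" using free_D[OF h] by simp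
      ultimately show ?thesis
        using cell_member_iff[OF t xc I(1)[OF h], of u] u m I[OF h] by (auto simp: m_def split: if_splits)
    qed
    moreover have "h u \<in> cell J F x" if "0 \<le> u" "u \<le> extent (cell J F x) h" for u
      using e(2) that by (auto simp: image_subset_iff)
    ultimately have "\<not> x h < extent (cell J F x) h"
    proof -
      assume *: "\<And>u. x h < u \<Longrightarrow> u < m \<Longrightarrow> h u \<notin> cell J F x"
        "\<And>u. 0 \<le> u \<Longrightarrow> u \<le> extent (cell J F x) h \<Longrightarrow> h u \<in> cell J F x"
      show ?thesis
      proof
        assume "x h < extent (cell J F x) h"
        then obtain u where "x h < u" "u < min m (extent (cell J F x) h)"
          using m dense[of "x h" "min m (extent (cell J F x) h)"] by auto
        then show False using *[of u] I[OF h] by auto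
      qed
    qed
    then show ?thesis using ge by simp
  qed
  show "full (cell J F x) = F"
  proof
    show "F \<subseteq> full (cell J F x)"
      using treeD(3)[OF t] unfolding full_def cell_def by blast
    show "full (cell J F x) \<subseteq> F"
    proof
      fix h assume h: "h \<in> full (cell J F x)"
      then have hD: "h \<in> D" and s: "pathstart h \<in> cell J F x"
        using full_imp_ends by (auto simp: full_def)
      then have "pathstart h \<in> J" using V start by blast
      then have "h \<in> darts_at J" using hD by (simp add: darts_at_def)
      moreover have "h \<notin> free J F"
      proof
        assume "h \<in> free J F"
        then show False
          using ext[of h] I[of h] extent_eq_1_iff[OF C(1) hD s] h by (auto simp: full_def)
      qed
      ultimately show "h \<in> F" by (simp add: free_def)
    qed
  qed
qed

text \<open>Along an edge of \<open>A\<close> outside the tree the two coordinates may be chosen freely with sum one: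
  the two pieces meet somewhere on the edge.\<close>

lemma cell_representation:
  assumes A: "A \<in> subcontinua X" and t: "tree (A \<inter> V) F" "F \<subseteq> full A"
    and ext: "\<And>h. h \<in> free (A \<inter> V) F \<Longrightarrow> h \<notin> full A \<Longrightarrow> x h = extent A h"
    and loose: "\<And>h. h \<in> free (A \<inter> V) F \<Longrightarrow> h \<in> full A \<Longrightarrow> pathfinish h \<notin> V \<Longrightarrow> x h = 1"
    and edge: "\<And>h. h \<in> free (A \<inter> V) F \<Longrightarrow> h \<in> full A \<Longrightarrow> pathfinish h \<in> V
      \<Longrightarrow> 0 \<le> x h \<and> x h + x (reversepath h) = 1"
  shows "x \<in> closed_params (A \<inter> V) F" "cell (A \<inter> V) F x = A"
proof -
  let ?J = "A \<inter> V"
  obtain p where p: "p \<in> A" "p \<in> V" using treeD(2)[OF t(1)] by auto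
  have I: "h \<in> D" "pathstart h \<in> A" if "h \<in> free ?J F" for h
    using that by (auto dest: free_D)
  have full_edge: "0 \<le> x h" "x h \<le> 1" "x h + x (reversepath h) = 1"
    if h: "h \<in> free ?J F" "h \<in> full A" "pathfinish h \<in> V" for h
  proof -
    have "pathfinish h \<in> ?J" using h full_imp_ends by auto
    then have "reversepath h \<in> free ?J F" by (rule rev_free[OF t(1) h(1)])
    moreover have "reversepath h \<in> full A" by (rule full_imp_rev_full[OF h(2,3)])
    moreover have "pathfinish (reversepath h) \<in> V" using I[OF h(1)] start by simp
    ultimately have "0 \<le> x (reversepath h)" using edge by blast
    then show "0 \<le> x h" "x h \<le> 1" "x h + x (reversepath h) = 1" using edge[OF h] by auto
  qed
  have le_ext: "x h \<le> extent A h" if h: "h \<in> free ?J F" for h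
  proof (cases "h \<in> full A")
    case True
    then have "extent A h = 1"
      using extent_eq_1_iff[OF A I[OF h]] by (simp add: full_def)
    then show ?thesis using full_edge[OF h True] loose[OF h True] by (cases "pathfinish h \<in> V") auto
  qed (use ext[OF h] in auto)
  show xc: "x \<in> closed_params ?J F"
    unfolding closed_params_def
  proof (clarify, intro conjI impI)
    fix h assume h: "h \<in> free ?J F"
    have e: "extent A h \<in> {0..1}" by (rule extent_props(1)[OF A I[OF h]])
    show "0 \<le> x h" "x h \<le> 1"
      using e ext[OF h] loose[OF h] full_edge[OF h] by (cases "h \<in> full A"; cases "pathfinish h \<in> V"; auto)+
    assume fin: "pathfinish h \<in> ?J"
    have r: "reversepath h \<in> free ?J F" by (rule rev_free[OF t(1) h fin])
    show "x h + x (reversepath h) \<le> 1"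
    proof (cases "h \<in> full A")
      case True
      then show ?thesis using full_edge[OF h] fin by auto
    next
      case False
      then have "extent A h + extent A (reversepath h) < 1"
        using full_of_extents[OF A I[OF h]] fin by force
      then show ?thesis using le_ext[OF h] le_ext[OF r] by linarith
    qed
  qed
  show "cell ?J F x = A"
  proof
    have "h ` {0..x h} \<subseteq> A" if h: "h \<in> free ?J F" for h
    proof -
      have "{0..x h} \<subseteq> {0..extent A h}" using le_ext[OF h] by auto
      then show ?thesis using extent_props(2)[OF A I[OF h]] by blast
    qed
    then show "cell ?J F x \<subseteq> A"
      unfolding cell_def using t(2) by (auto simp: full_def)
    show "A \<subseteq> cell ?J F x"
    proof
      fix a assume a: "a \<in> A"
      show "a \<in> cell ?J F x"
      proof (cases "a \<in> V")
        case True
        then show ?thesis using a by (auto simp: cell_def)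
      next
        case False
        then obtain h u where h: "h \<in> D" "pathstart h \<in> A" "u \<in> {0..extent A h}" "a = h u"
          using a subcontinuum_eq_extents[OF A p] by blast
        have u: "u \<in> {0..1}" using h extent_props(1)[OF A h(1,2)] by auto
        have notin: "h u \<notin> V" using False h by simp
        note mem = cell_member_iff[OF t(1) xc h(1) u notin]
        have hJ: "h \<in> F \<or> h \<in> free ?J F"
          using h start by (auto simp: free_def darts_at_def)
        show ?thesis
        proof (cases "h \<in> free ?J F \<and> h \<in> full A \<and> pathfinish h \<in> V")
          case True
          then have "reversepath h \<in> free ?J F"
            using rev_free[OF t(1), of h] full_imp_ends[of h A] by auto
          then show ?thesis using mem True full_edge(3)[of h] h(4) by force
        next
          case 2: False
          then have "x h = extent A h" if "h \<in> free ?J F"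
          proof (cases "h \<in> full A")
            case True
            then show ?thesis
              using 2 that loose[OF that] extent_eq_1_iff[OF A h(1,2)] by (auto simp: full_def)
          qed (use ext that in auto)
          then show ?thesis using mem hJ h(3,4) by auto
        qed
      qed
    qed
  qed
qed

lemma cell_representation_exists:
  assumes A: "A \<in> subcontinua X" and t: "tree (A \<inter> V) F" "F \<subseteq> full A"
  shows "\<exists>x\<in>closed_params (A \<inter> V) F. cell (A \<inter> V) F x = A"
proof -
  let ?x = "\<lambda>h. if h \<in> full A then if pathfinish h \<in> V then 1/2 else 1 else extent A h"
  have *: "?x h + ?x (reversepath h) = 1"
    if h: "h \<in> free (A \<inter> V) F" "h \<in> full A" "pathfinish h \<in> V" for h
  proof -
    have "reversepath h \<in> full A" "pathfinish (reversepath h) \<in> V"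
      using full_imp_rev_full h free_D[OF h(1)] by auto
    then show ?thesis using h by simp
  qed
  have "?x \<in> closed_params (A \<inter> V) F" "cell (A \<inter> V) F ?x = A"
    by (rule cell_representation[OF A t]; use * in auto)+
  then show ?thesis by blast
qed

text \<open>All strict inequalities hold at the point with all lengths \<open>1/4\<close>, so moving a little towards it
  leads from the closed into the open parameter set.\<close>

definition shrink :: "real \<Rightarrow> ((real \<Rightarrow> 'a) \<Rightarrow> real) \<Rightarrow> (real \<Rightarrow> 'a) \<Rightarrow> real" where
  "shrink e x = (\<lambda>h. (1 - e) * x h + e / 4)"

lemma shrink_in_open_params:
  assumes x: "x \<in> closed_params J F" and e: "0 < e" "e < 1"
  shows "shrink e x \<in> open_params J F" "h \<in> free J F \<Longrightarrow> \<bar>shrink e x h - x h\<bar> \<le> e"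
proof -
  have "0 < (1 - e) * x h + e/4" "(1 - e) * x h + e/4 < 1" "\<bar>(1 - e) * x h + e/4 - x h\<bar> \<le> e"
    if h: "h \<in> free J F" for h
  proof -
    have b: "0 \<le> x h" "x h \<le> 1" using x h by (auto simp: closed_params_def)
    have 1: "0 \<le> (1 - e) * x h" using b e by simp
    have 2: "(1 - e) * x h \<le> 1 - e" using b e by (simp add: mult_left_le)
    have 3: "0 \<le> e * x h" "e * x h \<le> e" using b e by (simp_all add: mult_left_le)
    have 4: "(1 - e) * x h = x h - e * x h" by (simp add: algebra_simps)
    show "0 < (1 - e) * x h + e/4" "(1 - e) * x h + e/4 < 1" "\<bar>(1 - e) * x h + e/4 - x h\<bar> \<le> e"
      using 1 2 3 4 e by linarith+
  qed
  moreover have "(1 - e) * x h + e/4 + ((1 - e) * x (reversepath h) + e/4) < 1"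
    if "h \<in> free J F" "pathfinish h \<in> J" for h
  proof -
    have "x h + x (reversepath h) \<le> 1" using x that by (auto simp: closed_params_def)
    then have "(1 - e) * (x h + x (reversepath h)) \<le> 1 - e" using e by (simp add: mult_left_le)
    then show ?thesis using e by (simp add: algebra_simps)
  qed
  ultimately show "shrink e x \<in> open_params J F" "h \<in> free J F \<Longrightarrow> \<bar>shrink e x h - x h\<bar> \<le> e"
    by (auto simp: open_params_def shrink_def)
qed

end

section \<open>Local dimension\<close>

definition has_cell :: "nat \<Rightarrow> 'b topology \<Rightarrow> 'b set \<Rightarrow> bool" where
  "has_cell k Y U \<longleftrightarrow> (\<exists>W c. openin (Euclidean_space k) W \<and> W \<noteq> {} \<and>
     continuous_map (subtopology (Euclidean_space k) W) Y c \<and> inj_on c W \<and> c ` W \<subseteq> U)"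

definition ldim_ge :: "'b topology \<Rightarrow> 'b \<Rightarrow> nat \<Rightarrow> bool" where
  "ldim_ge Y a k \<longleftrightarrow> (\<forall>U. openin Y U \<and> a \<in> U \<longrightarrow> has_cell k Y U)"

text \<open>The small cells need not contain the point, which may lie on the boundary of the cells around it
  or in the intersection of several of them.\<close>

definition ldim :: "'b topology \<Rightarrow> nat \<Rightarrow> 'b set" where
  "ldim Y k = {a \<in> topspace Y. ldim_ge Y a k \<and> \<not> ldim_ge Y a (Suc k)}"

lemma topspace_sub_Euclidean_space:
  "openin (Euclidean_space k) W \<Longrightarrow> topspace (subtopology (Euclidean_space k) W) = W"
  using openin_subset by (metis topspace_subtopology_subset)

lemma continuous_map_Euclidean_space_coordinate:
  "continuous_map (Euclidean_space k) euclideanreal (\<lambda>x. x i)"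
  unfolding Euclidean_space_def
  by (intro continuous_map_from_subtopology continuous_map_product_projection) auto

lemma continuous_map_into_Euclidean_space:
  assumes "\<And>i. i < k \<Longrightarrow> continuous_map Z euclideanreal (\<lambda>x. f x i)"
    and "\<And>x i. x \<in> topspace Z \<Longrightarrow> k \<le> i \<Longrightarrow> f x i = 0"
  shows "continuous_map Z (Euclidean_space k) f"
proof -
  have "continuous_map Z (Euclidean_space k) (\<lambda>x i. if i < k then f x i else 0)"
    using assms(1) by (simp add: continuous_map_componentwise_Euclidean_space)
  then show ?thesis
    by (rule continuous_map_eq) (use assms(2) in \<open>auto simp: fun_eq_iff\<close>)
qed

lemma openin_Euclidean_space_move:
  assumes W: "openin (Euclidean_space k) W" and x: "x \<in> W" and j: "j < k"
  shows "\<exists>t < x j. x(j := t) \<in> W"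
proof -
  have x0: "x i = 0" if "k \<le> i" for i
    using openin_subset[OF W] x that by (auto simp: topspace_Euclidean_space)
  have "continuous_map euclideanreal (Euclidean_space k) (\<lambda>t. x(j := t))"
    by (rule continuous_map_into_Euclidean_space) (use x0 j in auto)
  then have "openin euclideanreal {t \<in> topspace euclideanreal. x(j := t) \<in> W}"
    using W by (rule openin_continuous_map_preimage)
  then have op: "open {t. x(j := t) \<in> W}" by simp
  have "x j \<in> {t. x(j := t) \<in> W}" using x by simp
  then obtain e where e: "e > 0" "\<And>t. dist t (x j) < e \<Longrightarrow> x(j := t) \<in> W"
    using op unfolding open_dist by (metis mem_Collect_eq)
  have "x(j := x j - e/2) \<in> W" "x j - e/2 < x j"
    using e by (auto simp: dist_real_def)
  then show ?thesis by blast
qed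

lemma has_cell_antimono:
  assumes "j \<le> k" "has_cell k Y U"
  shows "has_cell j Y U"
proof -
  obtain W c where W: "openin (Euclidean_space k) W" "W \<noteq> {}"
    and c: "continuous_map (subtopology (Euclidean_space k) W) Y c" "inj_on c W" "c ` W \<subseteq> U"
    using assms(2) by (auto simp: has_cell_def)
  obtain z where z: "z \<in> W" using W by auto
  have z0: "z i = 0" if "k \<le> i" for i
    using openin_subset[OF W(1)] z that by (auto simp: topspace_Euclidean_space)
  define f where "f x = (\<lambda>i. if i < j then x i else z i)" for x :: "nat \<Rightarrow> real"
  have f: "continuous_map (Euclidean_space j) (Euclidean_space k) f"
  proof (rule continuous_map_into_Euclidean_space)
    fix i
    show "continuous_map (Euclidean_space j) euclideanreal (\<lambda>x. f x i)"
      using continuous_map_Euclidean_space_coordinate by (cases "i < j") (auto simp: f_def)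
  qed (use z0 assms(1) in \<open>auto simp: f_def\<close>)
  define W' where "W' = {x \<in> topspace (Euclidean_space j). f x \<in> W}"
  have W': "openin (Euclidean_space j) W'"
    unfolding W'_def using f W(1) by (rule openin_continuous_map_preimage)
  have "f (\<lambda>i. if i < j then z i else 0) = z"
    by (auto simp: f_def)
  then have "(\<lambda>i. if i < j then z i else 0) \<in> W'"
    using z by (auto simp: W'_def topspace_Euclidean_space)
  moreover have "continuous_map (subtopology (Euclidean_space j) W') Y (c \<circ> f)"
  proof (rule continuous_map_compose[OF _ c(1)])
    show "continuous_map (subtopology (Euclidean_space j) W') (subtopology (Euclidean_space k) W) f"
      unfolding continuous_map_in_subtopology
      using f by (auto simp: W'_def intro: continuous_map_from_subtopology)
  qed
  moreover have "inj_on (c \<circ> f) W'"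
  proof (rule comp_inj_on)
    show "inj_on f W'"
    proof (rule inj_onI)
      fix x y assume "x \<in> W'" "y \<in> W'" "f x = f y"
      then show "x = y"
        by (auto simp: W'_def f_def fun_eq_iff topspace_Euclidean_space) (metis not_le)
    qed
    show "inj_on c (f ` W')"
      using c(2) by (rule inj_on_subset) (auto simp: W'_def)
  qed
  moreover have "(c \<circ> f) ` W' \<subseteq> U"
    using c(3) by (auto simp: W'_def)
  ultimately show ?thesis
    using W' unfolding has_cell_def by blast
qed

lemma has_cell_mono: "has_cell k Y U \<Longrightarrow> U \<subseteq> U' \<Longrightarrow> has_cell k Y U'"
  unfolding has_cell_def by blast

text \<open>If \<open>d < k\<close>, the cell would embed as an open subset of Euclidean \<open>k\<close>-space on which the coordinate
  \<open>d\<close> vanishes.\<close>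

lemma has_cell_imp_le:
  assumes cell: "has_cell k Y U"
    and f: "continuous_map (subtopology Y U) (Euclidean_space d) f" "inj_on f U"
  shows "k \<le> d"
proof (rule ccontr)
  assume "\<not> k \<le> d"
  then have d: "d < k" by simp
  obtain W c where W: "openin (Euclidean_space k) W" "W \<noteq> {}"
    and c: "continuous_map (subtopology (Euclidean_space k) W) Y c" "inj_on c W" "c ` W \<subseteq> U"
    using cell by (auto simp: has_cell_def)
  have "continuous_map (subtopology (Euclidean_space k) W) (subtopology Y U) c"
    unfolding continuous_map_in_subtopology using c by auto
  then have fc: "continuous_map (subtopology (Euclidean_space k) W) (Euclidean_space d) (f \<circ> c)"
    using f(1) by (rule continuous_map_compose)
  have zero: "(f \<circ> c) x i = 0" if "x \<in> W" "d \<le> i" for x i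
    using continuous_map_image_subset_topspace[OF fc] that openin_subset[OF W(1)]
    by (auto simp: topspace_Euclidean_space)
  have "continuous_map (subtopology (Euclidean_space k) W) (Euclidean_space k) (f \<circ> c)"
  proof (rule continuous_map_into_Euclidean_space)
    fix i
    show "continuous_map (subtopology (Euclidean_space k) W) euclideanreal (\<lambda>x. (f \<circ> c) x i)"
      using continuous_map_compose[OF fc continuous_map_Euclidean_space_coordinate[of d i]]
      by (simp add: o_def)
  qed (use zero d in auto)
  moreover have "inj_on (f \<circ> c) W"
    using c f(2) by (intro comp_inj_on) (auto intro: inj_on_subset)
  ultimately have op: "openin (Euclidean_space k) ((f \<circ> c) ` W)"
    using invariance_of_domain_Euclidean_space W(1) by blast
  obtain x where x: "x \<in> W" using W(2) by auto
  then obtain t where t: "t < (f \<circ> c) x d" "((f \<circ> c) x)(d := t) \<in> (f \<circ> c) ` W"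
    using openin_Euclidean_space_move[OF op _ d] by blast
  obtain y where y: "y \<in> W" "((f \<circ> c) x)(d := t) = (f \<circ> c) y"
    using t(2) by auto
  have "t = (f \<circ> c) y d"
    by (metis y(2) fun_upd_same)
  then show False
    using t(1) zero[OF x, of d] zero[OF y(1), of d] by simp
qed

lemma ldim_unique:
  assumes "a \<in> ldim Y j" "a \<in> ldim Y k"
  shows "j = k"
proof -
  have "ldim_ge Y a i" if "i \<le> k" "ldim_ge Y a k" for i k
    using that has_cell_antimono unfolding ldim_ge_def by blast
  then show ?thesis
    using assms unfolding ldim_def by (metis (no_types, lifting) mem_Collect_eq not_less_eq_eq le_antisym)
qed

lemma has_cell_homeomorphic_image:
  assumes "homeomorphic_map Y Z f" "has_cell k Y U" "U \<subseteq> topspace Y"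
  shows "has_cell k Z (f ` U)"
proof -
  obtain W c where W: "openin (Euclidean_space k) W" "W \<noteq> {}"
    and c: "continuous_map (subtopology (Euclidean_space k) W) Y c" "inj_on c W" "c ` W \<subseteq> U"
    using assms(2) by (auto simp: has_cell_def)
  have "continuous_map (subtopology (Euclidean_space k) W) Z (f \<circ> c)"
    using c(1) homeomorphic_imp_continuous_map[OF assms(1)] by (rule continuous_map_compose)
  moreover have "inj_on (f \<circ> c) W"
    using c assms(3) homeomorphic_imp_injective_map[OF assms(1)]
    by (intro comp_inj_on) (auto intro: inj_on_subset)
  ultimately show ?thesis
    using W c(3) unfolding has_cell_def by (intro exI[of _ W] exI[of _ "f \<circ> c"]) auto
qed

lemma ldim_homeomorphic_image:
  assumes "homeomorphic_map Y Z f"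
  shows "f ` ldim Y k = ldim Z k"
proof -
  have ge: "ldim_ge Z (f a) k" if f: "homeomorphic_map Y Z f" and a: "a \<in> topspace Y" "ldim_ge Y a k"
    for f :: "'c \<Rightarrow> 'd" and Y Z a k
    unfolding ldim_ge_def
  proof (intro allI impI)
    fix U assume U: "openin Z U \<and> f a \<in> U"
    define U' where "U' = {x \<in> topspace Y. f x \<in> U}"
    have "openin Y U'"
      unfolding U'_def using homeomorphic_imp_continuous_map[OF f] U
      by (blast intro: openin_continuous_map_preimage)
    moreover have "a \<in> U'" using a U by (simp add: U'_def)
    ultimately have "has_cell k Y U'" using a by (auto simp: ldim_ge_def)
    then have "has_cell k Z (f ` U')"
      by (rule has_cell_homeomorphic_image[OF f]) (auto simp: U'_def)
    then show "has_cell k Z U"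
      by (rule has_cell_mono) (auto simp: U'_def)
  qed
  obtain g where g: "homeomorphic_maps Y Z f g"
    using assms homeomorphic_map_maps by blast
  then have g': "homeomorphic_map Z Y g" "\<And>x. x \<in> topspace Y \<Longrightarrow> g (f x) = x"
    "\<And>x. x \<in> topspace Z \<Longrightarrow> f (g x) = x"
    by (auto simp: homeomorphic_maps_map)
  have top: "f ` topspace Y = topspace Z"
    by (rule homeomorphic_imp_surjective_map[OF assms])
  have iff: "ldim_ge Z (f a) k \<longleftrightarrow> ldim_ge Y a k" if "a \<in> topspace Y" for a k
    using ge[OF assms that] ge[OF g'(1), of "f a"] g'(2)[OF that] that top by auto
  show ?thesis
  proof
    show "f ` ldim Y k \<subseteq> ldim Z k"
      using iff top by (auto simp: ldim_def)
    show "ldim Z k \<subseteq> f ` ldim Y k"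
    proof
      fix z assume z: "z \<in> ldim Z k"
      then obtain a where "a \<in> topspace Y" "z = f a"
        using top by (auto simp: ldim_def)
      then show "z \<in> f ` ldim Y k"
        using z iff[of a] by (auto simp: ldim_def)
    qed
  qed
qed

definition manifold_points :: "nat \<Rightarrow> 'b topology \<Rightarrow> 'b set" where
  "manifold_points k Y = {a. \<exists>U W. openin Y U \<and> a \<in> U \<and> openin (Euclidean_space k) W \<and>
     subtopology (Euclidean_space k) W homeomorphic_space subtopology Y U}"

lemma openin_manifold_points: "openin Y (manifold_points k Y)"
proof -
  have "manifold_points k Y = \<Union>{U. openin Y U \<and> (\<exists>W. openin (Euclidean_space k) W \<and>
     subtopology (Euclidean_space k) W homeomorphic_space subtopology Y U)}"
    by (auto simp: manifold_points_def)
  then show ?thesis by (auto intro: openin_Union)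
qed

lemma manifold_points_homeomorphic_image:
  assumes "homeomorphic_map Y Z f"
  shows "f ` manifold_points k Y = manifold_points k Z"
proof -
  have sub: "f ` manifold_points k Y \<subseteq> manifold_points k Z"
    if f: "homeomorphic_map Y Z f" for f :: "'c \<Rightarrow> 'd" and Y Z
  proof
    fix z assume "z \<in> f ` manifold_points k Y"
    then obtain a U W where a: "z = f a" "openin Y U" "a \<in> U" "openin (Euclidean_space k) W"
      "subtopology (Euclidean_space k) W homeomorphic_space subtopology Y U"
      by (auto simp: manifold_points_def)
    have U: "U \<subseteq> topspace Y" using a(2) by (rule openin_subset)
    have "openin Z (f ` U)"
      using homeomorphic_map_openness[OF f U] a(2) by simp
    moreover have "homeomorphic_map (subtopology Y U) (subtopology Z (f ` U)) f"
    proof (rule homeomorphic_map_subtopologies[OF f])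
      show "f ` (topspace Y \<inter> U) = topspace Z \<inter> f ` U"
        using U homeomorphic_imp_surjective_map[OF f] by blast
    qed
    then have "subtopology (Euclidean_space k) W homeomorphic_space subtopology Z (f ` U)"
      using a(5) homeomorphic_map_imp_homeomorphic_space homeomorphic_space_trans by blast
    ultimately show "z \<in> manifold_points k Z"
      using a unfolding manifold_points_def by blast
  qed
  obtain g where g: "homeomorphic_maps Y Z f g"
    using assms homeomorphic_map_maps by blast
  then have g': "homeomorphic_map Z Y g" "\<And>x. x \<in> topspace Z \<Longrightarrow> f (g x) = x"
    by (auto simp: homeomorphic_maps_map)
  have "z \<in> f ` manifold_points k Y" if "z \<in> manifold_points k Z" for z
  proof -
    have "z \<in> topspace Z" by (rule subsetD[OF openin_subset[OF openin_manifold_points] that])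
    then have "z = f (g z)" using g' by simp
    then show ?thesis using sub[OF g'(1)] that by blast
  qed
  then show ?thesis using sub[OF assms] by blast
qed

text \<open>Invariance of domain makes an injectively parametrised open cell consist of manifold points,
  provided that the space embeds near the cell into Euclidean space of the same dimension.\<close>

lemma cell_subset_manifold_points:
  assumes U: "openin Y U" and f: "continuous_map (subtopology Y U) (Euclidean_space k) f" "inj_on f U"
    and W: "openin (Euclidean_space k) W"
    and c: "continuous_map (subtopology (Euclidean_space k) W) Y c" "inj_on c W" "c ` W \<subseteq> U"
  shows "c ` W \<subseteq> manifold_points k Y"
proof -
  let ?E = "Euclidean_space k"
  have topW: "topspace (subtopology ?E W) = W" using W by (rule topspace_sub_Euclidean_space)
  have topU: "topspace (subtopology Y U) = U"
    using openin_subset[OF U] by (metis topspace_subtopology_subset)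
  have cU: "continuous_map (subtopology ?E W) (subtopology Y U) c"
    unfolding continuous_map_in_subtopology using c topW by auto
  have fc: "continuous_map (subtopology ?E W) ?E (f \<circ> c)"
    using cU f(1) by (rule continuous_map_compose)
  have inj: "inj_on (f \<circ> c) W"
    using c f(2) by (intro comp_inj_on) (auto intro: inj_on_subset)
  let ?S = "(f \<circ> c) ` W"
  have S: "openin ?E ?S"
    using invariance_of_domain_Euclidean_space[OF W fc inj] .
  have "embedding_map (subtopology ?E W) ?E (f \<circ> c)"
    by (rule invariance_of_domain_Euclidean_space_embedding_map[OF W fc inj])
  then have "homeomorphic_map (subtopology ?E W) (subtopology ?E ?S) (f \<circ> c)"
    unfolding embedding_map_def topW .
  then obtain g where g: "homeomorphic_maps (subtopology ?E W) (subtopology ?E ?S) (f \<circ> c) g"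
    using homeomorphic_map_maps by blast
  let ?C = "c ` W"
  have "{a \<in> topspace (subtopology Y U). f a \<in> ?S} = ?C"
    using c(3) f(2) unfolding topU by (auto simp: inj_on_def)
  then have "openin (subtopology Y U) ?C"
    using openin_continuous_map_preimage[OF f(1) S] by simp
  then have C: "openin Y ?C"
    using U openin_trans_full by blast
  have "homeomorphic_maps (subtopology ?E W) (subtopology Y ?C) c (g \<circ> f)"
    unfolding homeomorphic_maps_def
  proof (intro conjI ballI)
    show "continuous_map (subtopology ?E W) (subtopology Y ?C) c"
      unfolding continuous_map_in_subtopology using c(1) topW by auto
    have "continuous_map (subtopology Y ?C) (subtopology ?E ?S) f"
      unfolding continuous_map_in_subtopology
      using continuous_map_from_subtopology_mono[OF f(1) c(3)] by auto
    moreover have "continuous_map (subtopology ?E ?S) (subtopology ?E W) g"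
      using g by (simp add: homeomorphic_maps_def)
    ultimately show "continuous_map (subtopology Y ?C) (subtopology ?E W) (g \<circ> f)"
      by (rule continuous_map_compose)
    have inv: "g (f (c x)) = x" if "x \<in> W" for x
      using g that topW by (simp add: homeomorphic_maps_def)
    then show "(g \<circ> f) (c x) = x" if "x \<in> topspace (subtopology ?E W)" for x
      using that topW by simp
    show "c ((g \<circ> f) a) = a" if "a \<in> topspace (subtopology Y ?C)" for a
      using that inv by auto
  qed
  then have "subtopology ?E W homeomorphic_space subtopology Y ?C"
    unfolding homeomorphic_space_def by blast
  then show ?thesis
    using C W unfolding manifold_points_def by blast
qed

text \<open>An open subset of Euclidean space contains points on both sides of the value of any coordinate.\<close>

lemma boundary_not_manifold_point:
  assumes U: "openin Y U" "a \<in> U"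
    and f: "continuous_map (subtopology Y U) (Euclidean_space k) f" "inj_on f U"
    and j: "j < k" "\<And>b. b \<in> U \<Longrightarrow> f a j \<le> f b j"
  shows "a \<notin> manifold_points k Y"
proof
  let ?E = "Euclidean_space k"
  assume "a \<in> manifold_points k Y"
  then obtain U' W c g where U': "openin Y U'" "a \<in> U'" and W: "openin ?E W"
    and cg: "homeomorphic_maps (subtopology ?E W) (subtopology Y U') c g"
    unfolding manifold_points_def homeomorphic_space_def by blast
  have topW: "topspace (subtopology ?E W) = W" using W by (rule topspace_sub_Euclidean_space)
  have topU': "topspace (subtopology Y U') = U'"
    using openin_subset[OF U'(1)] by (metis topspace_subtopology_subset)
  have c: "continuous_map (subtopology ?E W) (subtopology Y U') c"
    and gc: "\<And>x. x \<in> W \<Longrightarrow> g (c x) = x" and cga: "c (g a) = a" and ga: "g a \<in> W"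
  proof -
    show "continuous_map (subtopology ?E W) (subtopology Y U') c" "\<And>x. x \<in> W \<Longrightarrow> g (c x) = x" "c (g a) = a"
      using cg topW topU' U' by (auto simp: homeomorphic_maps_def)
    have "continuous_map (subtopology Y U') (subtopology ?E W) g"
      using cg by (simp add: homeomorphic_maps_def)
    then show "g a \<in> W"
      using continuous_map_image_subset_topspace topW topU' U'(2) by blast
  qed
  have cY: "continuous_map (subtopology ?E W) Y c"
    using c by (simp add: continuous_map_in_subtopology)
  define W' where "W' = {x \<in> topspace (subtopology ?E W). c x \<in> U}"
  have W'W: "W' \<subseteq> W" using topW by (auto simp: W'_def)
  have "openin (subtopology ?E W) W'"
    unfolding W'_def using cY U(1) by (rule openin_continuous_map_preimage)
  then have W': "openin ?E W'" using W openin_trans_full by blast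
  have "continuous_map (subtopology ?E W') (subtopology Y U) c"
    unfolding continuous_map_in_subtopology
    using continuous_map_from_subtopology_mono[OF cY W'W] by (auto simp: W'_def)
  then have fc: "continuous_map (subtopology ?E W') ?E (f \<circ> c)"
    using f(1) by (rule continuous_map_compose)
  have "inj_on c W'"
    using gc W'W by (metis inj_on_def subsetD)
  then have "inj_on (f \<circ> c) W'"
    using f(2) by (intro comp_inj_on) (auto simp: W'_def intro: inj_on_subset)
  then have op: "openin ?E ((f \<circ> c) ` W')"
    using invariance_of_domain_Euclidean_space[OF W' fc] by blast
  have "g a \<in> W'" using ga cga U(2) topW by (simp add: W'_def)
  then have "f a \<in> (f \<circ> c) ` W'" using cga by force
  then obtain t where t: "t < f a j" "(f a)(j := t) \<in> (f \<circ> c) ` W'"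
    using openin_Euclidean_space_move[OF op _ j(1)] by blast
  then obtain y where y: "y \<in> W'" "(f a)(j := t) = (f \<circ> c) y" by auto
  then have "f (c y) j = t" by (metis fun_upd_same comp_apply)
  then show False
    using j(2)[of "c y"] t(1) y(1) by (auto simp: W'_def)
qed

section \<open>Local dimension of the hyperspace of a graph\<close>

lemma Euclidean_space_top_of_set: "Euclidean_space k = top_of_set {x. \<forall>i\<ge>k. x i = 0}"
  by (simp add: Euclidean_space_def euclidean_product_topology)

text \<open>Cells are parametrised by finite sets of darts, but \<open>Euclidean_space\<close> has the coordinates
  \<open>0, 1, 2, \<dots>\<close>; a numbering of the finite set translates between the two.\<close>

definition enum :: "'b set \<Rightarrow> nat \<Rightarrow> 'b" where
  "enum I = (SOME e. bij_betw e {..<card I} I)"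

definition index :: "'b set \<Rightarrow> 'b \<Rightarrow> nat" where
  "index I = inv_into {..<card I} (enum I)"

lemma enum_index:
  assumes "finite I"
  shows "i < card I \<Longrightarrow> enum I i \<in> I" "i < card I \<Longrightarrow> index I (enum I i) = i"
    "h \<in> I \<Longrightarrow> index I h < card I" "h \<in> I \<Longrightarrow> enum I (index I h) = h"
proof -
  have b: "bij_betw (enum I) {..<card I} I"
    using ex_bij_betw_nat_finite[OF assms] unfolding enum_def atLeast0LessThan by (rule someI_ex)
  show "i < card I \<Longrightarrow> enum I i \<in> I"
    using b by (auto simp: bij_betw_def)
  show "i < card I \<Longrightarrow> index I (enum I i) = i"
    using b by (simp add: index_def bij_betw_def)
  show "h \<in> I \<Longrightarrow> index I h < card I"
    using b inv_into_into[of h "enum I" "{..<card I}"] by (auto simp: index_def bij_betw_def)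
  show "h \<in> I \<Longrightarrow> enum I (index I h) = h"
    using b f_inv_into_f[of h "enum I" "{..<card I}"] by (auto simp: index_def bij_betw_def)
qed

context finite_graph
begin

text \<open>The length of \<open>A\<close> along \<open>h\<close> is continuous as long as \<open>A\<close> does not contain the whole edge.
  It is discontinuous where a loop closes up.\<close>

lemma continuous_extent:
  assumes h: "h \<in> D"
  shows "continuous_map (subtopology (hyperspace X) {A \<in> subcontinua X. pathstart h \<in> A \<and> h \<notin> full A})
    euclideanreal (\<lambda>A. extent A h)"
proof -
  let ?S = "{A \<in> subcontinua X. pathstart h \<in> A \<and> h \<notin> full A}"
  let ?Z = "subtopology (hyperspace X) ?S"
  have top: "topspace ?Z = ?S"
    by (auto simp: topspace_hyperspace[OF compact_X])
  have gap: "\<exists>u. extent A h < u \<and> u < b \<and> u \<in> {0..1} \<and> h u \<notin> A"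
    if A: "A \<in> ?S" and b: "extent A h < b" for A b
  proof -
    have A': "A \<in> subcontinua X" "pathstart h \<in> A" using A by auto
    note e = extent_props[OF A'(1) h A'(2)]
    have "extent A h \<noteq> 1" using A h extent_eq_1_iff[OF A'(1) h A'(2)] by (auto simp: full_def)
    then have "extent A h < min b 1" using b e(1) by auto
    then obtain w where w: "extent A h < w" "w < min b 1" using dense by blast
    then have "\<not> h ` {0..w} \<subseteq> A" using e(1) e(3)[of w] by auto
    then obtain u where u: "u \<in> {0..w}" "h u \<notin> A" by blast
    have "extent A h < u"
    proof (rule ccontr)
      assume "\<not> extent A h < u"
      then have "u \<in> {0..extent A h}" using u by auto
      then show False using e(2) u(2) by blast
    qed
    then show ?thesis using u w by (intro exI[of _ u]) auto
  qed
  have less: "openin ?Z {A \<in> topspace ?Z. extent A h < b}" for b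
    unfolding top
  proof (subst openin_subopen, intro ballI)
    fix A assume A: "A \<in> {A \<in> ?S. extent A h < b}"
    then obtain u where u: "extent A h < u" "u < b" "u \<in> {0..1}" "h u \<notin> A" using gap by blast
    let ?T = "?S \<inter> {B \<in> subcontinua X. h u \<notin> B}"
    have "openin ?Z ?T"
      using openin_hyperspace_miss[OF compact_X] by (rule openin_subtopology_Int2)
    moreover have "A \<in> ?T" using A u by auto
    moreover have "?T \<subseteq> {A \<in> ?S. extent A h < b}"
    proof
      fix B assume B: "B \<in> ?T"
      then have "u \<notin> {0..extent B h}"
        using extent_props(2)[of B h] h by blast
      then show "B \<in> {A \<in> ?S. extent A h < b}" using u B by auto
    qed
    ultimately show "\<exists>T. openin ?Z T \<and> A \<in> T \<and> T \<subseteq> {A \<in> ?S. extent A h < b}" by blast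
  qed
  have greater: "openin ?Z {A \<in> topspace ?Z. extent A h > b}" for b
    unfolding top
  proof (subst openin_subopen, intro ballI)
    fix A assume A: "A \<in> {A \<in> ?S. extent A h > b}"
    then have A': "A \<in> subcontinua X" "pathstart h \<in> A" by auto
    note e = extent_props[OF A'(1) h A'(2)]
    show "\<exists>T. openin ?Z T \<and> A \<in> T \<and> T \<subseteq> {A \<in> ?S. extent A h > b}"
    proof (cases "b < 0")
      case True
      have "extent B h > b" if "B \<in> ?S" for B
        using extent_props(1)[of B h] h that True by auto
      then have "?S \<subseteq> {A \<in> ?S. extent A h > b}" by auto
      moreover have "openin ?Z ?S" using openin_topspace[of ?Z] unfolding top .
      ultimately show ?thesis using A by blast
    next
      case False
      obtain u where u: "extent A h < u" "u < extent A h + 1" "u \<in> {0..1}" "h u \<notin> A"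
        using gap[of A "extent A h + 1"] A by auto
      let ?T = "?S \<inter> ({B \<in> subcontinua X. h u \<notin> B} \<inter> {B \<in> subcontinua X. B \<inter> h ` {b<..<u} \<noteq> {}})"
      have "openin (top_of_set X) (h ` {b<..<u})"
        using openin_dart_interval[OF h, of b u] False u by auto
      then have "openin ?Z ?T"
        by (intro openin_subtopology_Int2 openin_Int openin_hyperspace_miss openin_hyperspace_hit compact_X)
      moreover have "A \<in> ?T"
      proof -
        have "extent A h \<in> {0..extent A h}" using e(1) by simp
        then have "h (extent A h) \<in> A" using e(2) by blast
        moreover have "extent A h \<in> {b<..<u}" using A u(1) by simp
        ultimately have "A \<inter> h ` {b<..<u} \<noteq> {}" by blast
        then show ?thesis using A u(4) by simp
      qed
      moreover have "?T \<subseteq> {A \<in> ?S. extent A h > b}"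
      proof
        fix B assume B: "B \<in> ?T"
        then have "B \<inter> h ` {b<..<u} \<noteq> {}" by blast
        then obtain v where v: "v \<in> {b<..<u}" "h v \<in> B" by blast
        have B': "B \<in> subcontinua X" "pathstart h \<in> B" using B by auto
        have v1: "v \<in> {0..1}" using v u False by auto
        have "h ` {0..v} \<subseteq> B \<or> pathfinish h \<in> V \<and> h ` {v..1} \<subseteq> B"
          by (rule subcontinuum_order[OF B' start[OF h] h v1 v(2)])
        moreover have "u \<in> {v..1}" "h u \<notin> B" using u v B by auto
        ultimately have "h ` {0..v} \<subseteq> B" by blast
        then have "v \<le> extent B h" using extent_props(3)[OF B'(1) h B'(2) v1] by simp
        then show "B \<in> {A \<in> ?S. extent A h > b}" using v B by auto
      qed
      ultimately show ?thesis by blast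
    qed
  qed
  show ?thesis
    unfolding continuous_map_upper_lower_semicontinuous_lt using less greater by blast
qed

definition coords :: "'a set \<Rightarrow> (real \<Rightarrow> 'a) set \<Rightarrow> 'a set \<Rightarrow> nat \<Rightarrow> real" where
  "coords J F A = (\<lambda>i. if i < card (free J F) then extent A (enum (free J F) i) else 0)"

definition point_cell :: "'a set \<Rightarrow> (real \<Rightarrow> 'a) set \<Rightarrow> (nat \<Rightarrow> real) \<Rightarrow> 'a set" where
  "point_cell J F x = cell J F (\<lambda>h. x (index (free J F) h))"

definition open_box :: "'a set \<Rightarrow> (real \<Rightarrow> 'a) set \<Rightarrow> (nat \<Rightarrow> real) set" where
  "open_box J F = {x \<in> topspace (Euclidean_space (card (free J F))).
     (\<lambda>h. x (index (free J F) h)) \<in> open_params J F}"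

lemma finite_free: "finite (free J F)"
  using finite_D by (auto simp: free_def darts_at_def)

lemma finite_darts_at: "finite (darts_at J)"
  using finite_D by (auto simp: darts_at_def)

lemma cell_cong: "(\<And>h. h \<in> free J F \<Longrightarrow> x h = y h) \<Longrightarrow> cell J F x = cell J F y"
  unfolding cell_def by auto

lemma openin_open_box:
  assumes t: "tree J F"
  shows "openin (Euclidean_space (card (free J F))) (open_box J F)"
proof -
  let ?I = "free J F"
  let ?i = "index ?I"
  have c: "continuous_on UNIV (\<lambda>x :: nat \<Rightarrow> real. x i)" for i
    by (rule continuous_on_product_coordinates)
  have "open {x :: nat \<Rightarrow> real. 0 < x (?i h) \<and> x (?i h) < 1 \<and> (pathfinish h \<in> J \<longrightarrow> x (?i h) + x (?i (reversepath h)) < 1)}" for h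
  proof (cases "pathfinish h \<in> J")
    case True
    then show ?thesis
      by simp (intro open_Collect_conj open_Collect_less continuous_on_add continuous_on_const c)
  next
    case False
    then show ?thesis
      by simp (intro open_Collect_conj open_Collect_less continuous_on_const c)
  qed
  then have "open (\<Inter>h\<in>?I. {x :: nat \<Rightarrow> real. 0 < x (?i h) \<and> x (?i h) < 1 \<and> (pathfinish h \<in> J \<longrightarrow> x (?i h) + x (?i (reversepath h)) < 1)})"
    using finite_free by (intro open_INT) auto
  then have "openin (Euclidean_space (card ?I)) ({x. \<forall>i\<ge>card ?I. x i = 0} \<inter>
      (\<Inter>h\<in>?I. {x. 0 < x (?i h) \<and> x (?i h) < 1 \<and> (pathfinish h \<in> J \<longrightarrow> x (?i h) + x (?i (reversepath h)) < 1)}))"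
    unfolding Euclidean_space_top_of_set by (rule openin_open_Int)
  moreover have "open_box J F = {x. \<forall>i\<ge>card ?I. x i = 0} \<inter>
      (\<Inter>h\<in>?I. {x. 0 < x (?i h) \<and> x (?i h) < 1 \<and> (pathfinish h \<in> J \<longrightarrow> x (?i h) + x (?i (reversepath h)) < 1)})"
    unfolding set_eq_iff by (simp add: open_box_def open_params_def topspace_Euclidean_space)
  ultimately show ?thesis
    by simp
qed

lemma continuous_point_cell:
  assumes t: "tree J F"
  shows "continuous_map (subtopology (Euclidean_space (card (free J F))) (open_box J F)) (hyperspace X) (point_cell J F)"
proof -
  interpret M: Metric_space "subcontinua X" hausdorff_dist
    by (rule Metric_space_subcontinua[OF compact_X])
  let ?I = "free J F"
  let ?i = "index ?I"
  let ?E = "Euclidean_space (card ?I)"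
  have clo: "(\<lambda>h. x (?i h)) \<in> closed_params J F" if "x \<in> open_box J F" for x
    using that open_params_subset half_params_subset unfolding open_box_def by blast
  have top: "topspace (subtopology ?E (open_box J F)) = open_box J F"
    by (rule topspace_sub_Euclidean_space[OF openin_open_box[OF t]])
  show ?thesis
    unfolding hyperspace_def M.continuous_map_to_metric top
  proof (intro ballI allI impI)
    fix x and e :: real assume x: "x \<in> open_box J F" and e: "e > 0"
    obtain d where d: "d > 0" "\<And>x y. x \<in> closed_params J F \<Longrightarrow> y \<in> closed_params J F \<Longrightarrow>
        (\<forall>h\<in>free J F. \<bar>x h - y h\<bar> < d) \<Longrightarrow> hausdorff_dist (cell J F x) (cell J F y) < e"
      using cell_continuous[OF t e] by blast
    let ?O = "\<Inter>h\<in>?I. {y :: nat \<Rightarrow> real. \<bar>x (?i h) - y (?i h)\<bar> < d}"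
    have "open ?O"
      using finite_free
      by (intro open_INT ballI open_Collect_less continuous_on_rabs continuous_on_diff continuous_on_const
          continuous_on_product_coordinates)
    then have "openin ?E ({y. \<forall>i\<ge>card ?I. y i = 0} \<inter> ?O)"
      unfolding Euclidean_space_top_of_set by (rule openin_open_Int)
    then have "openin (subtopology ?E (open_box J F)) (open_box J F \<inter> ({y. \<forall>i\<ge>card ?I. y i = 0} \<inter> ?O))"
      by (rule openin_subtopology_Int2)
    moreover have "x \<in> open_box J F \<inter> ({y. \<forall>i\<ge>card ?I. y i = 0} \<inter> ?O)"
      using x d(1) by (auto simp: open_box_def topspace_Euclidean_space)
    moreover have "point_cell J F y \<in> M.mball (point_cell J F x) e"
      if "y \<in> open_box J F \<inter> ({y. \<forall>i\<ge>card ?I. y i = 0} \<inter> ?O)" for y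
      using d(2)[OF clo[OF x] clo[of y]] that cell_in_subcontinua(1)[OF t clo[OF x]]
        cell_in_subcontinua(1)[OF t clo[of y]]
      by (auto simp: point_cell_def)
    ultimately show "\<exists>U. openin (subtopology ?E (open_box J F)) U \<and> x \<in> U \<and>
        (\<forall>y\<in>U. point_cell J F y \<in> M.mball (point_cell J F x) e)"
      by blast
  qed
qed

lemma point_cell_props:
  assumes t: "tree J F" and x: "x \<in> open_box J F"
  shows "point_cell J F x \<in> subcontinua X" "point_cell J F x \<inter> V = J" "full (point_cell J F x) = F"
    "coords J F (point_cell J F x) = x"
proof -
  let ?I = "free J F"
  have o: "(\<lambda>h. x (index ?I h)) \<in> half_params J F"
    using x open_params_subset unfolding open_box_def by blast
  then have c: "(\<lambda>h. x (index ?I h)) \<in> closed_params J F"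
    using half_params_subset by blast
  show "point_cell J F x \<in> subcontinua X" "point_cell J F x \<inter> V = J" "full (point_cell J F x) = F"
    using cell_in_subcontinua[OF t c] half_params_cell[OF t o] by (auto simp: point_cell_def)
  show "coords J F (point_cell J F x) = x"
  proof
    fix i
    show "coords J F (point_cell J F x) i = x i"
      using half_params_cell(2)[OF t o] enum_index(1,2)[OF finite_free[of J F], of i] x
      by (auto simp: coords_def point_cell_def open_box_def topspace_Euclidean_space)
  qed
qed

lemma inj_point_cell:
  assumes t: "tree J F"
  shows "inj_on (point_cell J F) (open_box J F)"
  by (rule inj_on_inverseI[of _ "coords J F"]) (rule point_cell_props(4)[OF t])

text \<open>This provides open cells near the subcontinua whose parameters lie on the boundary, for example
  those that contain an edge outside the tree.\<close>

lemma open_cell_nearby: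
  assumes t: "tree J F" and x: "x \<in> closed_params J F"
    and U: "openin (hyperspace X) U" "cell J F x \<in> U"
  shows "\<exists>y\<in>open_box J F. point_cell J F y \<in> U"
proof -
  let ?I = "free J F"
  have "\<exists>r>0. \<forall>B\<in>subcontinua X. hausdorff_dist (cell J F x) B < r \<longrightarrow> B \<in> U"
    using U unfolding openin_hyperspace[OF compact_X] by (elim conjE) (rule bspec)
  then obtain r where r: "r > 0" "\<And>B. B \<in> subcontinua X \<Longrightarrow> hausdorff_dist (cell J F x) B < r \<Longrightarrow> B \<in> U"
    by blast
  obtain d where d: "d > 0" "\<And>x y. x \<in> closed_params J F \<Longrightarrow> y \<in> closed_params J F \<Longrightarrow>
      (\<forall>h\<in>free J F. \<bar>x h - y h\<bar> < d) \<Longrightarrow> hausdorff_dist (cell J F x) (cell J F y) < r"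
    using cell_continuous[OF t r(1)] by blast
  define e where "e = min (d/2) (1/2)"
  have e: "0 < e" "e < 1" "e < d" using d(1) by (auto simp: e_def min_def)
  let ?s = "shrink e x"
  define y where "y = (\<lambda>i. if i < card ?I then ?s (enum ?I i) else 0)"
  have ys: "y (index ?I h) = ?s h" if "h \<in> ?I" for h
    using enum_index(3,4)[OF finite_free that] by (simp add: y_def)
  have so: "?s \<in> open_params J F" by (rule shrink_in_open_params(1)[OF x e(1,2)])
  have "(\<lambda>h. y (index ?I h)) \<in> open_params J F"
    using so ys rev_free[OF t] by (auto simp: open_params_def)
  then have "y \<in> open_box J F"
    by (auto simp: open_box_def topspace_Euclidean_space y_def)
  moreover have "point_cell J F y = cell J F ?s"
    unfolding point_cell_def by (rule cell_cong) (use ys in simp)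
  moreover have sc: "?s \<in> closed_params J F" using so open_params_subset half_params_subset by blast
  have "\<bar>x h - ?s h\<bar> < d" if "h \<in> free J F" for h
    using shrink_in_open_params(2)[OF x e(1,2) that] e(3) by (simp add: abs_minus_commute)
  then have "cell J F ?s \<in> U"
    using r(2)[OF cell_in_subcontinua(1)[OF t sc]] d(2)[OF x sc] by blast
  ultimately show ?thesis by metis
qed

lemma has_cell_of_tree:
  assumes t: "tree J F" and p: "p \<in> J" and x: "x \<in> closed_params J F"
    and U: "openin (hyperspace_at p X) U" "cell J F x \<in> U"
  shows "has_cell (card (free J F)) (hyperspace_at p X) U"
proof -
  let ?E = "Euclidean_space (card (free J F))"
  let ?B = "open_box J F"
  obtain U' where U': "openin (hyperspace X) U'" "U = U' \<inter> subcontinua_at p X"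
    using U(1) by (auto simp: openin_subtopology)
  have top: "topspace (subtopology ?E ?B) = ?B"
    by (rule topspace_sub_Euclidean_space[OF openin_open_box[OF t]])
  let ?W = "{y \<in> ?B. point_cell J F y \<in> U'}"
  have "openin (subtopology ?E ?B) ?W"
    using openin_continuous_map_preimage[OF continuous_point_cell[OF t] U'(1)] unfolding top .
  then have "openin ?E ?W"
    using openin_open_box[OF t] openin_trans_full by blast
  moreover have "?W \<noteq> {}"
    using open_cell_nearby[OF t x U'(1)] U(2) U'(2) by blast
  moreover have at: "point_cell J F y \<in> subcontinua_at p X" if "y \<in> ?B" for y
    using point_cell_props(1,2)[OF t that] p by (auto simp: subcontinua_at_def)
  have "continuous_map (subtopology ?E ?W) (hyperspace_at p X) (point_cell J F)"
    unfolding continuous_map_in_subtopology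
    using continuous_map_from_subtopology_mono[OF continuous_point_cell[OF t], of ?W] at by auto
  moreover have "inj_on (point_cell J F) ?W"
    by (rule inj_on_subset[OF inj_point_cell[OF t]]) auto
  moreover have "point_cell J F ` ?W \<subseteq> U"
    using at U'(2) by auto
  ultimately show ?thesis unfolding has_cell_def by blast
qed

lemma continuous_coords:
  assumes "J \<subseteq> V"
  shows "continuous_map (subtopology (hyperspace X) {A \<in> subcontinua X. A \<inter> V = J \<and> full A \<subseteq> F})
    (Euclidean_space (card (free J F))) (coords J F)"
proof (rule continuous_map_into_Euclidean_space)
  let ?S = "{A \<in> subcontinua X. A \<inter> V = J \<and> full A \<subseteq> F}"
  fix i assume i: "i < card (free J F)"
  let ?h = "enum (free J F) i"
  have h: "?h \<in> free J F" by (rule enum_index(1)[OF finite_free i])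
  have "?S \<subseteq> {A \<in> subcontinua X. pathstart ?h \<in> A \<and> ?h \<notin> full A}"
    using free_D[OF h] by auto
  then have "continuous_map (subtopology (hyperspace X) ?S) euclideanreal (\<lambda>A. extent A ?h)"
    using continuous_extent[of ?h] free_D[OF h] continuous_map_from_subtopology_mono by blast
  then show "continuous_map (subtopology (hyperspace X) ?S) euclideanreal (\<lambda>A. coords J F A i)"
    using i by (simp add: coords_def)
qed (simp add: coords_def)

text \<open>A subcontinuum is the union of its initial pieces of darts, and on a full dart the length is one.\<close>

lemma inj_coords:
  assumes "J \<noteq> {}" "J \<subseteq> V"
  shows "inj_on (coords J F) {A \<in> subcontinua X. A \<inter> V = J \<and> full A = F}"
proof (rule inj_onI)
  fix A B assume A: "A \<in> {A \<in> subcontinua X. A \<inter> V = J \<and> full A = F}"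
    and B: "B \<in> {A \<in> subcontinua X. A \<inter> V = J \<and> full A = F}" and eq: "coords J F A = coords J F B"
  obtain p where p: "p \<in> J" using assms by auto
  have rep: "C = J \<union> (\<Union>h\<in>darts_at J. h ` {0..extent C h})"
    if C: "C \<in> {A \<in> subcontinua X. A \<inter> V = J \<and> full A = F}" for C
  proof -
    have "{h \<in> D. pathstart h \<in> C} = darts_at J"
      using C start by (auto simp: darts_at_def)
    moreover have "p \<in> C" "p \<in> V" using p C by auto
    ultimately show ?thesis using subcontinuum_eq_extents[of C p] C by auto
  qed
  have "extent A h = extent B h" if h: "h \<in> darts_at J" for h
  proof (cases "h \<in> F")
    case True
    have hD: "h \<in> D" "pathstart h \<in> A" "pathstart h \<in> B"
      using h A B by (auto simp: darts_at_def)
    have "path_image h \<subseteq> A" "path_image h \<subseteq> B"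
      using True A B unfolding full_def by blast+
    then show ?thesis
      using extent_eq_1_iff[of A h] extent_eq_1_iff[of B h] hD A B by auto
  next
    case False
    then have f: "h \<in> free J F" using h by (simp add: free_def)
    have "coords J F A (index (free J F) h) = coords J F B (index (free J F) h)" using eq by simp
    then show ?thesis
      using enum_index(3,4)[OF finite_free f] by (simp add: coords_def)
  qed
  then have "(\<Union>h\<in>darts_at J. h ` {0..extent A h}) = (\<Union>h\<in>darts_at J. h ` {0..extent B h})"
    by simp
  then show "A = B" using rep[OF A] rep[OF B] by metis
qed

text \<open>The number of darts at \<open>J\<close> outside a spanning tree.\<close>

definition graph_dim :: "'a set \<Rightarrow> nat" where
  "graph_dim J = card (darts_at J) + 2 - 2 * card J"

lemma card_free:
  assumes t: "tree J F"
  shows "card (free J F) = graph_dim J" "2 * card J \<le> card (darts_at J) + 2"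
proof -
  have fin: "finite F" using treeD(3)[OF t] finite_D finite_subset by blast
  have "card (free J F) = card (darts_at J) - card F"
    unfolding free_def by (rule card_Diff_subset[OF fin treeD(9)[OF t]])
  moreover have "card F \<le> card (darts_at J)"
    by (rule card_mono[OF finite_darts_at treeD(9)[OF t]])
  ultimately show "card (free J F) = graph_dim J" "2 * card J \<le> card (darts_at J) + 2"
    using treeD(8)[OF t] by (auto simp: graph_dim_def)
qed

lemma card_darts_at: "J \<subseteq> V \<Longrightarrow> card (darts_at J) = (\<Sum>v\<in>J. degree v)"
proof -
  assume J: "J \<subseteq> V"
  have "darts_at J = (\<Union>v\<in>J. {h \<in> D. pathstart h = v})"
    by (auto simp: darts_at_def)
  then show ?thesis
    using finite_subset[OF J finite_V] finite_D
    by (simp add: degree_def) (subst card_UN_disjoint; auto)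
qed

lemma graph_dim_sub:
  assumes J: "J' \<subseteq> J" "J \<subseteq> V" and deg: "\<And>v. v \<in> J - J' \<Longrightarrow> k \<le> degree v"
    and k: "2 \<le> k" and t: "2 * card J' \<le> card (darts_at J') + 2"
  shows "graph_dim J' + (k - 2) * card (J - J') \<le> graph_dim J"
proof -
  have fin: "finite J" using J(2) finite_V finite_subset by blast
  have "card (darts_at J) = (\<Sum>v\<in>J'. degree v) + (\<Sum>v\<in>J - J'. degree v)"
    using sum.subset_diff[OF J(1) fin, of degree] card_darts_at[OF J(2)] by simp
  moreover have "(\<Sum>v\<in>J'. degree v) = card (darts_at J')"
    using card_darts_at[of J'] J by auto
  moreover have "k * card (J - J') \<le> (\<Sum>v\<in>J - J'. degree v)"
    using sum_mono[of "J - J'" "\<lambda>_. k" degree] deg by (simp add: mult.commute)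
  moreover have "card J = card J' + card (J - J')"
    using card_Diff_subset[OF finite_subset[OF J(1) fin] J(1)] card_mono[OF fin J(1)] by simp
  moreover have "k * card (J - J') = (k - 2) * card (J - J') + 2 * card (J - J')"
    using k by (metis add_mult_distrib le_add_diff_inverse2)
  ultimately show ?thesis
    using t by (simp add: graph_dim_def)
qed

text \<open>On a cell, the vertices and the full darts of the subcontinuum can only disappear, not appear, in
  a neighbourhood of a point. Near a point where there are fewest of them both are therefore constant,
  and there the lengths along the other darts are continuous and injective coordinates.\<close>

lemma stratum_cell_dim:
  assumes p: "p \<in> V" and J: "J \<subseteq> V"
    and deg: "\<And>v. v \<in> V \<Longrightarrow> v \<noteq> p \<Longrightarrow> 2 \<le> degree v"
    and cell: "has_cell m (hyperspace_at p X) {B \<in> subcontinua_at p X. B \<inter> V \<subseteq> J}"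
  shows "m \<le> graph_dim J"
proof -
  let ?Y = "hyperspace_at p X"
  obtain W c where W: "openin (Euclidean_space m) W" "W \<noteq> {}"
    and c: "continuous_map (subtopology (Euclidean_space m) W) ?Y c" "inj_on c W"
      "c ` W \<subseteq> {B \<in> subcontinua_at p X. B \<inter> V \<subseteq> J}"
    using cell by (auto simp: has_cell_def)
  have topW: "topspace (subtopology (Euclidean_space m) W) = W"
    using W(1) by (rule topspace_sub_Euclidean_space)
  have cX: "c x \<in> subcontinua X" "p \<in> c x" "c x \<inter> V \<subseteq> J" if "x \<in> W" for x
    using c(3) that by (auto simp: subcontinua_at_def)
  define size where "size A = card (A \<inter> V) + card (full A)" for A
  obtain x0 where x0: "x0 \<in> W" "\<And>x. x \<in> W \<Longrightarrow> size (c x0) \<le> size (c x)"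
    using ex_has_least_nat[of "\<lambda>x. x \<in> W" _ "\<lambda>x. size (c x)"] W(2) by (metis ex_in_conv)
  let ?J = "c x0 \<inter> V"
  let ?F = "full (c x0)"
  define N where "N = (\<Inter>v\<in>V - c x0. {B \<in> subcontinua X. v \<notin> B}) \<inter>
      (\<Inter>h\<in>D - ?F. {B \<in> subcontinua X. \<not> path_image h \<subseteq> B}) \<inter> subcontinua X"
  have "openin (hyperspace X) N"
  proof -
    have eq: "N = topspace (hyperspace X) \<inter> \<Inter>((\<lambda>v. {B \<in> subcontinua X. v \<notin> B}) ` (V - c x0) \<union>
        (\<lambda>h. {B \<in> subcontinua X. \<not> path_image h \<subseteq> B}) ` (D - ?F))"
      unfolding N_def topspace_hyperspace[OF compact_X] by blast
    show ?thesis
      unfolding eq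
      by (rule openin_Int_Inter)
         (use finite_V finite_D openin_hyperspace_miss[OF compact_X] openin_hyperspace_not_supset[OF compact_X] in auto)
  qed
  then have opN: "openin ?Y (subcontinua_at p X \<inter> N)"
    by (rule openin_subtopology_Int2)
  let ?W = "{x \<in> W. c x \<in> subcontinua_at p X \<inter> N}"
  have "openin (subtopology (Euclidean_space m) W) ?W"
    using openin_continuous_map_preimage[OF c(1) opN] unfolding topW .
  then have W': "openin (Euclidean_space m) ?W"
    using W(1) openin_trans_full by blast
  let ?S = "{A \<in> subcontinua X. A \<inter> V = ?J \<and> full A = ?F}"
  have "x0 \<in> ?W"
    using x0 cX[OF x0(1)] c(3) unfolding N_def by (auto simp: full_def)
  moreover have strat: "c x \<in> ?S" if x: "x \<in> ?W" for x
  proof -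
    have sub: "c x \<inter> V \<subseteq> ?J" "full (c x) \<subseteq> ?F"
      using x unfolding N_def full_def by blast+
    have fin: "finite ?J" "finite ?F" using finite_V finite_D by (auto simp: full_def)
    have le: "card (c x \<inter> V) \<le> card ?J" "card (full (c x)) \<le> card ?F"
      using sub fin by (auto intro: card_mono)
    have "size (c x0) \<le> size (c x)" using x x0(2) by blast
    then have "card (c x \<inter> V) = card ?J" "card (full (c x)) = card ?F"
      using le unfolding size_def by linarith+
    then have "c x \<inter> V = ?J" "full (c x) = ?F"
      using card_subset_eq[OF fin(1) sub(1)] card_subset_eq[OF fin(2) sub(2)] by blast+
    then show ?thesis using x cX by auto
  qed
  have "has_cell m (hyperspace X) ?S"
    unfolding has_cell_def
  proof (intro exI conjI)
    show "openin (Euclidean_space m) ?W" by (rule W')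
    show "?W \<noteq> {}" using \<open>x0 \<in> ?W\<close> by blast
    have "continuous_map (subtopology (Euclidean_space m) W) (hyperspace X) c"
      using c(1) by (simp add: continuous_map_in_subtopology)
    then show "continuous_map (subtopology (Euclidean_space m) ?W) (hyperspace X) c"
      by (rule continuous_map_from_subtopology_mono) auto
    show "inj_on c ?W" by (rule inj_on_subset[OF c(2)]) auto
    show "c ` ?W \<subseteq> ?S" using strat by blast
  qed
  moreover have pJ: "p \<in> ?J" using cX[OF x0(1)] p by auto
  have "continuous_map (subtopology (hyperspace X) ?S) (Euclidean_space (card (free ?J ?F))) (coords ?J ?F)"
    by (rule continuous_map_from_subtopology_mono[OF continuous_coords]) auto
  moreover have "inj_on (coords ?J ?F) ?S"
    by (rule inj_coords) (use pJ in auto)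
  ultimately have "m \<le> card (free ?J ?F)"
    using has_cell_imp_le by blast
  moreover obtain F where F: "tree ?J F" "F \<subseteq> ?F"
    using exists_spanning_tree[OF cX(1,2)[OF x0(1)] p] by blast
  have "card (free ?J ?F) \<le> card (free ?J F)"
    by (rule card_mono[OF finite_free]) (use F(2) in \<open>auto simp: free_def\<close>)
  moreover have "graph_dim ?J \<le> graph_dim J"
    using graph_dim_sub[of ?J J 2] cX(3)[OF x0(1)] J deg pJ card_free(2)[OF F(1)] by fastforce
  ultimately show ?thesis
    using card_free(1)[OF F(1)] by simp
qed

text \<open>The lower bound comes from a spanning tree of the vertices in \<open>A\<close>: every remaining dart at
  these vertices contributes one free end. The upper bound holds because the subcontinua near \<open>A\<close>
  contain no further vertices, and fewer vertices do not give cells of larger dimension.\<close>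

theorem ldim_hyperspace_at:
  assumes p: "p \<in> V" and deg: "\<And>v. v \<in> V \<Longrightarrow> v \<noteq> p \<Longrightarrow> 2 \<le> degree v"
    and A: "A \<in> subcontinua_at p X"
  shows "A \<in> ldim (hyperspace_at p X) (graph_dim (A \<inter> V))"
proof -
  let ?Y = "hyperspace_at p X" and ?J = "A \<inter> V"
  have A': "A \<in> subcontinua X" "p \<in> A" using A by (auto simp: subcontinua_at_def)
  obtain F where F: "tree ?J F" "F \<subseteq> full A"
    using exists_spanning_tree[OF A' p] by blast
  obtain x where x: "x \<in> closed_params ?J F" "cell ?J F x = A"
    using cell_representation_exists[OF A'(1) F] by blast
  have "ldim_ge ?Y A (graph_dim ?J)"
    using has_cell_of_tree[OF F(1) _ x(1), of p] x(2) A' p card_free(1)[OF F(1)]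
    unfolding ldim_ge_def by auto
  moreover have "\<not> ldim_ge ?Y A (Suc (graph_dim ?J))"
  proof
    assume ge: "ldim_ge ?Y A (Suc (graph_dim ?J))"
    let ?N = "{B \<in> subcontinua_at p X. B \<inter> V \<subseteq> ?J}"
    have eq: "?N = subcontinua_at p X \<inter> (topspace (hyperspace X) \<inter> \<Inter>((\<lambda>v. {B \<in> subcontinua X. v \<notin> B}) ` (V - A)))"
      using topspace_hyperspace[OF compact_X] by (auto simp: subcontinua_at_def)
    have "openin ?Y ?N"
      unfolding eq
      by (intro openin_subtopology_Int2 openin_Int_Inter)
         (use finite_V openin_hyperspace_miss[OF compact_X] in auto)
    then have "has_cell (Suc (graph_dim ?J)) ?Y ?N"
      using ge A unfolding ldim_ge_def by blast
    then have "Suc (graph_dim ?J) \<le> graph_dim ?J"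
      by (rule stratum_cell_dim[OF p _ deg, rotated -1]) auto
    then show False by simp
  qed
  ultimately show ?thesis
    using A topspace_hyperspace_at[OF compact_X] by (auto simp: ldim_def)
qed

end

section \<open>Homeomorphisms of graphs\<close>

lemma continuous_map_hyperspace_image:
  assumes X: "compact X" and Z: "compact Z" and f: "continuous_on X f" "f ` X \<subseteq> Z"
  shows "continuous_map (hyperspace X) (hyperspace Z) ((`) f)"
proof -
  interpret M: Metric_space "subcontinua X" hausdorff_dist
    by (rule Metric_space_subcontinua[OF X])
  have sub: "f ` A \<in> subcontinua Z" if "A \<in> subcontinua X" for A
  proof -
    have A: "A \<noteq> {}" "compact A" "connected A" "A \<subseteq> X"
      using that subcontinua_iff[OF X] by auto
    have "continuous_on A f" using f(1) A(4) continuous_on_subset by blast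
    then show ?thesis
      using A f(2) by (auto simp: subcontinua_iff[OF Z] compact_continuous_image connected_continuous_image)
  qed
  have "\<exists>d>0. \<forall>B. B \<in> subcontinua X \<and> hausdorff_dist A B < d \<longrightarrow> hausdorff_dist (f ` A) (f ` B) < e"
    if A: "A \<in> subcontinua X" and e: "e > 0" for A e
  proof -
    have "uniformly_continuous_on X f"
      by (rule compact_uniformly_continuous[OF f(1) X])
    then obtain d where d: "d > 0" "\<And>x y. x \<in> X \<Longrightarrow> y \<in> X \<Longrightarrow> dist y x < d \<Longrightarrow> dist (f y) (f x) < e/2"
      using e unfolding uniformly_continuous_on_def by (metis half_gt_zero)
    have near: "\<exists>b\<in>f ` B. dist a b \<le> e/2"
      if A: "A \<in> subcontinua X" and B: "B \<in> subcontinua X" and AB: "hausdorff_dist A B < d" and a: "a \<in> f ` A" for A B a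
    proof -
      obtain x where x: "x \<in> A" "a = f x" using a by auto
      obtain y where y: "y \<in> B" "dist x y < d"
        using hausdorff_dist_less_imp_near[OF X A B AB x(1)] by blast
      have "x \<in> X" "y \<in> X" using x y A B subcontinua_iff[OF X] by auto
      then have "dist (f x) (f y) < e/2" using d(2) y(2) by blast
      then show ?thesis using x(2) y(1) by (intro bexI[of _ "f y"]) auto
    qed
    have "hausdorff_dist (f ` A) (f ` B) < e" if B: "B \<in> subcontinua X" "hausdorff_dist A B < d" for B
    proof -
      have "A \<noteq> {}" "B \<noteq> {}" using A B subcontinua_iff[OF X] by auto
      moreover have "hausdorff_dist B A < d" using B(2) by (simp add: hausdorff_dist_commute)
      ultimately have "hausdorff_dist (f ` A) (f ` B) \<le> e/2"
        using near[OF A B] near[OF B(1) A] e by (intro hausdorff_dist_le) auto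
      then show ?thesis using e by simp
    qed
    then show ?thesis using d(1) by blast
  qed
  then show ?thesis
    unfolding hyperspace_def M.metric_continuous_map[OF Metric_space_subcontinua[OF Z]]
    using sub by blast
qed

lemma homeomorphic_hyperspace_at:
  assumes X: "compact X" and f: "homeomorphism X X f g" and p: "p \<in> X"
  shows "hyperspace_at p X homeomorphic_space hyperspace_at (f p) X"
proof -
  have fg: "continuous_on X f" "f ` X \<subseteq> X" "continuous_on X g" "g ` X \<subseteq> X"
    "\<And>x. x \<in> X \<Longrightarrow> g (f x) = x" "\<And>x. x \<in> X \<Longrightarrow> f (g x) = x"
    using f by (auto simp: homeomorphism_def)
  have sub: "A \<subseteq> X" if "A \<in> subcontinua X" for A
    using that subcontinua_iff[OF X] by auto
  have cont: "continuous_map (hyperspace_at q X) (hyperspace_at (k q) X) ((`) k)"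
    if k: "continuous_on X k" "k ` X \<subseteq> X" for q k
  proof -
    have c: "continuous_map (hyperspace X) (hyperspace X) ((`) k)"
      by (rule continuous_map_hyperspace_image[OF X X k])
    have "k ` A \<in> subcontinua_at (k q) X" if "A \<in> subcontinua_at q X" for A
      using that continuous_map_image_subset_topspace[OF c] topspace_hyperspace[OF X]
      by (auto simp: subcontinua_at_def)
    then show ?thesis
      unfolding continuous_map_in_subtopology
      using continuous_map_from_subtopology[OF c] by auto
  qed
  have "homeomorphic_maps (hyperspace_at p X) (hyperspace_at (f p) X) ((`) f) ((`) g)"
    unfolding homeomorphic_maps_def topspace_hyperspace_at[OF X]
  proof (intro conjI ballI)
    show "continuous_map (hyperspace_at p X) (hyperspace_at (f p) X) ((`) f)"
      by (rule cont[OF fg(1,2)])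
    show "continuous_map (hyperspace_at (f p) X) (hyperspace_at p X) ((`) g)"
      using cont[OF fg(3,4), of "f p"] fg(5)[OF p] by simp
    show "g ` f ` A = A" if "A \<in> subcontinua_at p X" for A
    proof -
      have "g (f x) = x" if "x \<in> A" for x
        using fg(5) sub that \<open>A \<in> _\<close> by (auto simp: subcontinua_at_def)
      then show ?thesis by (simp add: image_image)
    qed
    show "f ` g ` A = A" if "A \<in> subcontinua_at (f p) X" for A
    proof -
      have "f (g x) = x" if "x \<in> A" for x
        using fg(6) sub that \<open>A \<in> _\<close> by (auto simp: subcontinua_at_def)
      then show ?thesis by (simp add: image_image)
    qed
  qed
  then show ?thesis unfolding homeomorphic_space_def by blast
qed

context finite_graph
begin

lemma continuous_on_graph:
  assumes "\<And>h. h \<in> D \<Longrightarrow> continuous_on {0..1} (\<lambda>u. f (h u) :: 'a)"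
  shows "continuous_on X f"
proof -
  have im: "continuous_on (path_image h) f" if h: "h \<in> D" for h
    unfolding continuous_on_closed_invariant
  proof (intro allI impI)
    fix B :: "'a set" assume B: "closed B"
    let ?K = "{u \<in> {0..1}. f (h u) \<in> B}"
    have "closed ?K"
      using continuous_closed_preimage[OF assms[OF h] _ B] by (simp add: vimage_def Int_def conj_commute)
    then have "compact ?K"
      using compact_Int_closed[of "{0..1}" ?K] by (simp add: Int_def) (metis (no_types, lifting) Collect_cong)
    moreover have "continuous_on ?K h"
      by (rule continuous_on_subset[OF continuous_dart[OF h]]) auto
    ultimately have "closed (h ` ?K)"
      by (intro compact_imp_closed compact_continuous_image)
    moreover have "h ` ?K \<inter> path_image h = f -` B \<inter> path_image h"
      by (auto simp: path_image_def)
    ultimately show "\<exists>A. closed A \<and> A \<inter> path_image h = f -` B \<inter> path_image h" by blast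
  qed
  have "continuous_on (\<Union>h\<in>D. path_image h) f"
    using finite_D im compact_path_image_dart compact_imp_closed
    by (intro continuous_on_closed_Union) auto
  moreover have "continuous_on V f"
    by (rule continuous_on_finite[OF finite_V])
  moreover have "closed (\<Union>h\<in>D. path_image h)"
    using finite_D compact_path_image_dart by (intro compact_imp_closed compact_UN) auto
  ultimately show ?thesis
    unfolding space_eq
    using finite_V finite_imp_closed by (intro continuous_on_closed_Un) auto
qed

lemma point_cases:
  assumes "x \<in> X"
  obtains "x \<in> V" | h u where "h \<in> D" "u \<in> {0..1}" "x = h u" "x \<notin> V"
  using assms unfolding space_eq path_image_def by blast

definition position :: "(real \<Rightarrow> 'a) \<Rightarrow> 'a \<Rightarrow> real" where
  "position h x = (SOME u. u \<in> {0..1} \<and> h u = x)"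

lemma position_dart:
  assumes "h \<in> D" "u \<in> {0..1}" "h u \<notin> V"
  shows "position h (h u) = u"
  unfolding position_def
proof (rule some_equality)
  fix v assume v: "v \<in> {0..1} \<and> h v = h u"
  then have "h = h \<and> v = u \<or> h = reversepath h \<and> v = 1 - u"
    using dart_point_unique[OF assms(1,1), of u v] assms by auto
  then show "v = u" using rev_neq[OF assms(1)] by metis
qed (use assms in auto)

lemma off_dart:
  assumes "h \<in> D" "g \<in> D" "g \<noteq> h" "g \<noteq> reversepath h" "u \<in> {0..1}" "g u \<notin> V"
  shows "g u \<notin> path_image h"
  using disjoint[OF assms(1-4)] assms(5,6) unfolding path_image_def by blast

text \<open>Points with equal parameters are exchanged. At the vertices this is consistent because the ends
  agree; the tips of legs are not vertices and lie on no other edge.\<close>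

lemma swap_homeomorphism:
  assumes h: "h \<in> D" "h' \<in> D" "h' \<noteq> h" "h' \<noteq> reversepath h" and s: "pathstart h = pathstart h'"
    and f: "pathfinish h = pathfinish h' \<or> pathfinish h \<notin> V \<and> pathfinish h' \<notin> V"
  shows "\<exists>f. homeomorphism X X f f \<and> (\<forall>u\<in>{0..1}. f (h u) = h' u)"
proof -
  define f where "f x = (if x \<in> V then x else if x \<in> path_image h then h' (position h x)
    else if x \<in> path_image h' then h (position h' x) else x)" for x
  have ne: "h \<noteq> h'" "h \<noteq> reversepath h'"
    using h by auto
  have ends: "h u = h' u" if "u \<in> {0..1}" "h u \<in> V \<or> h' u \<in> V" for u
  proof -
    have "u = 0 \<or> u = 1" using vertex_on_dart h that by blast
    then show ?thesis using s f that by (auto simp: pathstart_def pathfinish_def)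
  qed
  have fh: "f (h u) = h' u" if u: "u \<in> {0..1}" for u
  proof (cases "h u \<in> V")
    case True
    then show ?thesis using ends[OF u] by (simp add: f_def)
  next
    case False
    then show ?thesis using u position_dart[OF h(1) u] by (simp add: f_def path_image_def)
  qed
  have fh': "f (h' u) = h u" if u: "u \<in> {0..1}" for u
  proof (cases "h' u \<in> V")
    case True
    then show ?thesis using ends[OF u] by (simp add: f_def)
  next
    case False
    then have "h' u \<notin> path_image h" by (rule off_dart[OF h u])
    then show ?thesis using False u position_dart[OF h(2) u] by (simp add: f_def path_image_def)
  qed
  have fg: "f (g u) = g u" if g: "g \<in> D" "g \<noteq> h" "g \<noteq> reversepath h" "g \<noteq> h'" "g \<noteq> reversepath h'" and u: "u \<in> {0..1}" for g u
    using off_dart[OF h(1) g(1-3) u] off_dart[OF h(2) g(1,4,5) u] by (auto simp: f_def)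
  have cont: "continuous_on X f"
  proof (rule continuous_on_graph)
    fix g assume g: "g \<in> D"
    have rev_cont: "continuous_on {0..1} (\<lambda>u. k (1 - u))" if "k \<in> D" for k
      by (rule continuous_on_compose2[OF continuous_dart[OF that]]) (auto intro!: continuous_intros)
    consider "g = h" | "g = h'" | "g = reversepath h" | "g = reversepath h'"
      | "g \<noteq> h" "g \<noteq> reversepath h" "g \<noteq> h'" "g \<noteq> reversepath h'" by blast
    then show "continuous_on {0..1} (\<lambda>u. f (g u))"
    proof cases
      case 1
      show ?thesis
        by (rule continuous_on_eq[OF continuous_dart[OF h(2)]]) (use fh 1 in simp)
    next
      case 2
      show ?thesis
        by (rule continuous_on_eq[OF continuous_dart[OF h(1)]]) (use fh' 2 in simp)
    next
      case 3
      show ?thesis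
        by (rule continuous_on_eq[OF rev_cont[OF h(2)]]) (use fh 3 in \<open>simp add: reversepath_def\<close>)
    next
      case 4
      show ?thesis
        by (rule continuous_on_eq[OF rev_cont[OF h(1)]]) (use fh' 4 in \<open>simp add: reversepath_def\<close>)
    next
      case 5
      show ?thesis
        by (rule continuous_on_eq[OF continuous_dart[OF g]]) (use fg[OF g 5] in simp)
    qed
  qed
  have inv: "f (f x) = x \<and> f x \<in> X" if x: "x \<in> X" for x
    using x
  proof (cases x rule: point_cases)
    case 1
    then show ?thesis using x by (simp add: f_def)
  next
    case (2 g u)
    have u': "1 - u \<in> {0..1}" using 2 by auto
    consider "g = h" | "g = h'" | "g = reversepath h" | "g = reversepath h'"
      | "g \<noteq> h" "g \<noteq> reversepath h" "g \<noteq> h'" "g \<noteq> reversepath h'" by blast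
    then show ?thesis
    proof cases
      case 1
      then show ?thesis using fh fh' 2 dart_in_X[OF h(2)] by simp
    next
      case b: 2
      then show ?thesis using fh fh' 2 dart_in_X[OF h(1)] by simp
    next
      case 3
      then have "x = h (1 - u)" using 2 by (simp add: reversepath_def)
      then show ?thesis using fh[OF u'] fh'[OF u'] dart_in_X[OF h(2) u'] by simp
    next
      case 4
      then have "x = h' (1 - u)" using 2 by (simp add: reversepath_def)
      then show ?thesis using fh[OF u'] fh'[OF u'] dart_in_X[OF h(1) u'] by simp
    next
      case 5
      then show ?thesis using fg[OF 2(1) 5 2(2)] 2 x by simp
    qed
  qed
  have "homeomorphism X X f f"
    using cont inv by (intro homeomorphismI) auto
  then show ?thesis using fh by blast
qed

text \<open>The power \<open>s powr a\<close> maps the unit interval onto itself and moves a prescribed inner point to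
  any other one.\<close>

lemma slide_homeomorphism:
  assumes h: "h \<in> D" and u: "0 < u" "u < 1" and v: "0 < v" "v < 1"
  shows "\<exists>f g. homeomorphism X X f g \<and> f (h u) = h v"
proof -
  define f where "f a x = (if x \<notin> V \<and> x \<in> path_image h then h (position h x powr a) else x)" for a x
  have pw: "s powr a \<in> {0..1}" if "s \<in> {0..1}" "0 < a" for s a :: real
    using that powr_mono2[of a s 1] by auto
  have fh: "f a (h s) = h (s powr a)" if s: "s \<in> {0..1}" and a: "0 < a" for a s
  proof (cases "h s \<in> V")
    case True
    then have "s = 0 \<or> s = 1" using vertex_on_dart[OF h s] by blast
    then show ?thesis using True by (auto simp: f_def)
  next
    case False
    then show ?thesis using s position_dart[OF h s] by (simp add: f_def path_image_def)
  qed
  have fg: "f a (g s) = g s" if g: "g \<in> D" "g \<noteq> h" "g \<noteq> reversepath h" and s: "s \<in> {0..1}" for a g s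
    using off_dart[OF h g s] by (auto simp: f_def)
  have cont: "continuous_on X (f a)" if a: "0 < a" for a
  proof (rule continuous_on_graph)
    fix g assume g: "g \<in> D"
    have c: "continuous_on {0..1} (\<lambda>s. h (k s powr a))"
      if k: "continuous_on {0..1} k" "\<And>s. s \<in> {0..1} \<Longrightarrow> k s \<in> {0..1}" for k :: "real \<Rightarrow> real"
    proof (rule continuous_on_compose2[OF continuous_dart[OF h]])
      show "continuous_on {0..1} (\<lambda>s. k s powr a)"
        using k a by (intro continuous_on_powr' continuous_on_const) auto
      show "(\<lambda>s. k s powr a) ` {0..1} \<subseteq> {0..1}"
        using pw[OF k(2) a] by blast
    qed
    consider "g = h" | "g = reversepath h" | "g \<noteq> h" "g \<noteq> reversepath h" by blast
    then show "continuous_on {0..1} (\<lambda>s. f a (g s))"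
    proof cases
      case 1
      have "continuous_on {0..1} (\<lambda>s. h (s powr a))" by (rule c) auto
      then show ?thesis
        by (rule continuous_on_eq) (use fh[OF _ a] 1 in simp)
    next
      case 2
      have "continuous_on {0..1} (\<lambda>s. h ((1 - s) powr a))"
        by (rule c) (auto intro!: continuous_intros)
      moreover have "f a (h (1 - s)) = h ((1 - s) powr a)" if "s \<in> {0..1}" for s
        using fh[of "1 - s" a] that a by auto
      ultimately show ?thesis
        by (intro continuous_on_eq[OF \<open>continuous_on {0..1} (\<lambda>s. h ((1 - s) powr a))\<close>])
          (use 2 in \<open>simp add: reversepath_def\<close>)
    next
      case 3
      show ?thesis
        by (rule continuous_on_eq[OF continuous_dart[OF g]]) (use fg[OF g 3] in simp)
    qed
  qed
  have inv: "f (1 / a) (f a x) = x \<and> f a x \<in> X" if x: "x \<in> X" and a: "0 < a" for x a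
    using x
  proof (cases x rule: point_cases)
    case 1
    then show ?thesis using x by (simp add: f_def)
  next
    case (2 g s)
    have on: "f (1 / a) (f a (h r)) = h r \<and> f a (h r) \<in> X" if r: "r \<in> {0..1}" for r
      using fh[OF r a] fh[OF pw[OF r a], of "1 / a"] dart_in_X[OF h pw[OF r a]] a r
      by (simp add: powr_powr)
    consider "g = h" | "g = reversepath h" | "g \<noteq> h" "g \<noteq> reversepath h" by blast
    then show ?thesis
    proof cases
      case 1
      then show ?thesis using on 2 by simp
    next
      case b: 2
      then have "x = h (1 - s)" using 2 by (simp add: reversepath_def)
      then show ?thesis using on[of "1 - s"] 2 by simp
    next
      case 3
      then show ?thesis using fg[OF 2(1) 3 2(2)] 2 x by simp
    qed
  qed
  define a where "a = ln v / ln u"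
  have a: "0 < a" using u v by (simp add: a_def divide_neg_neg)
  have "homeomorphism X X (f a) (f (1 / a))"
  proof (rule homeomorphismI)
    show "f a (f (1 / a) x) = x" if "x \<in> X" for x
      using inv[OF that, of "1 / a"] a by simp
    show "f (1 / a) ` X \<subseteq> X" using inv[of _ "1 / a"] a by auto
  qed (use cont a inv in auto)
  moreover have "f a (h u) = h v"
    using fh[of u a] a u v by (simp add: powr_def a_def)
  ultimately show ?thesis by blast
qed

end

section \<open>Invariants of the hyperspace at a vertex\<close>

definition lowest_dim :: "'b topology \<Rightarrow> nat" where
  "lowest_dim Y = (LEAST k. ldim Y k \<noteq> {})"

text \<open>For the hyperspace at a point that is not a branch point, these numbers reveal the degrees of the
  vertices at the ends of its edge.\<close>

definition closure_dims :: "'b topology \<Rightarrow> nat set" where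
  "closure_dims Y = {k. ldim Y k \<inter> Y closure_of ldim Y (lowest_dim Y) \<noteq> {}}"

text \<open>The stratum of local dimension \<open>k\<close> is taken with its own topology; its points are usually not
  manifold points of the whole space.\<close>

definition connected_stratum :: "nat \<Rightarrow> 'b topology \<Rightarrow> bool" where
  "connected_stratum k Y \<longleftrightarrow>
     connectedin (subtopology Y (ldim Y k)) (manifold_points k (subtopology Y (ldim Y k)))"

lemma ldim_subset_topspace: "ldim Y k \<subseteq> topspace Y"
  by (auto simp: ldim_def)

lemma invariants_homeomorphic:
  assumes "Y homeomorphic_space Z"
  shows "lowest_dim Y = lowest_dim Z" "closure_dims Y = closure_dims Z"
    "connected_stratum k Y = connected_stratum k Z"
proof -
  obtain f where f: "homeomorphic_map Y Z f"
    using assms homeomorphic_space by blast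
  have L: "f ` ldim Y k = ldim Z k" for k
    by (rule ldim_homeomorphic_image[OF f])
  then have "ldim Y k = {} \<longleftrightarrow> ldim Z k = {}" for k
    by (metis image_is_empty)
  then show low: "lowest_dim Y = lowest_dim Z"
    by (simp add: lowest_dim_def)
  have inj: "inj_on f (topspace Y)"
    by (rule homeomorphic_imp_injective_map[OF f])
  have cl: "f ` (Y closure_of ldim Y k) = Z closure_of ldim Z k" for k
    using homeomorphic_map_closure_of[OF f ldim_subset_topspace] L by metis
  have "f ` (ldim Y k \<inter> Y closure_of ldim Y j) = ldim Z k \<inter> Z closure_of ldim Z j" for j k
    using inj_on_image_Int[OF inj ldim_subset_topspace closure_of_subset_topspace] L cl by metis
  then have "ldim Y k \<inter> Y closure_of ldim Y j = {} \<longleftrightarrow> ldim Z k \<inter> Z closure_of ldim Z j = {}" for j k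
    by (metis image_is_empty)
  then show "closure_dims Y = closure_dims Z"
    by (simp add: closure_dims_def low)
  let ?Y = "subtopology Y (ldim Y k)" and ?Z = "subtopology Z (ldim Z k)"
  have fs: "homeomorphic_map ?Y ?Z f"
  proof (rule homeomorphic_map_subtopologies[OF f])
    show "f ` (topspace Y \<inter> ldim Y k) = topspace Z \<inter> ldim Z k"
      using L ldim_subset_topspace by (metis inf.absorb2)
  qed
  have "manifold_points k ?Y \<subseteq> topspace ?Y"
    by (rule openin_subset[OF openin_manifold_points])
  from homeomorphic_map_connectedness[OF fs this] show "connected_stratum k Y = connected_stratum k Z"
    unfolding connected_stratum_def manifold_points_homeomorphic_image[OF fs] by simp
qed

locale graph_at = finite_graph X V D for X :: "'a::metric_space set" and V D +
  fixes p :: 'a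
  assumes p: "p \<in> V" and degree_ge_3: "v \<in> V \<Longrightarrow> v \<noteq> p \<Longrightarrow> 3 \<le> degree v"
begin

abbreviation "Y \<equiv> hyperspace_at p X"

lemma topspace_Y: "topspace Y = subcontinua_at p X"
  by (rule topspace_hyperspace_at[OF compact_X])

lemma subcontinua_atD: "A \<in> subcontinua_at p X \<Longrightarrow> A \<in> subcontinua X \<and> p \<in> A"
  by (simp add: subcontinua_at_def)

lemma ldim_eq: "ldim Y k = {A \<in> subcontinua_at p X. graph_dim (A \<inter> V) = k}"
proof -
  have *: "A \<in> ldim Y (graph_dim (A \<inter> V))" if "A \<in> subcontinua_at p X" for A
  proof (rule ldim_hyperspace_at[OF p _ that])
    show "2 \<le> degree v" if "v \<in> V" "v \<noteq> p" for v
      using degree_ge_3[OF that] by simp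
  qed
  show ?thesis
  proof
    show "ldim Y k \<subseteq> {A \<in> subcontinua_at p X. graph_dim (A \<inter> V) = k}"
    proof
      fix A assume A: "A \<in> ldim Y k"
      then have "A \<in> subcontinua_at p X" by (simp add: ldim_def topspace_Y)
      then show "A \<in> {A \<in> subcontinua_at p X. graph_dim (A \<inter> V) = k}"
        using ldim_unique[OF * A] by simp
    qed
  qed (use * in auto)
qed

lemma graph_dim_1: "v \<in> V \<Longrightarrow> graph_dim {v} = degree v"
  using card_darts_at[of "{v}"] by (simp add: graph_dim_def)

lemma graph_dim_2: "v \<in> V \<Longrightarrow> v \<noteq> p \<Longrightarrow> graph_dim {p, v} = degree p + degree v - 2"
  using card_darts_at[of "{p, v}"] p by (simp add: graph_dim_def)

lemma graph_dim_3: "v \<in> V \<Longrightarrow> w \<in> V \<Longrightarrow> v \<noteq> p \<Longrightarrow> w \<noteq> p \<Longrightarrow> v \<noteq> w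
    \<Longrightarrow> graph_dim {p, v, w} = degree p + degree v + degree w - 4"
  using card_darts_at[of "{p, v, w}"] p by (simp add: graph_dim_def)

lemma graph_dim_eq_degree_iff:
  assumes "p \<in> J" "J \<subseteq> V"
  shows "degree p \<le> graph_dim J" "graph_dim J = degree p \<longleftrightarrow> J = {p}"
proof -
  have "graph_dim {p} + (3 - 2) * card (J - {p}) \<le> graph_dim J"
    by (rule graph_dim_sub) (use assms degree_ge_3 in auto)
  then have *: "degree p + card (J - {p}) \<le> graph_dim J"
    using graph_dim_1[OF p] by simp
  then show "degree p \<le> graph_dim J" by simp
  have "finite (J - {p})" using assms finite_V finite_subset by blast
  then have "J - {p} = {}" if "graph_dim J = degree p"
    using * that by simp
  then show "graph_dim J = degree p \<longleftrightarrow> J = {p}"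
    using graph_dim_1[OF p] assms(1) by blast
qed

lemma graph_dim_eq_pair_iff:
  assumes "p \<in> J" "v \<in> J" "J \<subseteq> V" "v \<noteq> p" "1 \<le> degree p"
  shows "graph_dim J = degree p + degree v - 2 \<longleftrightarrow> J = {p, v}"
proof -
  have v: "v \<in> V" using assms by auto
  have "2 * card {p, v} \<le> card (darts_at {p, v}) + 2"
    using card_darts_at[of "{p, v}"] p v assms(4,5) degree_ge_3[OF v assms(4)] by simp
  then have "graph_dim {p, v} + (3 - 2) * card (J - {p, v}) \<le> graph_dim J"
    by (intro graph_dim_sub) (use assms degree_ge_3 in auto)
  moreover have "finite (J - {p, v})" using assms finite_V finite_subset by blast
  ultimately have "J - {p, v} = {}" if "graph_dim J = graph_dim {p, v}"
    using that by simp
  then show ?thesis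
    using graph_dim_2[OF v assms(4)] assms(1,2) by (metis Diff_eq_empty_iff empty_subsetI insert_subset subset_antisym)
qed

lemma singleton_subcontinuum: "{p} \<in> subcontinua_at p X" "{p} \<inter> V = {p}"
  using p V_subset by (auto simp: subcontinua_at_def subcontinua_iff[OF compact_X])

lemma lowest_dim_Y: "lowest_dim Y = degree p"
  unfolding lowest_dim_def
proof (rule Least_equality)
  show "ldim Y (degree p) \<noteq> {}"
    using singleton_subcontinuum graph_dim_1[OF p] unfolding ldim_eq by fastforce
  fix k assume "ldim Y k \<noteq> {}"
  then obtain A where A: "A \<in> subcontinua_at p X" "graph_dim (A \<inter> V) = k"
    unfolding ldim_eq by auto
  then show "degree p \<le> k"
    using graph_dim_eq_degree_iff(1)[of "A \<inter> V"] p subcontinua_atD by auto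
qed

lemma ldim_lowest: "ldim Y (degree p) = {A \<in> subcontinua_at p X. A \<inter> V = {p}}"
proof -
  have "graph_dim (A \<inter> V) = degree p \<longleftrightarrow> A \<inter> V = {p}" if "A \<in> subcontinua_at p X" for A
    using graph_dim_eq_degree_iff(2)[of "A \<inter> V"] subcontinua_atD[OF that] p by simp
  then show ?thesis unfolding ldim_eq by auto
qed

definition neighbours :: "'a set" where
  "neighbours = {v \<in> V. v \<noteq> p \<and> (\<exists>h\<in>D. pathstart h = p \<and> pathfinish h = v)}"

text \<open>A subcontinuum with the only vertex \<open>p\<close> lies in the union of the edges at \<open>p\<close>, which is a closed
  condition.\<close>

lemma closure_of_lowest:
  assumes "A \<in> Y closure_of ldim Y (degree p)"
  shows "A \<in> subcontinua_at p X" "A \<inter> V \<subseteq> insert p neighbours"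
proof -
  show A: "A \<in> subcontinua_at p X"
    using assms in_closure_of[of A Y] topspace_Y by simp
  define K where "K = insert p (\<Union>h\<in>darts_at {p}. path_image h)"
  have "compact (path_image h)" if "h \<in> darts_at {p}" for h
    using that compact_path_image_dart by (simp add: darts_at_def)
  then have "closed K"
    unfolding K_def using finite_darts_at
    by (intro closed_insert compact_imp_closed compact_UN) blast+
  then have "openin (top_of_set X) (X \<inter> - K)"
    by (intro openin_open_Int open_Compl)
  then have op: "openin (top_of_set X) (X - K)"
    by (simp add: Diff_eq)
  let ?H = "subcontinua_at p X \<inter> {B \<in> subcontinua X. B \<inter> (X - K) \<noteq> {}}"
  have opH: "openin Y ?H"
    by (intro openin_subtopology_Int2 openin_hyperspace_hit compact_X op)
  have miss: "B \<notin> ?H" if B: "B \<in> ldim Y (degree p)" for B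
  proof -
    have B': "B \<in> subcontinua X" "p \<in> B" "B \<inter> V = {p}"
      using B subcontinua_atD unfolding ldim_lowest by auto
    have "h ` {0..extent B h} \<subseteq> K" if h: "h \<in> D" "pathstart h \<in> B" for h
    proof -
      have "pathstart h = p" using B'(3) h start by auto
      moreover have "{0..extent B h} \<subseteq> {0..1}" using extent_props(1)[OF B'(1) h] by auto
      ultimately show ?thesis using h unfolding K_def path_image_def darts_at_def by blast
    qed
    then have "(B \<inter> V) \<union> (\<Union>h\<in>{h\<in>D. pathstart h \<in> B}. h ` {0..extent B h}) \<subseteq> K"
      using B'(3) unfolding K_def by blast
    then have "B \<subseteq> K"
      by (rule ord_eq_le_trans[OF subcontinuum_eq_extents[OF B'(1,2) p]])
    then show ?thesis by blast
  qed
  have "A \<notin> ?H"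
  proof
    assume AH: "A \<in> ?H"
    have "\<forall>T. A \<in> T \<and> openin Y T \<longrightarrow> (\<exists>y. y \<in> ldim Y (degree p) \<and> y \<in> T)"
      using assms by (simp add: in_closure_of)
    from this[rule_format, OF conjI[OF AH opH]] show False
      using miss by blast
  qed
  moreover have "A \<in> subcontinua X" "A \<subseteq> X"
    using subcontinua_atD[OF A] subcontinua_iff[OF compact_X, of A] by simp_all
  ultimately have "A \<subseteq> K"
    using A by blast
  show "A \<inter> V \<subseteq> insert p neighbours"
  proof
    fix v assume v: "v \<in> A \<inter> V"
    show "v \<in> insert p neighbours"
    proof (cases "v = p")
      case False
      then obtain h u where h: "h \<in> D" "pathstart h = p" "u \<in> {0..1}" "v = h u"
        using v \<open>A \<subseteq> K\<close> unfolding K_def darts_at_def path_image_def by blast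
      then have "u = 0 \<or> u = 1" using vertex_on_dart v by blast
      then have "pathfinish h = v" using h False by (auto simp: pathstart_def pathfinish_def)
      then show ?thesis using h v False by (auto simp: neighbours_def)
    qed simp
  qed
qed

lemma tree_singleton: "tree {p} {}"
  using p by (simp add: tree_def)

text \<open>A whole edge at \<open>p\<close> is the limit of its initial pieces.\<close>

lemma edge_in_closure:
  assumes h: "h \<in> D" "pathstart h = p" "pathfinish h \<in> V" "pathfinish h \<noteq> p"
  shows "path_image h \<in> Y closure_of ldim Y (degree p)"
    "path_image h \<in> subcontinua_at p X" "path_image h \<inter> V = {p, pathfinish h}"
proof -
  let ?x = "\<lambda>g. if g = h then 1 else 0 :: real"
  have "reversepath h \<notin> free {p} {}"
    using h by (auto simp: free_def darts_at_def)
  then have x: "?x \<in> closed_params {p} {}"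
    using h(4) by (auto simp: closed_params_def)
  have hf: "h \<in> free {p} {}" using h by (simp add: free_def darts_at_def)
  have c: "cell {p} {} ?x = path_image h"
  proof
    have "g ` {0..?x g} \<subseteq> path_image h" if g: "g \<in> free {p} {}" for g
    proof (cases "g = h")
      case False
      have "g 0 = p" using free_D[OF g] by (simp add: pathstart_def)
      moreover have "p \<in> path_image h" using h(2) by auto
      ultimately show ?thesis using False by simp
    qed (auto simp: path_image_def)
    moreover have "p \<in> path_image h" using h(2) by auto
    ultimately show "cell {p} {} ?x \<subseteq> path_image h" unfolding cell_def by blast
    have "path_image h = h ` {0..?x h}" by (simp add: path_image_def)
    then show "path_image h \<subseteq> cell {p} {} ?x"
      unfolding cell_def using hf by blast
  qed
  have sub: "path_image h \<in> subcontinua X"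
    using cell_in_subcontinua(1)[OF tree_singleton x] c by simp
  then show at: "path_image h \<in> subcontinua_at p X"
    using h(2) by (auto simp: subcontinua_at_def)
  show "path_image h \<inter> V = {p, pathfinish h}"
  proof
    show "path_image h \<inter> V \<subseteq> {p, pathfinish h}"
    proof
      fix w assume "w \<in> path_image h \<inter> V"
      then obtain u where u: "u \<in> {0..1}" "w = h u" "h u \<in> V" unfolding path_image_def by blast
      then have "u = 0 \<or> u = 1" using vertex_on_dart[OF h(1)] by blast
      then show "w \<in> {p, pathfinish h}" using u h(2) by (auto simp: pathstart_def pathfinish_def)
    qed
    show "{p, pathfinish h} \<subseteq> path_image h \<inter> V" using h p by auto
  qed
  show "path_image h \<in> Y closure_of ldim Y (degree p)"
    unfolding in_closure_of
  proof (intro conjI allI impI)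
    show "path_image h \<in> topspace Y" using at topspace_Y by simp
    fix T assume T: "path_image h \<in> T \<and> openin Y T"
    then obtain T' where T': "openin (hyperspace X) T'" "T = T' \<inter> subcontinua_at p X"
      by (auto simp: openin_subtopology)
    have "cell {p} {} ?x \<in> T'" using c T T' by simp
    then obtain y where y: "y \<in> open_box {p} {}" "point_cell {p} {} y \<in> T'"
      using open_cell_nearby[OF tree_singleton x T'(1)] by blast
    have pc: "point_cell {p} {} y \<in> subcontinua X" "point_cell {p} {} y \<inter> V = {p}"
      using point_cell_props[OF tree_singleton y(1)] by auto
    then have "point_cell {p} {} y \<in> subcontinua_at p X" by (auto simp: subcontinua_at_def)
    then show "\<exists>y. y \<in> ldim Y (degree p) \<and> y \<in> T"
      using pc y(2) T'(2) unfolding ldim_lowest by blast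
  qed
qed

lemma closure_dims_lower:
  assumes "v \<in> neighbours"
  shows "degree p \<in> closure_dims Y" "degree p + degree v - 2 \<in> closure_dims Y"
proof -
  have "{p} \<in> ldim Y (degree p)"
    using singleton_subcontinuum unfolding ldim_lowest by auto
  then show "degree p \<in> closure_dims Y"
    using closure_of_subset[OF ldim_subset_topspace, of Y "degree p"]
    unfolding closure_dims_def lowest_dim_Y by auto
  obtain h where h: "h \<in> D" "pathstart h = p" "pathfinish h = v" and v: "v \<in> V" "v \<noteq> p"
    using assms by (auto simp: neighbours_def)
  have "path_image h \<in> ldim Y (degree p + degree v - 2)"
    using edge_in_closure[of h] h v graph_dim_2[OF v] unfolding ldim_eq by simp
  then show "degree p + degree v - 2 \<in> closure_dims Y"
    using edge_in_closure(1)[of h] h v unfolding closure_dims_def lowest_dim_Y by auto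
qed

lemma closure_dims_upper:
  assumes "k \<in> closure_dims Y"
  shows "\<exists>N\<subseteq>neighbours. k = graph_dim (insert p N)"
proof -
  obtain A where A: "A \<in> ldim Y k" "A \<in> Y closure_of ldim Y (degree p)"
    using assms unfolding closure_dims_def lowest_dim_Y by blast
  have "p \<in> A \<inter> V"
    using subcontinua_atD[OF closure_of_lowest(1)[OF A(2)]] p by simp
  then have "A \<inter> V = insert p (A \<inter> V - {p})"
    by auto
  moreover have "A \<inter> V - {p} \<subseteq> neighbours" using closure_of_lowest(2)[OF A(2)] by blast
  moreover have "graph_dim (A \<inter> V) = k" using A(1) unfolding ldim_eq by simp
  ultimately show ?thesis by metis
qed

lemma closure_dims_one_neighbour:
  assumes "neighbours = {v}"
  shows "closure_dims Y = {degree p, degree p + degree v - 2}"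
proof -
  have v: "v \<in> V" "v \<noteq> p" using assms by (auto simp: neighbours_def)
  have "k \<in> {degree p, degree p + degree v - 2}" if k: "k \<in> closure_dims Y" for k
  proof -
    obtain N where "N \<subseteq> {v}" "k = graph_dim (insert p N)"
      using closure_dims_upper[OF k] assms by auto
    then show ?thesis using graph_dim_1[OF p] graph_dim_2[OF v] by (auto simp: subset_singleton_iff)
  qed
  then show ?thesis using closure_dims_lower[of v] assms by auto
qed

lemma closure_dims_two_neighbours:
  assumes "neighbours = {v, w}" "v \<noteq> w"
  shows "{degree p, degree p + degree v - 2, degree p + degree w - 2} \<subseteq> closure_dims Y"
    "closure_dims Y \<subseteq> {degree p, degree p + degree v - 2, degree p + degree w - 2, degree p + degree v + degree w - 4}"
proof -
  have v: "v \<in> V" "v \<noteq> p" "w \<in> V" "w \<noteq> p" using assms by (auto simp: neighbours_def)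
  show "closure_dims Y \<subseteq> {degree p, degree p + degree v - 2, degree p + degree w - 2, degree p + degree v + degree w - 4}"
  proof
    fix k assume k: "k \<in> closure_dims Y"
    obtain N where N: "N \<subseteq> {v, w}" "k = graph_dim (insert p N)"
      using closure_dims_upper[OF k] assms by auto
    then have "N = {} \<or> N = {v} \<or> N = {w} \<or> N = {v, w}" by blast
    then show "k \<in> {degree p, degree p + degree v - 2, degree p + degree w - 2, degree p + degree v + degree w - 4}"
      using N(2) graph_dim_1[OF p] graph_dim_2 graph_dim_3 v assms(2) by auto
  qed
  show "{degree p, degree p + degree v - 2, degree p + degree w - 2} \<subseteq> closure_dims Y"
    using closure_dims_lower[of v] closure_dims_lower[of w] assms by auto
qed

subsection \<open>Legs and loops\<close>

text \<open>At a point of a leg and at a point of a loop the invariants above agree. They are told apart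
  by the stratum of the subcontinua that contain exactly the vertices \<open>p\<close> and \<open>v\<close>. For a leg it is
  a cell with part of its boundary. For a loop it consists of two such cells, one for either way from
  \<open>p\<close> to \<open>v\<close>, glued along the subcontinua that contain the loop; these are not manifold points.\<close>

definition pair_stratum :: "'a \<Rightarrow> 'a set set" where
  "pair_stratum v = {A \<in> subcontinua_at p X. A \<inter> V = {p, v}}"

lemma pair_stratum_full_dart:
  assumes "A \<in> pair_stratum v" "v \<noteq> p"
  shows "\<exists>h\<in>full A. pathstart h = p \<and> pathfinish h = v"
proof -
  have "A \<in> subcontinua X" "A \<inter> V = {p, v}"
    using assms(1) by (auto simp: pair_stratum_def subcontinua_at_def)
  then show ?thesis
    using exists_full_dart_leaving[of A "{p}"] assms(2) by auto
qed

text \<open>The part of the stratum in which \<open>p\<close> and \<open>v\<close> are joined by the edge \<open>a\<close> only. The tree \<open>{p, v}\<close>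
  with this edge makes it an open subset of the stratum with injective coordinates.\<close>

lemma edge_stratum:
  assumes a: "a \<in> D" "pathstart a = p" "pathfinish a = v" and v: "v \<in> V" "v \<noteq> p" and deg: "degree p = 2"
  defines "F \<equiv> {a, reversepath a}" and "Q \<equiv> pair_stratum v"
  defines "Z \<equiv> subtopology (hyperspace X) Q"
  shows "tree {p, v} F" "card (free {p, v} F) = degree v" "topspace Z = Q"
    "openin Z {A \<in> Q. full A \<subseteq> F}"
    "continuous_map (subtopology Z {A \<in> Q. full A \<subseteq> F}) (Euclidean_space (degree v)) (coords {p, v} F)"
    "inj_on (coords {p, v} F) {A \<in> Q. full A \<subseteq> F}"
    "point_cell {p, v} F ` open_box {p, v} F \<subseteq> {A \<in> Q. full A = F}"
    "point_cell {p, v} F ` open_box {p, v} F \<subseteq> manifold_points (degree v) Z"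
proof -
  have ra: "reversepath a \<in> D" "reversepath a \<noteq> a" using rev[OF a(1)] rev_neq[OF a(1)] a v by auto
  have im: "{p, v} \<union> (\<Union>h\<in>F. path_image h) = path_image a"
    using a by (auto simp: F_def)
  show t: "tree {p, v} F"
    unfolding tree_def im
  proof (intro conjI)
    show "connected (path_image a)"
      using connected_dart_image[OF a(1), of 0 1] by (simp add: path_image_def)
  qed (use a v p ra in \<open>auto simp: F_def\<close>)
  show d: "card (free {p, v} F) = degree v"
    using card_free(1)[OF t] graph_dim_2[OF v] deg by simp
  have Qs: "Q \<subseteq> subcontinua X" by (auto simp: Q_def pair_stratum_def subcontinua_at_def)
  then show top: "topspace Z = Q"
    by (auto simp: Z_def topspace_hyperspace[OF compact_X])
  let ?S = "{A \<in> Q. full A \<subseteq> F}"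
  have fullF: "full A = F" if A: "A \<in> ?S" for A
  proof -
    obtain h where h: "h \<in> full A" "pathstart h = p" "pathfinish h = v"
      using pair_stratum_full_dart[of A v] A v by (auto simp: Q_def)
    then have "h = a" using A a v by (auto simp: F_def)
    then have "a \<in> full A" "reversepath a \<in> full A"
      using h full_imp_rev_full[of a A] v by auto
    then show ?thesis using A by (auto simp: F_def)
  qed
  have eq: "?S = Q \<inter> (topspace (hyperspace X) \<inter> \<Inter>((\<lambda>h. {B \<in> subcontinua X. \<not> path_image h \<subseteq> B}) ` (D - F)))"
    using Qs topspace_hyperspace[OF compact_X] by (auto simp: full_def)
  show op: "openin Z ?S"
    unfolding eq Z_def
    by (intro openin_subtopology_Int2 openin_Int_Inter)
       (use finite_D openin_hyperspace_not_supset[OF compact_X] in auto)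
  have sub: "?S \<subseteq> {A \<in> subcontinua X. A \<inter> V = {p, v} \<and> full A \<subseteq> F}"
    using Qs by (auto simp: Q_def pair_stratum_def)
  have "subtopology Z ?S = subtopology (hyperspace X) ?S"
    unfolding Z_def subtopology_subtopology by (rule arg_cong[of _ _ "subtopology (hyperspace X)"]) auto
  then show cont: "continuous_map (subtopology Z ?S) (Euclidean_space (degree v)) (coords {p, v} F)"
    using continuous_map_from_subtopology_mono[OF continuous_coords[of "{p, v}" F] sub] v p d by simp
  have subF: "?S \<subseteq> {A \<in> subcontinua X. A \<inter> V = {p, v} \<and> full A = F}"
    using sub fullF by blast
  have "{p, v} \<subseteq> V" using v p by simp
  then show inj: "inj_on (coords {p, v} F) ?S"
    by (intro inj_on_subset[OF inj_coords subF]) auto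
  show im: "point_cell {p, v} F ` open_box {p, v} F \<subseteq> {A \<in> Q. full A = F}"
  proof
    fix A assume "A \<in> point_cell {p, v} F ` open_box {p, v} F"
    then obtain x where x: "x \<in> open_box {p, v} F" "A = point_cell {p, v} F x" by blast
    show "A \<in> {A \<in> Q. full A = F}"
      using point_cell_props[OF t x(1)] x(2) by (auto simp: Q_def pair_stratum_def subcontinua_at_def)
  qed
  show "point_cell {p, v} F ` open_box {p, v} F \<subseteq> manifold_points (degree v) Z"
  proof (rule cell_subset_manifold_points[OF op cont inj])
    show "openin (Euclidean_space (degree v)) (open_box {p, v} F)"
      using openin_open_box[OF t] d by simp
    have tb: "topspace (subtopology (Euclidean_space (degree v)) (open_box {p, v} F)) = open_box {p, v} F"
      using topspace_sub_Euclidean_space[OF openin_open_box[OF t]] d by simp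
    have cc: "continuous_map (subtopology (Euclidean_space (degree v)) (open_box {p, v} F)) (hyperspace X) (point_cell {p, v} F)"
      using continuous_point_cell[OF t] d by simp
    have "point_cell {p, v} F \<in> open_box {p, v} F \<rightarrow> Q"
      using im by blast
    then show "continuous_map (subtopology (Euclidean_space (degree v)) (open_box {p, v} F)) Z (point_cell {p, v} F)"
      unfolding Z_def using continuous_map_into_subtopology[OF cc, unfolded tb] by blast
    show "inj_on (point_cell {p, v} F) (open_box {p, v} F)" by (rule inj_point_cell[OF t])
    show "point_cell {p, v} F ` open_box {p, v} F \<subseteq> ?S" using im by blast
  qed
qed

lemma connected_open_box: "connected (open_box J F)"
proof (rule connected_iff_connected_component[THEN iffD2], intro ballI)
  fix x y assume x: "x \<in> open_box J F" and y: "y \<in> open_box J F"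
  define l where "l t = (\<lambda>i. (1 - t) * x i + t * y i)" for t :: real
  have "continuous_on {0..1} l"
    unfolding l_def
    by (rule continuous_on_coordinatewise_then_product)
      (intro continuous_on_add continuous_on_mult continuous_on_diff continuous_on_id continuous_on_const)
  then have "connected (l ` {0..1})"
    by (rule connected_continuous_image) simp
  moreover have "l 0 = x" "l 1 = y" by (auto simp: l_def)
  then have "x \<in> l ` {0..1}" "y \<in> l ` {0..1}"
    by (metis atLeastAtMost_iff imageI order_refl zero_le_one)+
  moreover have "l t \<in> open_box J F" if t: "t \<in> {0..1}" for t
  proof -
    have conv: "r < (1 - t) * q + t * q'" if "r < q" "r < q'" for r q q' :: real
    proof -
      have "(1 - t) * r + t * r = r" by (simp add: algebra_simps)
      moreover have "(1 - t) * r \<le> (1 - t) * q" "t * r \<le> t * q'" using that t by (auto intro: mult_left_mono)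
      moreover have "(1 - t) * r < (1 - t) * q \<or> t * r < t * q'" using that t by (cases "t = 0") auto
      ultimately show ?thesis by linarith
    qed
    have conv': "(1 - t) * q + t * q' < r" if "q < r" "q' < r" for r q q' :: real
      using conv[of "-r" "-q" "-q'"] that by simp
    have "(1 - t) * x i + t * y i + ((1 - t) * x j + t * y j) = (1 - t) * (x i + x j) + t * (y i + y j)" for i j
      by (simp add: algebra_simps)
    then show ?thesis
      using x y unfolding open_box_def open_params_def l_def topspace_Euclidean_space
      by (auto intro!: conv conv' simp del: distrib_left)
  qed
  ultimately show "connected_component (open_box J F) x y"
    unfolding connected_component_def by (intro exI[of _ "l ` {0..1}"]) blast
qed

lemma ldim_pair_stratum:
  assumes "v \<in> V" "v \<noteq> p" "degree p = 2" "neighbours = {v}"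
  shows "ldim Y (degree v) = pair_stratum v"
    "subtopology Y (ldim Y (degree v)) = subtopology (hyperspace X) (pair_stratum v)"
proof -
  have "A \<inter> V = {p, v}" if A: "A \<in> subcontinua_at p X" and d: "graph_dim (A \<inter> V) = degree v" for A
  proof -
    have pA: "p \<in> A \<inter> V" "A \<in> subcontinua X" using A p subcontinua_atD by auto
    have "A \<inter> V \<noteq> {p}"
      using d graph_dim_1[OF p] degree_ge_3[OF assms(1,2)] assms(3) by auto
    then obtain h where h: "h \<in> full A" "pathstart h = p" "pathfinish h \<in> A \<inter> V - {p}"
      using exists_full_dart_leaving[OF pA(2), of "{p}"] pA by auto
    then have "pathfinish h \<in> neighbours" by (auto simp: neighbours_def full_def)
    then have "v \<in> A \<inter> V" using h assms(4) by auto
    then show ?thesis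
      using graph_dim_eq_pair_iff[of "A \<inter> V" v] pA assms d by auto
  qed
  moreover have "graph_dim {p, v} = degree v"
    using graph_dim_2[OF assms(1,2)] assms(3) by simp
  ultimately have "graph_dim (A \<inter> V) = degree v \<longleftrightarrow> A \<inter> V = {p, v}" if "A \<in> subcontinua_at p X" for A
    using that by metis
  then show *: "ldim Y (degree v) = pair_stratum v"
    unfolding ldim_eq pair_stratum_def by (intro Collect_cong conj_cong refl)
  have "subcontinua_at p X \<inter> pair_stratum v = pair_stratum v"
    by (auto simp: pair_stratum_def)
  then show "subtopology Y (ldim Y (degree v)) = subtopology (hyperspace X) (pair_stratum v)"
    unfolding * subtopology_subtopology by simp
qed

lemma neighbours_eq:
  assumes "{h \<in> D. pathstart h = p} = {a, b}"
  shows "neighbours = {pathfinish a, pathfinish b} \<inter> V - {p}"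
proof -
  have "neighbours = pathfinish ` {h \<in> D. pathstart h = p} \<inter> V - {p}"
    by (auto simp: neighbours_def)
  then show ?thesis unfolding assms by simp
qed

lemma connected_stratum_leg:
  assumes darts: "{h \<in> D. pathstart h = p} = {a, b}" and ab: "a \<noteq> b"
    and fin: "pathfinish a = v" "v \<in> V" "v \<noteq> p" "pathfinish b \<notin> V"
  shows "connected_stratum (degree v) Y"
proof -
  have a: "a \<in> D" "pathstart a = p" using darts by auto
  have deg: "degree p = 2" using darts ab by (simp add: degree_def)
  have nb: "neighbours = {v}"
    using neighbours_eq[OF darts] fin by auto
  let ?F = "{a, reversepath a}" and ?Z = "subtopology (hyperspace X) (pair_stratum v)"
  let ?E = "Euclidean_space (card (free {p, v} ?F))"
  note es = edge_stratum[OF a fin(1-3) deg]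
  let ?G = "point_cell {p, v} ?F ` open_box {p, v} ?F"
  have "open_box {p, v} ?F \<subseteq> topspace ?E"
    by (rule openin_subset[OF openin_open_box[OF es(1)]])
  then have "connectedin ?E (open_box {p, v} ?F)"
    unfolding Euclidean_space_top_of_set connectedin_subtopology
    using connected_open_box[of "{p, v}" ?F] by simp
  then have "connectedin (subtopology ?E (open_box {p, v} ?F)) (open_box {p, v} ?F)"
    by (simp add: connectedin_subtopology)
  then have "connectedin (hyperspace X) ?G"
    using continuous_point_cell[OF es(1)] connectedin_continuous_map_image by blast
  then have con: "connectedin ?Z ?G"
    unfolding connectedin_subtopology using es(7) by blast
  have "manifold_points (degree v) ?Z \<subseteq> ?Z closure_of ?G"
  proof
    fix A assume "A \<in> manifold_points (degree v) ?Z"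
    then have AQ: "A \<in> pair_stratum v"
      using subsetD[OF openin_subset[OF openin_manifold_points]] es(3) by metis
    then have A: "A \<in> subcontinua X" "A \<inter> V = {p, v}"
      by (auto simp: pair_stratum_def subcontinua_at_def)
    obtain h where h: "h \<in> full A" "pathstart h = p" "pathfinish h = v"
      using pair_stratum_full_dart[OF AQ fin(3)] by blast
    then have "h \<in> {a, b}" using darts by (auto simp: full_def)
    then have "h = a" using h fin by auto
    then have "?F \<subseteq> full A" using h full_imp_rev_full[of a A] fin by auto
    then obtain x where x: "x \<in> closed_params {p, v} ?F" "cell {p, v} ?F x = A"
      using cell_representation_exists[OF A(1), of ?F] es(1) A(2) by auto
    show "A \<in> ?Z closure_of ?G"
      unfolding in_closure_of
    proof (intro conjI allI impI)
      show "A \<in> topspace ?Z" using AQ es(3) by simp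
      fix T assume T: "A \<in> T \<and> openin ?Z T"
      then obtain T' where T': "openin (hyperspace X) T'" "T = T' \<inter> pair_stratum v"
        by (auto simp: openin_subtopology)
      have "cell {p, v} ?F x \<in> T'" using x T T' by simp
      then obtain y where y: "y \<in> open_box {p, v} ?F" "point_cell {p, v} ?F y \<in> T'"
        using open_cell_nearby[OF es(1) x(1) T'(1)] by blast
      then show "\<exists>y. y \<in> ?G \<and> y \<in> T" using es(7) T'(2) by blast
    qed
  qed
  then have "connectedin ?Z (manifold_points (degree v) ?Z)"
    using connectedin_intermediate_closure_of[OF con es(8)] by blast
  then show ?thesis
    unfolding connected_stratum_def ldim_pair_stratum(2)[OF fin(2,3) deg nb] .
qed

text \<open>A subcontinuum that contains the loop is a limit of subcontinua that reach \<open>v\<close> along \<open>b\<close>, have a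
  gap in the edge \<open>a\<close> and stop exactly at \<open>v\<close> on its side. For these the length along the dart
  \<open>reversepath a\<close> is zero, the least possible value, so they lie on the boundary of their cell. As the
  manifold points form an open set, the limit is not among them either.\<close>

lemma full_loop_not_manifold_point:
  assumes darts: "{h \<in> D. pathstart h = p} = {a, b}" and ab: "a \<noteq> b"
    and fin: "pathfinish a = v" "pathfinish b = v" "v \<in> V" "v \<noteq> p"
    and A: "A \<in> pair_stratum v" "a \<in> full A" "b \<in> full A"
  shows "A \<notin> manifold_points (degree v) (subtopology (hyperspace X) (pair_stratum v))"
proof
  let ?Z = "subtopology (hyperspace X) (pair_stratum v)" and ?F = "{b, reversepath b}" and ?J = "{p, v}"
  let ?M = "manifold_points (degree v) ?Z"
  assume AM: "A \<in> ?M"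
  have a: "a \<in> D" "pathstart a = p" and b: "b \<in> D" "pathstart b = p" using darts by auto
  have deg: "degree p = 2" using darts ab by (simp add: degree_def)
  note es = edge_stratum[OF b fin(2-4) deg]
  have ra: "reversepath a \<in> D" using rev[OF a(1)] fin by auto
  have A': "A \<in> subcontinua X" "A \<inter> V = ?J"
    using A(1) by (auto simp: pair_stratum_def subcontinua_at_def)
  have rF: "a \<notin> ?F" "reversepath a \<notin> ?F"
  proof -
    show "a \<notin> ?F" using ab a b fin by auto
    show "reversepath a \<notin> ?F"
      using ab a b fin by (metis insert_iff empty_iff pathstart_reversepath reversepath_reversepath)
  qed
  have raf: "a \<in> free ?J ?F" "reversepath a \<in> free ?J ?F"
    using a ra rF fin by (auto simp: free_def darts_at_def)
  have F: "?F \<subseteq> full A" using A(3) full_imp_rev_full[of b A] fin by auto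
  have t: "tree (A \<inter> V) ?F" using es(1) A'(2) by simp
  have rnb: "reversepath a \<noteq> a" by (rule rev_neq[OF a(1)])
  \<comment> \<open>The two coordinates of the edge \<open>a\<close> are chosen such that its piece at \<open>v\<close> is degenerate.\<close>
  define x where "x h = (if h = a then 1 else if h = reversepath a then 0 else
    if h \<in> full A then if pathfinish h \<in> V then 1/2 else 1 else extent A h)" for h
  have x: "x \<in> closed_params (A \<inter> V) ?F" "cell (A \<inter> V) ?F x = A"
  proof -
    have raA: "reversepath a \<in> full A" "pathfinish (reversepath a) \<in> V"
      using A(2) full_imp_rev_full[of a A] fin a p by auto
    have 1: "x h = extent A h" if "h \<in> free (A \<inter> V) ?F" "h \<notin> full A" for h
      using that A(2) raA by (auto simp: x_def)
    have 2: "x h = 1" if "h \<in> free (A \<inter> V) ?F" "h \<in> full A" "pathfinish h \<notin> V" for h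
      using that fin raA by (auto simp: x_def)
    have 3: "0 \<le> x h \<and> x h + x (reversepath h) = 1"
      if h: "h \<in> free (A \<inter> V) ?F" "h \<in> full A" "pathfinish h \<in> V" for h
    proof -
      have r: "reversepath h \<in> full A" "pathfinish (reversepath h) \<in> V"
        using full_imp_rev_full[OF h(2,3)] free_D[OF h(1)] A'(2) fin p by auto
      consider "h = a" | "h = reversepath a" | "h \<noteq> a" "h \<noteq> reversepath a" by blast
      then show ?thesis
      proof cases
        case 3
        then have "reversepath h \<noteq> a" "reversepath h \<noteq> reversepath a"
          by (metis reversepath_reversepath)+
        then show ?thesis using 3 h r by (simp add: x_def)
      qed (use rnb in \<open>simp_all add: x_def\<close>)
    qed
    show "x \<in> closed_params (A \<inter> V) ?F" "cell (A \<inter> V) ?F x = A"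
      by (rule cell_representation[OF A'(1) t F]; use 1 2 3 in blast)+
  qed
  then have x': "x \<in> closed_params ?J ?F" "cell ?J ?F x = A" using A'(2) by auto
  obtain M' where M': "openin (hyperspace X) M'" "?M = M' \<inter> pair_stratum v"
    using openin_manifold_points[of ?Z "degree v"] by (auto simp: openin_subtopology)
  have "\<exists>r>0. \<forall>B\<in>subcontinua X. hausdorff_dist A B < r \<longrightarrow> B \<in> M'"
    using M' AM unfolding openin_hyperspace[OF compact_X] by blast
  then obtain r where r: "r > 0" "\<And>B. B \<in> subcontinua X \<Longrightarrow> hausdorff_dist A B < r \<Longrightarrow> B \<in> M'"
    by blast
  obtain d where d: "d > 0" "\<And>x y. x \<in> closed_params ?J ?F \<Longrightarrow> y \<in> closed_params ?J ?F \<Longrightarrow>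
      (\<forall>h\<in>free ?J ?F. \<bar>x h - y h\<bar> < d) \<Longrightarrow> hausdorff_dist (cell ?J ?F x) (cell ?J ?F y) < r"
    using cell_continuous[OF es(1) r(1)] by blast
  define e where "e = min (d/2) (1/2)"
  have e: "0 < e" "e < 1" "e < d" using d(1) by (auto simp: e_def min_def)
  let ?s = "shrink e x"
  note so = shrink_in_open_params[OF x'(1) e(1,2)]
  define y where "y = ?s(reversepath a := 0)"
  have y: "y \<in> half_params ?J ?F"
    unfolding half_params_def
  proof (clarify, intro conjI impI)
    fix h assume h: "h \<in> free ?J ?F"
    have s: "0 < ?s h" "?s h < 1" "pathfinish h \<in> ?J \<Longrightarrow> ?s h + ?s (reversepath h) < 1"
      using so(1) h by (auto simp: open_params_def)
    show "0 \<le> y h" "y h < 1" using s by (auto simp: y_def)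
    assume f: "pathfinish h \<in> ?J"
    have "reversepath h \<in> free ?J ?F" by (rule rev_free[OF es(1) h f])
    then have "0 < ?s (reversepath h)" "?s (reversepath h) < 1" using so(1) by (auto simp: open_params_def)
    then show "y h + y (reversepath h) < 1" using s f by (auto simp: y_def)
  qed
  have yc: "y \<in> closed_params ?J ?F" using y half_params_subset by blast
  have "\<bar>x h - y h\<bar> < d" if h: "h \<in> free ?J ?F" for h
  proof (cases "h = reversepath a")
    case True
    then show ?thesis using rnb d(1) by (simp add: y_def x_def)
  next
    case False
    then show ?thesis using so(2)[OF h] e(3) by (simp add: y_def abs_minus_commute)
  qed
  then have near: "hausdorff_dist A (cell ?J ?F y) < r"
    using d(2)[OF x'(1) yc] x'(2) by simp
  let ?B = "cell ?J ?F y"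
  have B: "?B \<in> subcontinua X" "?B \<inter> V = ?J" "full ?B = ?F"
    using cell_in_subcontinua(1)[OF es(1) yc] half_params_cell[OF es(1) y] by auto
  then have BQ: "?B \<in> pair_stratum v" by (auto simp: pair_stratum_def subcontinua_at_def)
  then have BM: "?B \<in> ?M" using r(2)[OF B(1) near] M'(2) by blast
  let ?S = "{A \<in> pair_stratum v. full A \<subseteq> ?F}"
  let ?j = "index (free ?J ?F) (reversepath a)"
  have j: "?j < degree v" using enum_index(3)[OF finite_free raf(2)] es(2) by simp
  have cj: "coords ?J ?F C ?j = extent C (reversepath a)" for C
    using enum_index(3,4)[OF finite_free raf(2)] by (simp add: coords_def)
  have "?B \<notin> ?M"
  proof (rule boundary_not_manifold_point[OF es(4) _ es(5,6) j])
    show "?B \<in> ?S" using BQ B(3) by simp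
    fix C assume C: "C \<in> ?S"
    have "coords ?J ?F ?B ?j = 0"
      using half_params_cell(2)[OF es(1) y raf(2)] cj by (simp add: y_def)
    moreover have "pathstart (reversepath a) \<in> C" "C \<in> subcontinua X"
      using C fin by (auto simp: pair_stratum_def subcontinua_at_def)
    then have "0 \<le> extent C (reversepath a)"
      using extent_props(1)[of C "reversepath a"] ra by auto
    ultimately show "coords ?J ?F ?B ?j \<le> coords ?J ?F C ?j" using cj by simp
  qed
  then show False using BM by blast
qed

lemma disconnected_stratum_loop:
  assumes darts: "{h \<in> D. pathstart h = p} = {a, b}" and ab: "a \<noteq> b"
    and fin: "pathfinish a = v" "pathfinish b = v" "v \<in> V" "v \<noteq> p"
  shows "\<not> connected_stratum (degree v) Y"
proof
  assume con: "connected_stratum (degree v) Y"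
  let ?Z = "subtopology (hyperspace X) (pair_stratum v)"
  let ?M = "manifold_points (degree v) ?Z"
  have a: "a \<in> D" "pathstart a = p" and b: "b \<in> D" "pathstart b = p" using darts by auto
  have deg: "degree p = 2" using darts ab by (simp add: degree_def)
  have nb: "neighbours = {v}"
    using neighbours_eq[OF darts] fin by auto
  have conM: "connectedin ?Z ?M"
    using con unfolding connected_stratum_def ldim_pair_stratum(2)[OF fin(3,4) deg nb] .
  define U where "U h = {A \<in> pair_stratum v. h \<notin> full A}" for h
  have opU: "openin ?Z (U h)" if h: "h \<in> D" for h
  proof -
    have "U h = pair_stratum v \<inter> {B \<in> subcontinua X. \<not> path_image h \<subseteq> B}"
      using h by (auto simp: U_def full_def pair_stratum_def subcontinua_at_def)
    then show ?thesis
      using openin_subtopology_Int2[OF openin_hyperspace_not_supset[OF compact_X]] by metis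
  qed
  have top: "topspace ?Z = pair_stratum v"
    by (rule edge_stratum(3)[OF a fin(1,3,4) deg])
  have sub: "?M \<subseteq> pair_stratum v"
    using openin_subset[OF openin_manifold_points, of "degree v" ?Z] top by metis
  have "?M \<subseteq> U a \<union> U b"
    using full_loop_not_manifold_point[OF darts ab fin] sub unfolding U_def by blast
  moreover have "U a \<inter> U b \<inter> ?M = {}"
  proof -
    have "a \<in> full A \<or> b \<in> full A" if A: "A \<in> pair_stratum v" for A
    proof -
      obtain h where h: "h \<in> full A" "pathstart h = p"
        using pair_stratum_full_dart[OF A fin(4)] by blast
      then have "h \<in> {a, b}" using darts by (auto simp: full_def)
      then show ?thesis using h(1) by auto
    qed
    then show ?thesis unfolding U_def by blast
  qed
  moreover have meets: "U h \<inter> ?M \<noteq> {}"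
    if g: "g \<in> D" "pathstart g = p" "pathfinish g = v" and h: "h \<in> D" "pathstart h = p" "h \<noteq> g" for g h
  proof -
    note es = edge_stratum[OF g fin(3,4) deg]
    have "(\<lambda>_. 0) \<in> closed_params {p, v} {g, reversepath g}"
      by (simp add: closed_params_def)
    moreover have "openin (hyperspace X) (subcontinua X)"
      using openin_topspace[of "hyperspace X"] topspace_hyperspace[OF compact_X] by simp
    ultimately obtain y where "y \<in> open_box {p, v} {g, reversepath g}"
      using open_cell_nearby[OF es(1)] cell_in_subcontinua(1)[OF es(1)] by blast
    then have y: "point_cell {p, v} {g, reversepath g} y \<in> ?M"
      "point_cell {p, v} {g, reversepath g} y \<in> pair_stratum v"
      "full (point_cell {p, v} {g, reversepath g} y) = {g, reversepath g}"
      using es(7,8) by auto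
    have "h \<noteq> reversepath g" using g h fin by auto
    then show ?thesis using y h(3) unfolding U_def by blast
  qed
  have "U a \<inter> ?M \<noteq> {}" "U b \<inter> ?M \<noteq> {}"
    using meets[OF b fin(2) a] meets[OF a fin(1) b] ab by auto
  ultimately show False
    using conM opU[OF a(1)] opU[OF b(1)] unfolding connectedin by blast
qed

end

section \<open>Subdividing an edge at a point\<close>

definition subarc :: "real \<Rightarrow> real \<Rightarrow> (real \<Rightarrow> 'a) \<Rightarrow> real \<Rightarrow> 'a" where
  "subarc a b h = (\<lambda>s. h ((b - a) * s + a))"

lemma reversepath_subarc: "reversepath (subarc a b h) = subarc b a h"
  by (simp add: reversepath_def subarc_def algebra_simps)

lemma subarc_ends [simp]: "pathstart (subarc a b h) = h a" "pathfinish (subarc a b h) = h b"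
  by (simp_all add: pathstart_def pathfinish_def subarc_def)

lemma subarc_parameters: "(\<lambda>s. (b - a) * s + a) ` {0..1} = closed_segment a b" for a b :: real
  unfolding closed_segment_image_interval by (rule image_cong) (simp_all add: algebra_simps)

lemma path_image_subarc: "path_image (subarc a b h) = h ` closed_segment a b"
  unfolding path_image_def subarc_def subarc_parameters[symmetric] by (simp add: image_image)

lemma simple_path_subarc:
  fixes h :: "real \<Rightarrow> 'a::topological_space"
  assumes h: "simple_path h" and ab: "a \<in> {0..1}" "b \<in> {0..1}" "a \<noteq> b" "\<bar>b - a\<bar> < 1"
  shows "simple_path (subarc a b h)"
proof -
  have sub: "closed_segment a b \<subseteq> {0..1}"
    using ab by (auto simp: closed_segment_eq_real_ivl)
  then have in01: "(b - a) * s + a \<in> {0..1}" if "s \<in> {0..1}" for s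
    using subarc_parameters[of b a] that by blast
  have "path (subarc a b h)"
    unfolding path_def subarc_def
  proof (rule continuous_on_compose2[of "{0..1}" h])
    show "continuous_on {0..1} h" using h by (simp add: simple_path_def path_def)
    show "continuous_on {0..1} (\<lambda>s. (b - a) * s + a)" by (intro continuous_intros)
  qed (use in01 in blast)
  moreover have "s = t" if st: "s \<in> {0..1}" "t \<in> {0..1}" and eq: "subarc a b h s = subarc a b h t" for s t
  proof -
    let ?x = "(b - a) * s + a" and ?y = "(b - a) * t + a"
    have "?x = ?y \<or> ?x = 0 \<and> ?y = 1 \<or> ?x = 1 \<and> ?y = 0"
      using h in01[OF st(1)] in01[OF st(2)] eq unfolding simple_path_def loop_free_def subarc_def by blast
    moreover have "\<bar>?x - ?y\<bar> < 1"
    proof -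
      have "\<bar>?x - ?y\<bar> = \<bar>b - a\<bar> * \<bar>s - t\<bar>"
        by (simp add: abs_mult[symmetric] algebra_simps)
      also have "\<dots> \<le> \<bar>b - a\<bar> * 1" by (rule mult_left_mono) (use st in auto)
      finally show ?thesis using ab(4) by simp
    qed
    ultimately have "?x = ?y" by auto
    then show ?thesis using ab(3) by simp
  qed
  ultimately show ?thesis unfolding simple_path_def loop_free_def by blast
qed

context finite_graph
begin

text \<open>If the edge is a leg, its outer part is a leg at the new vertex and carries one dart only.\<close>

definition subdivided :: "(real \<Rightarrow> 'a) \<Rightarrow> real \<Rightarrow> (real \<Rightarrow> 'a) set" where
  "subdivided h u = (D - {h, reversepath h}) \<union> {subarc u 0 h, subarc 0 u h, subarc u 1 h} \<union>
     (if pathfinish h \<in> V then {subarc 1 u h} else {})"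

lemma subdivision_point:
  assumes "h \<in> D" "0 < u" "u < 1"
  shows "h u \<notin> V" "s \<in> {0..1} \<Longrightarrow> h s = h u \<longleftrightarrow> s = u"
    "g \<in> D \<Longrightarrow> g \<noteq> h \<Longrightarrow> g \<noteq> reversepath h \<Longrightarrow> s \<in> {0..1} \<Longrightarrow> g s \<noteq> h u"
proof -
  show V: "h u \<notin> V" using inner assms by blast
  show "h s = h u \<longleftrightarrow> s = u" if "s \<in> {0..1}"
    using dart_loop_free[OF assms(1), of s u] assms that by auto
  show "g s \<noteq> h u" if "g \<in> D" "g \<noteq> h" "g \<noteq> reversepath h" "s \<in> {0..1}"
  proof
    assume "g s = h u"
    then show False
      using dart_point_unique[OF assms(1) that(1), of u s] assms V that by auto
  qed
qed

lemma finite_graph_subdivided: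
  assumes h: "h \<in> D" and u: "0 < u" "u < 1"
  shows "finite_graph X (insert (h u) V) (subdivided h u)"
proof -
  let ?p = "h u"
  let ?V = "insert ?p V" and ?D = "subdivided h u"
  let ?E = "D - {h, reversepath h}"
  let ?A = "{subarc u 0 h, subarc 0 u h}" and ?B = "{subarc u 1 h, subarc 1 u h}"
  note sp = subdivision_point[OF h u]
  have D_cases: "g \<in> ?E \<or> g \<in> ?A \<or> g \<in> ?B" if "g \<in> ?D" for g
    using that by (auto simp: subdivided_def split: if_splits)
  have B1: "pathfinish h \<in> V" if "subarc 1 u h \<in> ?D" "subarc 1 u h \<notin> ?E" "subarc 1 u h \<notin> ?A"
    "subarc 1 u h \<noteq> subarc u 1 h"
    using that by (auto simp: subdivided_def split: if_splits)
  have imA: "path_image g = h ` {0..u}" if "g \<in> ?A" for g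
    using that u by (auto simp: path_image_subarc closed_segment_eq_real_ivl)
  have imB: "path_image g = h ` {u..1}" if "g \<in> ?B" for g
    using that u by (auto simp: path_image_subarc closed_segment_eq_real_ivl)
  have subA: "path_image g \<subseteq> path_image h" if "g \<in> ?A \<union> ?B" for g
  proof -
    have "{0..u} \<subseteq> {0..1}" "{u..1} \<subseteq> {0..1}" using u by auto
    then have "h ` {0..u} \<subseteq> path_image h" "h ` {u..1} \<subseteq> path_image h"
      unfolding path_image_def by (auto intro: image_mono)
    then show ?thesis using that imA[of g] imB[of g] by (metis Un_iff)
  qed
  have EE: "path_image g \<inter> path_image h \<subseteq> V" if "g \<in> ?E" for g
    using disjoint[OF h, of g] that by auto
  have AB: "h ` {0..u} \<inter> h ` {u..1} \<subseteq> ?V"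
  proof
    fix x assume "x \<in> h ` {0..u} \<inter> h ` {u..1}"
    then obtain s t where st: "s \<in> {0..u}" "t \<in> {u..1}" "x = h s" "h s = h t" by blast
    then have "s = t \<or> s = 0 \<and> t = 1 \<or> s = 1 \<and> t = 0"
      using dart_loop_free[OF h, of s t] u by auto
    then have "s = u \<or> s = 0" using st u by auto
    then show "x \<in> ?V" using st start[OF h] by (auto simp: pathstart_def)
  qed
  have start': "pathstart g \<in> ?V" and simple': "simple_path g" and inner': "\<And>s. 0 < s \<Longrightarrow> s < 1 \<Longrightarrow> g s \<notin> ?V"
    and rev': "pathfinish g \<in> ?V \<Longrightarrow> reversepath g \<in> ?D" if g: "g \<in> ?D" for g
  proof -
    have sub: "subarc a b h s \<notin> ?V" if "0 < s" "s < 1" "(a, b) \<in> {(u, 0), (0, u), (u, 1), (1, u)}" for a b s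
    proof -
      have *: "0 < u * s" "u * s < u" "0 < (1 - u) * s" "(1 - u) * s < 1 - u"
        using that(1,2) u by auto
      then have "0 < (b - a) * s + a" "(b - a) * s + a < 1" "(b - a) * s + a \<noteq> u"
        using that(3) u by (auto simp: algebra_simps)
      then show ?thesis
        using inner[OF h, of "(b - a) * s + a"] sp(2)[of "(b - a) * s + a"] by (simp add: subarc_def)
    qed
    have simp_sub: "simple_path (subarc a b h)" if "(a, b) \<in> {(u, 0), (0, u), (u, 1), (1, u)}" for a b
      using that u simple[OF h] by (intro simple_path_subarc) auto
    show "simple_path g" using D_cases[OF g] simple simp_sub by auto
    show "g s \<notin> ?V" if s: "0 < s" "s < 1" for s
      using D_cases[OF g]
    proof (elim disjE)
      assume "g \<in> ?E"
      then show ?thesis using inner[of g s] sp(3)[of g s] s by auto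
    qed (use sub[OF s] in auto)
    show "pathstart g \<in> ?V"
    proof (cases "g \<in> ?E")
      case True
      then show ?thesis using start by auto
    next
      case False
      then have "g \<in> {subarc u 0 h, subarc 0 u h, subarc u 1 h} \<or> g = subarc 1 u h \<and> pathfinish h \<in> V"
        using g by (auto simp: subdivided_def split: if_splits)
      then show ?thesis using start[OF h] by (auto simp: pathstart_def pathfinish_def subarc_def)
    qed
    assume f: "pathfinish g \<in> ?V"
    show "reversepath g \<in> ?D"
    proof (cases "g \<in> ?E")
      case True
      then have "pathfinish g \<noteq> ?p" using sp(3)[of g 1] by (auto simp: pathfinish_def)
      then have "reversepath g \<in> D" using f rev True by auto
      moreover have "reversepath g \<noteq> h" "reversepath g \<noteq> reversepath h"
        using True by (metis DiffE insertCI reversepath_reversepath)+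
      ultimately show ?thesis by (auto simp: subdivided_def)
    next
      case False
      then have "g \<in> {subarc u 0 h, subarc 0 u h} \<or> g = subarc u 1 h \<or> g = subarc 1 u h"
        using g by (auto simp: subdivided_def split: if_splits)
      moreover have "pathfinish h \<in> V" if "g = subarc u 1 h"
        using that f sp(2)[of 1] u by (auto simp: pathfinish_def subarc_def)
      ultimately show ?thesis by (auto simp: subdivided_def reversepath_subarc)
    qed
  qed
  have disj': "path_image g \<inter> path_image g' \<subseteq> ?V"
    if g: "g \<in> ?D" "g' \<in> ?D" "g' \<noteq> g" "g' \<noteq> reversepath g" for g g'
  proof -
    consider "g \<in> ?E" "g' \<in> ?E" | "g \<in> ?E" "g' \<in> ?A \<union> ?B" | "g \<in> ?A \<union> ?B" "g' \<in> ?E"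
      | "g \<in> ?A" "g' \<in> ?A" | "g \<in> ?B" "g' \<in> ?B" | "g \<in> ?A" "g' \<in> ?B" | "g \<in> ?B" "g' \<in> ?A"
      using D_cases[OF g(1)] D_cases[OF g(2)] by blast
    then show ?thesis
    proof cases
      case 1
      then show ?thesis using disjoint[of g g'] g by auto
    next
      case 2
      then show ?thesis using EE[of g] subA[of g'] by blast
    next
      case 3
      then show ?thesis using EE[of g'] subA[of g] by blast
    next
      case 4
      then show ?thesis using g by (auto simp: reversepath_subarc)
    next
      case 5
      then show ?thesis using g by (auto simp: reversepath_subarc)
    next
      case 6
      then show ?thesis using imA[of g] imB[of g'] AB by auto
    next
      case 7
      then show ?thesis using imA[of g'] imB[of g] AB by auto
    qed
  qed
  have imh: "path_image h = h ` {0..u} \<union> h ` {u..1}"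
  proof -
    have "{0..1} = {0..u} \<union> {u..1}" using u by auto
    then show ?thesis unfolding path_image_def by (simp add: image_Un)
  qed
  have space': "X = ?V \<union> (\<Union>g\<in>?D. path_image g)"
  proof
    have pX: "?p \<in> X" using dart_in_X[OF h, of u] u by auto
    have "path_image g \<subseteq> X" if "g \<in> ?D" for g
      using D_cases[OF that] subA[of g] dart_image_subset[of g] dart_image_subset[OF h] by blast
    then show "?V \<union> (\<Union>g\<in>?D. path_image g) \<subseteq> X" using pX V_subset by blast
    have "path_image g \<subseteq> (\<Union>g\<in>?D. path_image g)" if g: "g \<in> D" for g
    proof (cases "g = h \<or> g = reversepath h")
      case True
      then have "path_image g = path_image (subarc u 0 h) \<union> path_image (subarc u 1 h)"
        using imh imA[of "subarc u 0 h"] imB[of "subarc u 1 h"] by auto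
      then show ?thesis unfolding subdivided_def by blast
    next
      case False
      then have "g \<in> ?D" using g by (simp add: subdivided_def)
      then show ?thesis by blast
    qed
    then show "X \<subseteq> ?V \<union> (\<Union>g\<in>?D. path_image g)" unfolding space_eq by blast
  qed
  have "finite ?D" using finite_D by (simp add: subdivided_def)
  then show ?thesis
    using finite_V start' simple' inner' rev' disj' space' by unfold_locales auto
qed

text \<open>At the old vertices, the darts of the subdivided edge are replaced by their initial parts, also for
  a loop, where both start at the same vertex.\<close>

lemma subdivided_darts:
  assumes h: "h \<in> D" and u: "0 < u" "u < 1"
  shows "{g \<in> subdivided h u. pathstart g = h u} = {subarc u 0 h, subarc u 1 h}"
    "subarc u 0 h \<noteq> subarc u 1 h"
    "v \<in> V \<Longrightarrow> card {g \<in> subdivided h u. pathstart g = v} = degree v"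
proof -
  let ?p = "h u" and ?E = "D - {h, reversepath h}"
  note sp = subdivision_point[OF h u]
  have h0: "h 0 \<in> V" using start[OF h] by (simp add: pathstart_def)
  have h01: "h 0 \<noteq> ?p" "h 1 \<noteq> ?p" using sp(2)[of 0] sp(2)[of 1] u by auto
  have Ep: "pathstart g \<noteq> ?p" if "g \<in> ?E" for g
    using sp(3)[of g 0] that by (auto simp: pathstart_def)
  show "{g \<in> subdivided h u. pathstart g = ?p} = {subarc u 0 h, subarc u 1 h}"
    using Ep h01 by (auto simp: subdivided_def split: if_splits)
  have half: "subarc u 0 h (1/2) = h (u/2)" "subarc u 1 h (1/2) = h ((1 + u)/2)"
    "subarc 0 u h (1/2) = h (u/2)" "subarc 1 u h (1/2) = h ((1 + u)/2)"
    unfolding subarc_def by (rule arg_cong[of _ _ h], simp add: field_simps)+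
  have ne: "h (u/2) \<noteq> h ((1 + u)/2)"
    using subdivision_point(2)[OF h, of "u/2" "(1+u)/2"] u by auto
  show "subarc u 0 h \<noteq> subarc u 1 h" using half ne by metis
  have ne': "subarc 0 u h \<noteq> subarc 1 u h" using half ne by metis
  have notE: "g \<notin> ?E" if "g \<in> {subarc 0 u h, subarc 1 u h}" for g
  proof
    assume gE: "g \<in> ?E"
    have "g (1/2) \<in> {h (u/2), h ((1 + u)/2)}" using that half by auto
    then show False
      using subdivision_point(3)[OF h, of "u/2" g "1/2"] subdivision_point(3)[OF h, of "(1+u)/2" g "1/2"] u gE by auto
  qed
  show "card {g \<in> subdivided h u. pathstart g = v} = degree v" if v: "v \<in> V"
  proof -
    define S where "S = {g \<in> ?E. pathstart g = v}"
    define P where "P a b = S \<union> (if pathstart h = v then {a} else {}) \<union> (if pathfinish h = v then {b} else {})"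
      for a b :: "real \<Rightarrow> 'a"
    have finS: "finite S" using finite_D by (simp add: S_def)
    have cardP: "card (P a b) = card S + (if pathstart h = v then 1 else 0) + (if pathfinish h = v then 1 else 0)"
      if "a \<notin> S" "b \<notin> S" "a \<noteq> b" for a b
      using finS that by (auto simp: P_def)
    have "{g \<in> D. pathstart g = v} = P h (reversepath h)"
      using h rev[OF h] v by (auto simp: P_def S_def split: if_splits)
    moreover have "{g \<in> subdivided h u. pathstart g = v} = P (subarc 0 u h) (subarc 1 u h)"
    proof -
      have "?p \<noteq> v" using sp(1) v by auto
      then show ?thesis
        using v by (auto simp: P_def S_def subdivided_def pathstart_def pathfinish_def subarc_def split: if_splits)
    qed
    moreover have "h \<notin> S" "reversepath h \<notin> S" "h \<noteq> reversepath h"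
      using rev_neq[OF h] by (auto simp: S_def)
    moreover have "subarc 0 u h \<notin> S" "subarc 1 u h \<notin> S"
      using notE by (auto simp: S_def)
    ultimately show ?thesis
      using cardP[of h "reversepath h"] cardP[of "subarc 0 u h" "subarc 1 u h"] ne'
      by (simp add: degree_def)
  qed
qed

text \<open>This turns a tip into a vertex, so that the invariants at a vertex apply to it.\<close>

lemma finite_graph_tip:
  assumes h: "h \<in> D" "pathfinish h \<notin> V"
  shows "finite_graph X (insert (pathfinish h) V) (insert (reversepath h) D)"
    "{g \<in> insert (reversepath h) D. pathstart g = pathfinish h} = {reversepath h}"
    "v \<in> V \<Longrightarrow> {g \<in> insert (reversepath h) D. pathstart g = v} = {g \<in> D. pathstart g = v}"
proof -
  have tip: "pathfinish h = h 1" by (simp add: pathfinish_def)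
  have hs: "g s \<noteq> h 1" if "g \<in> D" "0 < s" "s < 1" for g s
  proof
    assume "g s = h 1"
    then show False
      using dart_point_unique[OF that(1) h(1), of s 1] that h(2) tip by auto
  qed
  have fin: "g = h" if "g \<in> D" "pathfinish g = h 1" for g
    using dart_point_unique[OF that(1) h(1), of 1 1] that h(2) tip by (auto simp: pathfinish_def)
  have hX: "h 1 \<in> X" using dart_in_X[OF h(1), of 1] by simp
  show "finite_graph X (insert (pathfinish h) V) (insert (reversepath h) D)"
  proof
    fix g assume g: "g \<in> insert (reversepath h) D"
    show "simple_path g" using g simple h(1) by (auto simp: simple_path_reversepath)
    show "pathstart g \<in> insert (pathfinish h) V" using g start by auto
    show "g s \<notin> insert (pathfinish h) V" if s: "0 < s" "s < 1" for s
    proof (cases "g = reversepath h")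
      case True
      then have "g s = h (1 - s)" by (simp add: reversepath_def)
      then show ?thesis using inner[OF h(1), of "1 - s"] hs[OF h(1), of "1 - s"] s tip by auto
    next
      case False
      then show ?thesis using g inner[of g s] hs[of g s] s tip by auto
    qed
    show "reversepath g \<in> insert (reversepath h) D" if "pathfinish g \<in> insert (pathfinish h) V"
      using g that fin[of g] rev[of g] h tip by auto
    fix g' assume g': "g' \<in> insert (reversepath h) D" "g' \<noteq> g" "g' \<noteq> reversepath g"
    define k k' where "k = (if g = reversepath h then h else g)" and "k' = (if g' = reversepath h then h else g')"
    have "k \<in> D" "k' \<in> D" "path_image k = path_image g" "path_image k' = path_image g'"
      using g g' h(1) by (auto simp: k_def k'_def)
    moreover have "k' \<noteq> k" "k' \<noteq> reversepath k"
      using g'(2,3) unfolding k_def k'_def by (metis reversepath_reversepath)+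
    ultimately have "path_image g \<inter> path_image g' \<subseteq> V"
      using disjoint[of k k'] by auto
    then show "path_image g \<inter> path_image g' \<subseteq> insert (pathfinish h) V" by auto
  next
    have "(\<Union>g\<in>insert (reversepath h) D. path_image g) = (\<Union>g\<in>D. path_image g)"
      using h(1) by auto
    then show "X = insert (pathfinish h) V \<union> (\<Union>g\<in>insert (reversepath h) D. path_image g)"
      using hX tip space_eq by auto
  qed (use finite_V finite_D in auto)
  show "{g \<in> insert (reversepath h) D. pathstart g = pathfinish h} = {reversepath h}"
  proof -
    have "pathstart g \<noteq> pathfinish h" if "g \<in> D" for g using start[OF that] h(2) by auto
    then show ?thesis by auto
  qed
  show "{g \<in> insert (reversepath h) D. pathstart g = v} = {g \<in> D. pathstart g = v}" if "v \<in> V"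
    using that h by auto
qed

end

section \<open>Classification of the points of a graph\<close>

text \<open>A point other than a vertex is classified by the vertices at the ends of its edge. A tip is the
  loose end of a leg, and \<open>Leg\<close> stands for the inner points of legs.\<close>

datatype 'a point_type = Vertex 'a | Tip 'a | Leg 'a | Loop 'a | Edge "'a set"

context finite_graph
begin

definition of_type :: "'a point_type \<Rightarrow> 'a \<Rightarrow> bool" where
  "of_type \<tau> x = (case \<tau> of
     Vertex v \<Rightarrow> v \<in> V \<and> x = v
   | Tip v \<Rightarrow> \<exists>h\<in>D. pathstart h = v \<and> pathfinish h \<notin> V \<and> x = pathfinish h
   | Leg v \<Rightarrow> \<exists>h\<in>D. \<exists>u. 0 < u \<and> u < 1 \<and> pathstart h = v \<and> pathfinish h \<notin> V \<and> x = h u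
   | Loop v \<Rightarrow> \<exists>h\<in>D. \<exists>u. 0 < u \<and> u < 1 \<and> pathstart h = v \<and> pathfinish h = v \<and> x = h u
   | Edge S \<Rightarrow> \<exists>h\<in>D. \<exists>u. 0 < u \<and> u < 1 \<and> S = {pathstart h, pathfinish h} \<and> pathfinish h \<in> V \<and>
       pathstart h \<noteq> pathfinish h \<and> x = h u)"

definition leg_vertices :: "'a set" where
  "leg_vertices = {v. \<exists>h\<in>D. pathstart h = v \<and> pathfinish h \<notin> V}"

definition loop_vertices :: "'a set" where
  "loop_vertices = {v. \<exists>h\<in>D. pathstart h = v \<and> pathfinish h = v}"

definition edge_ends :: "'a set set" where
  "edge_ends = {{pathstart h, pathfinish h} | h. h \<in> D \<and> pathfinish h \<in> V \<and> pathstart h \<noteq> pathfinish h}"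

definition point_types :: "'a point_type set" where
  "point_types = Vertex ` V \<union> Tip ` leg_vertices \<union> Leg ` leg_vertices \<union> Loop ` loop_vertices \<union> Edge ` edge_ends"

lemma card_point_types:
  "finite point_types" "card point_types = card V + 2 * card leg_vertices + card loop_vertices + card edge_ends"
proof -
  have "leg_vertices \<subseteq> pathstart ` D" "loop_vertices \<subseteq> pathstart ` D"
    "edge_ends \<subseteq> (\<lambda>h. {pathstart h, pathfinish h}) ` D"
    by (auto simp: leg_vertices_def loop_vertices_def edge_ends_def)
  then have fin: "finite leg_vertices" "finite loop_vertices" "finite edge_ends"
    using finite_D finite_surj by blast+
  then show "finite point_types" using finite_V by (simp add: point_types_def)
  have inj: "inj_on Vertex V" "inj_on Tip leg_vertices" "inj_on Leg leg_vertices" "inj_on Loop loop_vertices" "inj_on Edge edge_ends"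
    by (auto simp: inj_on_def)
  show "card point_types = card V + 2 * card leg_vertices + card loop_vertices + card edge_ends"
    unfolding point_types_def using fin finite_V
    by (subst card_Un_disjoint, simp, simp, blast)+ (simp add: inj card_image)
qed

lemma of_type_in_X: "of_type \<tau> x \<Longrightarrow> x \<in> X"
  using V_subset dart_in_X by (auto simp: of_type_def pathfinish_def split: point_type.splits)

lemma of_type_inner:
  assumes "h \<in> D" "0 < u" "u < 1"
  shows "pathfinish h \<notin> V \<Longrightarrow> of_type (Leg (pathstart h)) (h u)"
    "pathfinish h = pathstart h \<Longrightarrow> of_type (Loop (pathstart h)) (h u)"
    "pathfinish h \<in> V \<Longrightarrow> pathstart h \<noteq> pathfinish h \<Longrightarrow> of_type (Edge {pathstart h, pathfinish h}) (h u)"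
  using assms unfolding of_type_def point_type.case by blast+

lemma point_has_type:
  assumes "x \<in> X"
  shows "\<exists>\<tau>\<in>point_types. of_type \<tau> x"
  using assms
proof (cases x rule: point_cases)
  case 1
  then show ?thesis by (intro bexI[of _ "Vertex x"]) (auto simp: of_type_def point_types_def)
next
  case (2 h u)
  have u0: "u \<noteq> 0" using 2 start[of h] by (auto simp: pathstart_def)
  consider "u = 1" | "u < 1" "pathfinish h \<notin> V" | "u < 1" "pathfinish h \<in> V" "pathfinish h = pathstart h"
    | "u < 1" "pathfinish h \<in> V" "pathfinish h \<noteq> pathstart h"
    using 2 by force
  then show ?thesis
  proof cases
    case 1
    then have f: "pathfinish h \<notin> V" "x = pathfinish h" using 2 by (simp_all add: pathfinish_def)
    then have "of_type (Tip (pathstart h)) x"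
      using 2(1) unfolding of_type_def by auto
    moreover have "pathstart h \<in> leg_vertices" using f 2 by (auto simp: leg_vertices_def)
    ultimately show ?thesis by (auto simp: point_types_def)
  next
    case b: 2
    have "of_type (Leg (pathstart h)) x"
      using of_type_inner(1)[of h u] b 2 u0 by auto
    moreover have "pathstart h \<in> leg_vertices" using b 2 by (auto simp: leg_vertices_def)
    ultimately show ?thesis by (auto simp: point_types_def)
  next
    case 3
    have "of_type (Loop (pathstart h)) x"
      using of_type_inner(2)[of h u] 3 2 u0 by auto
    moreover have "pathstart h \<in> loop_vertices" using 3 2 by (auto simp: loop_vertices_def)
    ultimately show ?thesis by (auto simp: point_types_def)
  next
    case 4
    have "of_type (Edge {pathstart h, pathfinish h}) x"
      using of_type_inner(3)[of h u] 4 2 u0 by auto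
    moreover have "{pathstart h, pathfinish h} \<in> edge_ends"
      unfolding edge_ends_def by (intro CollectI exI[of _ h] conjI refl) (use 4 2 in auto)
    then have "Edge {pathstart h, pathfinish h} \<in> point_types" by (simp add: point_types_def)
    ultimately show ?thesis by blast
  qed
qed

lemma type_has_point:
  assumes "\<tau> \<in> point_types"
  shows "\<exists>x\<in>X. of_type \<tau> x"
proof -
  have half: "(0::real) < 1/2" "(1/2::real) < 1" by auto
  have "\<exists>x. of_type \<tau> x"
  proof (cases \<tau>)
    case (Vertex v)
    then show ?thesis using assms by (auto simp: of_type_def point_types_def)
  next
    case (Tip v)
    then show ?thesis using assms by (auto simp: of_type_def point_types_def leg_vertices_def)
  next
    case (Leg v)
    then obtain h where "h \<in> D" "pathstart h = v" "pathfinish h \<notin> V"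
      using assms by (auto simp: point_types_def leg_vertices_def)
    then have "of_type \<tau> (h (1/2))" using of_type_inner(1)[OF _ half] Leg by auto
    then show ?thesis by blast
  next
    case (Loop v)
    then obtain h where "h \<in> D" "pathstart h = v" "pathfinish h = v"
      using assms by (auto simp: point_types_def loop_vertices_def)
    then have "of_type \<tau> (h (1/2))" using of_type_inner(2)[OF _ half] Loop by auto
    then show ?thesis by blast
  next
    case (Edge S)
    then have "S \<in> edge_ends" using assms by (auto simp: point_types_def)
    then obtain h where "h \<in> D" "S = {pathstart h, pathfinish h}" "pathfinish h \<in> V" "pathstart h \<noteq> pathfinish h"
      unfolding edge_ends_def by blast
    then have "of_type \<tau> (h (1/2))" using of_type_inner(3)[OF _ half] Edge by simp
    then show ?thesis by blast
  qed
  then show ?thesis using of_type_in_X by blast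
qed

definition movable :: "'a \<Rightarrow> 'a \<Rightarrow> bool" where
  "movable x y \<longleftrightarrow> (\<exists>f g. homeomorphism X X f g \<and> f x = y)"

lemma movable_trans: "movable x y \<Longrightarrow> movable y z \<Longrightarrow> movable x z"
  unfolding movable_def by (metis homeomorphism_compose comp_apply)

lemma movable_twins:
  assumes h: "h \<in> D" "h' \<in> D" and s: "pathstart h = pathstart h'"
    and f: "pathfinish h = pathfinish h' \<or> pathfinish h \<notin> V \<and> pathfinish h' \<notin> V"
  shows "0 < u \<Longrightarrow> u < 1 \<Longrightarrow> 0 < u' \<Longrightarrow> u' < 1 \<Longrightarrow> movable (h u) (h' u')"
    "pathfinish h \<notin> V \<Longrightarrow> movable (pathfinish h) (pathfinish h')"
proof -
  have slide: "movable (g u) (g u')" if "g \<in> D" "0 < u" "u < 1" "0 < u'" "u' < 1" for g u u'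
    using slide_homeomorphism[OF that] by (auto simp: movable_def)
  have swap: "movable (h u) (h' u)" if "h' \<noteq> h" "h' \<noteq> reversepath h" "u \<in> {0..1}" for u
    using swap_homeomorphism[OF h that(1,2) s f] that(3) unfolding movable_def by blast
  show "movable (h u) (h' u')" if u: "0 < u" "u < 1" "0 < u'" "u' < 1"
  proof -
    consider "h' = h" | "h' = reversepath h" | "h' \<noteq> h" "h' \<noteq> reversepath h" by blast
    then show ?thesis
    proof cases
      case 1
      then show ?thesis using slide[OF h(1) u] by simp
    next
      case 2
      then show ?thesis using slide[OF h(1), of u "1 - u'"] u by (simp add: reversepath_def)
    next
      case 3
      then show ?thesis
        using movable_trans[OF swap[OF 3, of u] slide[OF h(2) u]] u by auto
    qed
  qed
  show "movable (pathfinish h) (pathfinish h')" if loose: "pathfinish h \<notin> V"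
  proof (cases "h' = h")
    case True
    then show ?thesis using homeomorphism_ident[of X] by (auto simp: movable_def)
  next
    case False
    moreover have "h' \<noteq> reversepath h" using start[OF h(2)] loose by auto
    ultimately show ?thesis using swap[of 1] by (simp add: pathfinish_def)
  qed
qed

lemma same_type_movable:
  assumes "of_type \<tau> x" "of_type \<tau> y"
  shows "movable x y"
proof (cases \<tau>)
  case (Vertex v)
  then show ?thesis using assms homeomorphism_ident[of X] by (auto simp: of_type_def movable_def)
next
  case (Tip v)
  then show ?thesis using assms movable_twins(2) by (auto simp: of_type_def)
next
  case (Leg v)
  then show ?thesis using assms movable_twins(1) by (auto simp: of_type_def)
next
  case (Loop v)
  then show ?thesis using assms movable_twins(1) by (auto simp: of_type_def)
next
  case (Edge S)
  then obtain h u h' u' where h: "h \<in> D" "0 < u" "u < 1" "S = {pathstart h, pathfinish h}"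
      "pathfinish h \<in> V" "pathstart h \<noteq> pathfinish h" "x = h u"
    and h': "h' \<in> D" "0 < u'" "u' < 1" "S = {pathstart h', pathfinish h'}"
      "pathfinish h' \<in> V" "pathstart h' \<noteq> pathfinish h'" "y = h' u'"
    using assms by (auto simp: of_type_def)
  have "pathstart h = pathstart h' \<and> pathfinish h = pathfinish h' \<or>
      pathstart h = pathfinish h' \<and> pathfinish h = pathstart h'"
    using h(4) h'(4) by (metis doubleton_eq_iff)
  then show ?thesis
  proof
    assume "pathstart h = pathstart h' \<and> pathfinish h = pathfinish h'"
    then show ?thesis using movable_twins(1)[OF h(1) h'(1)] h h' by auto
  next
    assume a: "pathstart h = pathfinish h' \<and> pathfinish h = pathstart h'"
    have "reversepath h' \<in> D" using rev h' by auto
    moreover have "y = reversepath h' (1 - u')" using h' by (simp add: reversepath_def)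
    ultimately show ?thesis
      using movable_twins(1)[OF h(1), of "reversepath h'" u "1 - u'"] a h h' by auto
  qed
qed

end

text \<open>The vertex degrees are recovered from the invariants, so that the degree being injective makes
  the type of a point a homeomorphism invariant of the hyperspace at that point.\<close>

locale rigid_graph = finite_graph +
  assumes min_degree: "v \<in> V \<Longrightarrow> 3 \<le> degree v"
    and inj_degree: "inj_on degree V"
begin

lemma degree_eq_iff: "v \<in> V \<Longrightarrow> w \<in> V \<Longrightarrow> degree v = degree w \<longleftrightarrow> v = w"
  using inj_degree by (auto simp: inj_on_def)

lemma vertex_invariant:
  assumes "v \<in> V"
  shows "lowest_dim (hyperspace_at v X) = degree v"
proof -
  interpret graph_at X V D v
    using assms min_degree by unfold_locales auto
  show ?thesis by (rule lowest_dim_Y)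
qed

lemma tip_invariants:
  assumes h: "h \<in> D" "pathfinish h \<notin> V"
  shows "lowest_dim (hyperspace_at (pathfinish h) X) = 1"
    "closure_dims (hyperspace_at (pathfinish h) X) = {1, degree (pathstart h) - 1}"
proof -
  let ?p = "pathfinish h" and ?v = "pathstart h"
  note tip = finite_graph_tip[OF h]
  interpret T: finite_graph X "insert ?p V" "insert (reversepath h) D" by (rule tip(1))
  have deg: "T.degree v = degree v" if "v \<in> V" for v
    using tip(3)[OF that] by (simp add: T.degree_def degree_def)
  have degp: "T.degree ?p = 1"
    using tip(2) by (simp add: T.degree_def)
  interpret T: graph_at X "insert ?p V" "insert (reversepath h) D" ?p
    using deg min_degree by unfold_locales auto
  have v: "?v \<in> V" "?v \<noteq> ?p" using start[OF h(1)] h(2) by auto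
  have "T.neighbours = {?v}"
    using T.neighbours_eq[of "reversepath h" "reversepath h"] tip(2) v by auto
  then show "closure_dims (hyperspace_at ?p X) = {1, degree ?v - 1}"
    using T.closure_dims_one_neighbour[of ?v] degp deg[OF v(1)] by simp
  show "lowest_dim (hyperspace_at ?p X) = 1"
    using T.lowest_dim_Y degp by simp
qed

lemma inner_point_invariants:
  assumes h: "h \<in> D" and u: "0 < u" "u < 1"
  defines "Y \<equiv> hyperspace_at (h u) X" and "v \<equiv> pathstart h" and "w \<equiv> pathfinish h"
  shows "lowest_dim Y = 2"
    "w \<notin> V \<Longrightarrow> closure_dims Y = {2, degree v} \<and> connected_stratum (degree v) Y"
    "w = v \<Longrightarrow> closure_dims Y = {2, degree v} \<and> \<not> connected_stratum (degree v) Y"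
    "w \<in> V \<Longrightarrow> w \<noteq> v \<Longrightarrow> {2, degree v, degree w} \<subseteq> closure_dims Y \<and>
      closure_dims Y \<subseteq> {2, degree v, degree w, degree v + degree w - 2}"
proof -
  let ?p = "h u" and ?D = "subdivided h u"
  note sd = subdivided_darts[OF h u]
  have pV: "?p \<notin> V" by (rule subdivision_point(1)[OF h u])
  interpret T: finite_graph X "insert ?p V" ?D by (rule finite_graph_subdivided[OF h u])
  have deg: "T.degree v = degree v" if "v \<in> V" for v
    using sd(3)[OF that] by (simp add: T.degree_def)
  have degp: "T.degree ?p = 2"
    using sd(1,2) by (simp add: T.degree_def)
  interpret T: graph_at X "insert ?p V" ?D ?p
    using deg min_degree by unfold_locales auto
  let ?a = "subarc u 0 h" and ?b = "subarc u 1 h"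
  have fin: "pathfinish ?a = v" "pathfinish ?b = w"
    by (simp_all add: v_def w_def pathstart_def pathfinish_def subarc_def)
  have v: "v \<in> V" "v \<noteq> ?p" using start[OF h] pV by (auto simp: v_def)
  have wp: "w \<noteq> ?p"
    using subdivision_point(2)[OF h u, of 1] u by (auto simp: w_def pathfinish_def)
  have nb: "T.neighbours = {v, w} \<inter> insert ?p V - {?p}"
    using T.neighbours_eq[OF sd(1)] fin by simp
  show "lowest_dim Y = 2" using T.lowest_dim_Y degp by (simp add: Y_def)
  have one: "closure_dims Y = {2, degree v}" if "T.neighbours = {v}"
    using T.closure_dims_one_neighbour[OF that] degp deg[OF v(1)] by (simp add: Y_def)
  show "closure_dims Y = {2, degree v} \<and> connected_stratum (degree v) Y" if w: "w \<notin> V"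
  proof
    have "T.neighbours = {v}" using nb v w wp by auto
    then show "closure_dims Y = {2, degree v}" by (rule one)
    have "connected_stratum (T.degree v) Y"
      unfolding Y_def using T.connected_stratum_leg[OF sd(1,2) fin(1)] v w wp fin(2) by auto
    then show "connected_stratum (degree v) Y" using deg[OF v(1)] by simp
  qed
  show "closure_dims Y = {2, degree v} \<and> \<not> connected_stratum (degree v) Y" if w: "w = v"
  proof
    have "T.neighbours = {v}" using nb v w by auto
    then show "closure_dims Y = {2, degree v}" by (rule one)
    have "\<not> connected_stratum (T.degree v) Y"
      unfolding Y_def using T.disconnected_stratum_loop[OF sd(1,2) fin(1)] v w fin(2) by auto
    then show "\<not> connected_stratum (degree v) Y" using deg[OF v(1)] by simp
  qed
  show "{2, degree v, degree w} \<subseteq> closure_dims Y \<and>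
      closure_dims Y \<subseteq> {2, degree v, degree w, degree v + degree w - 2}" if w: "w \<in> V" "w \<noteq> v"
  proof -
    have "T.neighbours = {v, w}" using nb v w wp by auto
    then show ?thesis
      using T.closure_dims_two_neighbours[of v w] w(2) degp deg[OF v(1)] deg[OF w(1)] by (simp add: Y_def)
  qed
qed

lemma ends_determined:
  fixes a b c d :: nat
  assumes "a \<noteq> b" "c \<noteq> d" "3 \<le> a" "3 \<le> b" "3 \<le> c" "3 \<le> d"
    and "{2, a, b} \<subseteq> C" "C \<subseteq> {2, a, b, a + b - 2}" "{2, c, d} \<subseteq> C" "C \<subseteq> {2, c, d, c + d - 2}"
  shows "a = c \<and> b = d \<or> a = d \<and> b = c"
proof -
  have m: "a = c \<or> a = d \<or> a = c + d - 2" "b = c \<or> b = d \<or> b = c + d - 2"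
    "c = a \<or> c = b \<or> c = a + b - 2" "d = a \<or> d = b \<or> d = a + b - 2"
  proof -
    have "a \<in> {2, c, d, c + d - 2}" "b \<in> {2, c, d, c + d - 2}"
      by (rule subsetD[OF assms(10)], rule subsetD[OF assms(7)], simp)+
    moreover have "c \<in> {2, a, b, a + b - 2}" "d \<in> {2, a, b, a + b - 2}"
      by (rule subsetD[OF assms(8)], rule subsetD[OF assms(9)], simp)+
    moreover have "a \<noteq> 2" "b \<noteq> 2" "c \<noteq> 2" "d \<noteq> 2" using assms(3-6) by simp_all
    ultimately show "a = c \<or> a = d \<or> a = c + d - 2" "b = c \<or> b = d \<or> b = c + d - 2"
      "c = a \<or> c = b \<or> c = a + b - 2" "d = a \<or> d = b \<or> d = a + b - 2"
      unfolding insert_iff empty_iff by simp_all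
  qed
  have "a \<noteq> c + d - 2"
  proof
    assume "a = c + d - 2"
    then have "c = b" "d = b" using m(3,4) assms(3-6) by linarith+
    then show False using assms(2) by simp
  qed
  moreover have "b \<noteq> c + d - 2"
  proof
    assume "b = c + d - 2"
    then have "c = a" "d = a" using m(3,4) assms(3-6) by linarith+
    then show False using assms(2) by simp
  qed
  ultimately show ?thesis using m(1,2) assms(1) by blast
qed

text \<open>The lowest local dimension is at least three at a vertex, one at a tip and two at all other points.
  In the last two cases the dimensions in the closure determine the degrees of the end vertices, and
  thereby these vertices and whether there are one or two of them. A leg and a loop differ in the
  connectedness of a stratum.\<close>

lemma homeomorphic_imp_same_type:
  assumes x: "of_type \<sigma> x" and y: "of_type \<tau> y"
    and hom: "hyperspace_at x X homeomorphic_space hyperspace_at y X"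
  shows "\<sigma> = \<tau>"
proof -
  let ?low = "\<lambda>x. lowest_dim (hyperspace_at x X)" and ?cl = "\<lambda>x. closure_dims (hyperspace_at x X)"
  let ?con = "\<lambda>k x. connected_stratum k (hyperspace_at x X)"
  have inv: "?low x = ?low y" "?cl x = ?cl y" "\<And>k. ?con k x = ?con k y"
    using invariants_homeomorphic[OF hom] by auto
  have desc: "(\<exists>v\<in>V. \<tau> = Vertex v \<and> x = v \<and> ?low x = degree v) \<or>
      (\<exists>v\<in>V. \<tau> = Tip v \<and> ?low x = 1 \<and> ?cl x = {1, degree v - 1}) \<or>
      (\<exists>v\<in>V. \<tau> = Leg v \<and> ?low x = 2 \<and> ?cl x = {2, degree v} \<and> ?con (degree v) x) \<or>
      (\<exists>v\<in>V. \<tau> = Loop v \<and> ?low x = 2 \<and> ?cl x = {2, degree v} \<and> \<not> ?con (degree v) x) \<or>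
      (\<exists>v\<in>V. \<exists>w\<in>V. \<tau> = Edge {v, w} \<and> v \<noteq> w \<and> ?low x = 2 \<and> {2, degree v, degree w} \<subseteq> ?cl x \<and>
        ?cl x \<subseteq> {2, degree v, degree w, degree v + degree w - 2})"
    if x: "of_type \<tau> x" for \<tau> x
  proof (cases \<tau>)
    case (Vertex v)
    then show ?thesis using x vertex_invariant by (auto simp: of_type_def)
  next
    case (Tip v)
    then obtain h where "h \<in> D" "pathstart h = v" "pathfinish h \<notin> V" "x = pathfinish h"
      using x by (auto simp: of_type_def)
    then show ?thesis using tip_invariants[of h] start[of h] Tip by auto
  next
    case (Leg v)
    then obtain h u where "h \<in> D" "0 < u" "u < 1" "pathstart h = v" "pathfinish h \<notin> V" "x = h u"
      using x by (auto simp: of_type_def)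
    then show ?thesis using inner_point_invariants(1,2)[of h u] start[of h] Leg by auto
  next
    case (Loop v)
    then obtain h u where "h \<in> D" "0 < u" "u < 1" "pathstart h = v" "pathfinish h = v" "x = h u"
      using x by (auto simp: of_type_def)
    then show ?thesis using inner_point_invariants(1,3)[of h u] start[of h] Loop by auto
  next
    case (Edge S)
    then obtain h u where h: "h \<in> D" "0 < u" "u < 1" "S = {pathstart h, pathfinish h}"
        "pathfinish h \<in> V" "pathstart h \<noteq> pathfinish h" "x = h u"
      using x by (auto simp: of_type_def)
    then have "\<tau> = Edge {pathstart h, pathfinish h}" "pathstart h \<in> V" using Edge start by auto
    then show ?thesis
      using inner_point_invariants(1,4)[of h u] h by (intro disjI2 bexI[of _ "pathstart h"] bexI[of _ "pathfinish h"]) auto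
  qed
  have two: "degree v = degree w" if "v \<in> V" "w \<in> V" "{2, degree v} = {2, degree w}" for v w
    using that min_degree[of v] min_degree[of w] by (auto simp: doubleton_eq_iff)
  have three: False if "v \<in> V" "w \<in> V" "v \<noteq> w" "{2, degree v, degree w} \<subseteq> {2, degree z}" for v w z
    using that min_degree[of v] min_degree[of w] degree_eq_iff[of v w] by auto
  from desc[OF x] show ?thesis
  proof (elim disjE bexE conjE)
    fix v assume v: "v \<in> V" "\<sigma> = Vertex v" "?low x = degree v"
    then show ?thesis
      using desc[OF y] inv(1) min_degree[of v] degree_eq_iff[of v] by auto
  next
    fix v assume v: "v \<in> V" "\<sigma> = Tip v" "?low x = 1" "?cl x = {1, degree v - 1}"
    have "\<exists>w\<in>V. \<tau> = Tip w \<and> ?cl y = {1, degree w - 1}"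
      using desc[OF y] inv(1) v(3) min_degree by (elim disjE bexE conjE) force+
    then obtain w where w: "w \<in> V" "\<tau> = Tip w" "{1, degree v - 1} = {1, degree w - 1}"
      using v(4) inv(2) by auto
    then have "degree v = degree w"
      using min_degree[of v] min_degree[of w] v(1) by (auto simp: doubleton_eq_iff)
    then show ?thesis using v w degree_eq_iff by auto
  next
    fix v assume v: "v \<in> V" "\<sigma> = Leg v" "?low x = 2" "?cl x = {2, degree v}" "?con (degree v) x"
    from desc[OF y] show ?thesis
    proof (elim disjE bexE conjE)
      fix w assume w: "w \<in> V" "\<tau> = Leg w" "?cl y = {2, degree w}"
      then show ?thesis using two[of v w] v inv(2) degree_eq_iff by auto
    next
      fix w assume w: "w \<in> V" "?cl y = {2, degree w}" "\<not> ?con (degree w) y"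
      then have "degree v = degree w" using two[of v w] v inv(2) by auto
      then show ?thesis using w v inv(3) by simp
    next
      fix w z assume w: "w \<in> V" "z \<in> V" "w \<noteq> z" "{2, degree w, degree z} \<subseteq> ?cl y"
      then show ?thesis using three[of w z v] v inv(2) by auto
    qed (use v inv(1) min_degree in force)+
  next
    fix v assume v: "v \<in> V" "\<sigma> = Loop v" "?low x = 2" "?cl x = {2, degree v}" "\<not> ?con (degree v) x"
    from desc[OF y] show ?thesis
    proof (elim disjE bexE conjE)
      fix w assume w: "w \<in> V" "\<tau> = Loop w" "?cl y = {2, degree w}"
      then show ?thesis using two[of v w] v inv(2) degree_eq_iff by auto
    next
      fix w assume w: "w \<in> V" "?cl y = {2, degree w}" "?con (degree w) y"
      then have "degree v = degree w" using two[of v w] v inv(2) by auto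
      then show ?thesis using w v inv(3) by simp
    next
      fix w z assume w: "w \<in> V" "z \<in> V" "w \<noteq> z" "{2, degree w, degree z} \<subseteq> ?cl y"
      then show ?thesis using three[of w z v] v inv(2) by auto
    qed (use v inv(1) min_degree in force)+
  next
    fix v v' assume v: "v \<in> V" "v' \<in> V" "\<sigma> = Edge {v, v'}" "v \<noteq> v'" "?low x = 2"
      "{2, degree v, degree v'} \<subseteq> ?cl x" "?cl x \<subseteq> {2, degree v, degree v', degree v + degree v' - 2}"
    from desc[OF y] show ?thesis
    proof (elim disjE bexE conjE)
      fix w w' assume w: "w \<in> V" "w' \<in> V" "\<tau> = Edge {w, w'}" "w \<noteq> w'"
        "{2, degree w, degree w'} \<subseteq> ?cl y" "?cl y \<subseteq> {2, degree w, degree w', degree w + degree w' - 2}"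
      have "degree v = degree w \<and> degree v' = degree w' \<or> degree v = degree w' \<and> degree v' = degree w"
        by (rule ends_determined[of _ _ _ _ "?cl y"]) (use v w inv(2) min_degree degree_eq_iff in auto)
      then show ?thesis using v w degree_eq_iff by auto
    next
      fix w assume "w \<in> V" "?cl y = {2, degree w}" "?con (degree w) y"
      then show ?thesis using three[of v v' w] v inv(2) by auto
    next
      fix w assume "w \<in> V" "?cl y = {2, degree w}" "\<not> ?con (degree w) y"
      then show ?thesis using three[of v v' w] v inv(2) by auto
    qed (use v inv(1) min_degree in force)+
  qed
qed

end

lemma KX_has_size_classification:
  assumes R: "\<And>x. x \<in> X \<Longrightarrow> \<exists>\<tau>\<in>T. R \<tau> x" "\<And>\<tau>. \<tau> \<in> T \<Longrightarrow> \<exists>x\<in>X. R \<tau> x" and T: "finite T"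
    and hom: "\<And>x y \<sigma> \<tau>. \<lbrakk>x \<in> X; y \<in> X; \<sigma> \<in> T; \<tau> \<in> T; R \<sigma> x; R \<tau> y\<rbrakk>
      \<Longrightarrow> hyperspace_at x X homeomorphic_space hyperspace_at y X \<longleftrightarrow> \<sigma> = \<tau>"
  shows "KX_has_size X (card T)"
proof -
  define t where "t x = (SOME \<tau>. \<tau> \<in> T \<and> R \<tau> x)" for x
  have t: "t x \<in> T" "R (t x) x" if "x \<in> X" for x
    using someI_ex[of "\<lambda>\<tau>. \<tau> \<in> T \<and> R \<tau> x"] R(1)[OF that] by (auto simp: t_def)
  have eq: "hyperspace_at x X homeomorphic_space hyperspace_at y X \<longleftrightarrow> t x = t y" if "x \<in> X" "y \<in> X" for x y
    using hom that t by blast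
  define F where "F \<tau> = {subcontinua_at x X | x. x \<in> X \<and> t x = \<tau>}" for \<tau>
  have cls: "KX_rel X `` {subcontinua_at x X} = F (t x)" if x: "x \<in> X" for x
  proof -
    have "B \<in> KX_rel X `` {subcontinua_at x X} \<longleftrightarrow> B \<in> F (t x)" for B
      using x eq unfolding F_def KX_rel_def KX_def by (auto 4 3 simp: image_iff)
    then show ?thesis by blast
  qed
  have tT: "t ` X = T"
  proof
    show "t ` X \<subseteq> T" using t by blast
    show "T \<subseteq> t ` X"
    proof
      fix \<tau> assume \<tau>: "\<tau> \<in> T"
      then obtain x where x: "x \<in> X" "R \<tau> x" using R(2) by blast
      then have "t x = \<tau>"
        using hom[OF x(1) x(1) t(1)[OF x(1)] \<tau> t(2)[OF x(1)] x(2)] homeomorphic_space_refl by blast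
      then show "\<tau> \<in> t ` X" using x by blast
    qed
  qed
  have quot: "KX X // KX_rel X = F ` T"
    unfolding quotient_def KX_def tT[symmetric] using cls by (auto simp: image_image)
  have "inj_on F T"
  proof (rule inj_onI)
    fix \<sigma> \<tau> assume \<sigma>: "\<sigma> \<in> T" and \<tau>: "\<tau> \<in> T" and FF: "F \<sigma> = F \<tau>"
    obtain x where x: "x \<in> X" "t x = \<sigma>" using \<sigma> tT by blast
    then have "subcontinua_at x X \<in> F \<tau>" using FF unfolding F_def by blast
    then obtain y where y: "y \<in> X" "t y = \<tau>" "subcontinua_at x X = subcontinua_at y X"
      unfolding F_def by blast
    then have "hyperspace_at x X homeomorphic_space hyperspace_at y X"
      by (simp add: homeomorphic_space_refl)
    then show "\<sigma> = \<tau>" using eq[OF x(1) y(1)] x y by simp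
  qed
  then have "card (F ` T) = card T" by (rule card_image)
  then show ?thesis
    unfolding KX_has_size_def quot using T by simp
qed

context rigid_graph
begin

theorem KX_size:
  "KX_has_size X (card V + 2 * card leg_vertices + card loop_vertices + card edge_ends)"
proof -
  have "KX_has_size X (card point_types)"
  proof (rule KX_has_size_classification[where R = of_type])
    fix x y \<sigma> \<tau> assume x: "x \<in> X" "y \<in> X" and xy: "of_type \<sigma> x" "of_type \<tau> y"
    show "hyperspace_at x X homeomorphic_space hyperspace_at y X \<longleftrightarrow> \<sigma> = \<tau>"
    proof
      assume "\<sigma> = \<tau>"
      then obtain f g where "homeomorphism X X f g" "f x = y"
        using same_type_movable xy unfolding movable_def by blast
      then show "hyperspace_at x X homeomorphic_space hyperspace_at y X"
        using homeomorphic_hyperspace_at[OF compact_X _ x(1)] by blast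
    qed (rule homeomorphic_imp_same_type[OF xy])
  qed (use point_has_type type_has_point card_point_types(1) in auto)
  then show ?thesis by (simp only: card_point_types(2))
qed

end

section \<open>Building graphs from legs, loops and edges\<close>

text \<open>A graph together with all that is needed to count its types of points: the vertices \<open>L\<close> with
  legs, the vertices \<open>K\<close> with loops, the pairs \<open>E\<close> of adjacent vertices and the degrees. If two
  graphs meet only in common vertices, these data are united and the degrees are added.\<close>

definition graph_with :: "'a::metric_space set \<Rightarrow> 'a set \<Rightarrow> 'a set \<Rightarrow> 'a set \<Rightarrow> 'a set set \<Rightarrow> ('a \<Rightarrow> nat) \<Rightarrow> bool" where
  "graph_with X V L K E d \<longleftrightarrow> (\<exists>D. finite_graph X V D \<and>
     L = {v. \<exists>h\<in>D. pathstart h = v \<and> pathfinish h \<notin> V} \<and>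
     K = {v. \<exists>h\<in>D. pathstart h = v \<and> pathfinish h = v} \<and>
     E = {{pathstart h, pathfinish h} | h. h \<in> D \<and> pathfinish h \<in> V \<and> pathstart h \<noteq> pathfinish h} \<and>
     d = (\<lambda>v. card {h \<in> D. pathstart h = v}))"

lemma graph_with_size:
  assumes "graph_with X V L K E d" "\<And>v. v \<in> V \<Longrightarrow> 3 \<le> d v" "inj_on d V"
  shows "KX_has_size X (card V + 2 * card L + card K + card E)"
proof -
  obtain D where D: "finite_graph X V D" and L: "L = {v. \<exists>h\<in>D. pathstart h = v \<and> pathfinish h \<notin> V}"
    and K: "K = {v. \<exists>h\<in>D. pathstart h = v \<and> pathfinish h = v}"
    and E: "E = {{pathstart h, pathfinish h} | h. h \<in> D \<and> pathfinish h \<in> V \<and> pathstart h \<noteq> pathfinish h}"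
    and d: "d = (\<lambda>v. card {h \<in> D. pathstart h = v})"
    using assms(1) unfolding graph_with_def by blast
  interpret finite_graph X V D by (rule D)
  have "degree = d" by (simp add: d degree_def fun_eq_iff)
  then interpret rigid_graph X V D
    using assms(2,3) by unfold_locales auto
  show ?thesis
    using KX_size unfolding L K E leg_vertices_def loop_vertices_def edge_ends_def .
qed

lemma graph_with_subsets:
  assumes "graph_with X V L K E d"
  shows "finite V" "V \<subseteq> X" "L \<subseteq> V" "K \<subseteq> V" "\<Union>E \<subseteq> V" "finite E" "v \<notin> V \<Longrightarrow> d v = 0"
proof -
  obtain D where D: "finite_graph X V D" and L: "L = {v. \<exists>h\<in>D. pathstart h = v \<and> pathfinish h \<notin> V}"
    and K: "K = {v. \<exists>h\<in>D. pathstart h = v \<and> pathfinish h = v}"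
    and E: "E = {{pathstart h, pathfinish h} | h. h \<in> D \<and> pathfinish h \<in> V \<and> pathstart h \<noteq> pathfinish h}"
    and d: "d = (\<lambda>v. card {h \<in> D. pathstart h = v})"
    using assms(1) unfolding graph_with_def by blast
  interpret finite_graph X V D by (rule D)
  show "finite V" "V \<subseteq> X" by (rule finite_V, rule V_subset)
  show "L \<subseteq> V" "K \<subseteq> V" using start unfolding L K by auto
  show "\<Union>E \<subseteq> V"
  proof
    fix v assume "v \<in> \<Union>E"
    then obtain h where "h \<in> D" "pathfinish h \<in> V" "v \<in> {pathstart h, pathfinish h}" unfolding E by blast
    then show "v \<in> V" using start by auto
  qed
  have "E \<subseteq> (\<lambda>h. {pathstart h, pathfinish h}) ` D" unfolding E by blast
  then show "finite E" using finite_D finite_surj by blast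
  assume "v \<notin> V"
  then have "{h \<in> D. pathstart h = v} = {}" using start by auto
  then show "d v = 0" unfolding d by (simp only: card.empty)
qed

lemma graph_with_Un:
  assumes G1: "graph_with X1 V1 L1 K1 E1 d1" and G2: "graph_with X2 V2 L2 K2 E2 d2"
    and meet: "X1 \<inter> X2 \<subseteq> V1 \<inter> V2"
  shows "graph_with (X1 \<union> X2) (V1 \<union> V2) (L1 \<union> L2) (K1 \<union> K2) (E1 \<union> E2) (\<lambda>v. d1 v + d2 v)"
proof -
  obtain D1 where D1: "finite_graph X1 V1 D1" and L1: "L1 = {v. \<exists>h\<in>D1. pathstart h = v \<and> pathfinish h \<notin> V1}"
    and K1: "K1 = {v. \<exists>h\<in>D1. pathstart h = v \<and> pathfinish h = v}"
    and E1: "E1 = {{pathstart h, pathfinish h} | h. h \<in> D1 \<and> pathfinish h \<in> V1 \<and> pathstart h \<noteq> pathfinish h}"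
    and d1: "d1 = (\<lambda>v. card {h \<in> D1. pathstart h = v})"
    using G1 unfolding graph_with_def by blast
  obtain D2 where D2: "finite_graph X2 V2 D2" and L2: "L2 = {v. \<exists>h\<in>D2. pathstart h = v \<and> pathfinish h \<notin> V2}"
    and K2: "K2 = {v. \<exists>h\<in>D2. pathstart h = v \<and> pathfinish h = v}"
    and E2: "E2 = {{pathstart h, pathfinish h} | h. h \<in> D2 \<and> pathfinish h \<in> V2 \<and> pathstart h \<noteq> pathfinish h}"
    and d2: "d2 = (\<lambda>v. card {h \<in> D2. pathstart h = v})"
    using G2 unfolding graph_with_def by blast
  interpret A: finite_graph X1 V1 D1 by (rule D1)
  interpret B: finite_graph X2 V2 D2 by (rule D2)
  have VA: "h u \<in> V1 \<union> V2 \<longleftrightarrow> h u \<in> V1" if "h \<in> D1" "u \<in> {0..1}" for h u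
    using A.dart_in_X[OF that] B.V_subset meet by blast
  have VB: "h u \<in> V1 \<union> V2 \<longleftrightarrow> h u \<in> V2" if "h \<in> D2" "u \<in> {0..1}" for h u
    using B.dart_in_X[OF that] A.V_subset meet by blast
  have finA: "pathfinish h \<in> V1 \<union> V2 \<longleftrightarrow> pathfinish h \<in> V1" if "h \<in> D1" for h
    using VA[OF that, of 1] unfolding pathfinish_def by simp
  have finB: "pathfinish h \<in> V1 \<union> V2 \<longleftrightarrow> pathfinish h \<in> V2" if "h \<in> D2" for h
    using VB[OF that, of 1] unfolding pathfinish_def by simp
  have mix: "path_image h \<inter> path_image h' \<subseteq> V1 \<union> V2" if "h \<in> D1" "h' \<in> D2" for h h'
    using A.dart_image_subset[OF that(1)] B.dart_image_subset[OF that(2)] meet by blast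
  have "finite_graph (X1 \<union> X2) (V1 \<union> V2) (D1 \<union> D2)"
  proof
    show "finite (V1 \<union> V2)" "finite (D1 \<union> D2)"
      using A.finite_V B.finite_V A.finite_D B.finite_D by auto
    show "X1 \<union> X2 = V1 \<union> V2 \<union> (\<Union>h\<in>D1 \<union> D2. path_image h)"
      using A.space_eq B.space_eq by blast
    fix h assume h: "h \<in> D1 \<union> D2"
    show "simple_path h" using h A.simple B.simple by blast
    show "pathstart h \<in> V1 \<union> V2" using h A.start B.start by blast
    show "h u \<notin> V1 \<union> V2" if u: "0 < u" "u < 1" for u
      using h VA[of h u] VB[of h u] A.inner[of h u] B.inner[of h u] u by auto
    show "reversepath h \<in> D1 \<union> D2" if "pathfinish h \<in> V1 \<union> V2"
      using h that finA[of h] finB[of h] A.rev[of h] B.rev[of h] by blast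
    fix h' assume h': "h' \<in> D1 \<union> D2" "h' \<noteq> h" "h' \<noteq> reversepath h"
    show "path_image h \<inter> path_image h' \<subseteq> V1 \<union> V2"
      using h h' A.disjoint[of h h'] B.disjoint[of h h'] mix[of h h'] mix[of h' h] by blast
  qed
  moreover have "L1 \<union> L2 = {v. \<exists>h\<in>D1 \<union> D2. pathstart h = v \<and> pathfinish h \<notin> V1 \<union> V2}"
    unfolding L1 L2 using finA finB by blast
  moreover have "K1 \<union> K2 = {v. \<exists>h\<in>D1 \<union> D2. pathstart h = v \<and> pathfinish h = v}"
    unfolding K1 K2 by blast
  moreover have "E1 \<union> E2 = {{pathstart h, pathfinish h} | h. h \<in> D1 \<union> D2 \<and> pathfinish h \<in> V1 \<union> V2 \<and> pathstart h \<noteq> pathfinish h}"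
    unfolding E1 E2 using finA finB by blast
  moreover have "(\<lambda>v. d1 v + d2 v) = (\<lambda>v. card {h \<in> D1 \<union> D2. pathstart h = v})"
  proof
    fix v
    have "h \<notin> D2" if "h \<in> D1" for h
    proof
      assume "h \<in> D2"
      then have "h (1/2) \<in> X1 \<inter> X2" using A.dart_in_X[OF that, of "1/2"] B.dart_in_X[of h "1/2"] by simp
      then show False using meet A.inner[OF that, of "1/2"] by auto
    qed
    then have "{h \<in> D1. pathstart h = v} \<inter> {h \<in> D2. pathstart h = v} = {}" by blast
    moreover have "{h \<in> D1 \<union> D2. pathstart h = v} = {h \<in> D1. pathstart h = v} \<union> {h \<in> D2. pathstart h = v}" by blast
    ultimately show "d1 v + d2 v = card {h \<in> D1 \<union> D2. pathstart h = v}"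
      unfolding d1 d2 using A.finite_D B.finite_D by (simp add: card_Un_disjoint)
  qed
  ultimately show ?thesis unfolding graph_with_def by blast
qed

lemma arc_inner_neq:
  assumes "arc g" "0 < u" "u < 1"
  shows "g u \<noteq> pathstart g" "g u \<noteq> pathfinish g"
  using assms inj_onD[of g "{0..1}" u 0] inj_onD[of g "{0..1}" u 1]
  by (auto simp: arc_def pathstart_def pathfinish_def)

lemma finite_graph_leg:
  fixes g :: "real \<Rightarrow> 'a::metric_space"
  assumes "arc g"
  shows "finite_graph (path_image g) {pathstart g} {g}"
proof
  show "path_image g = {pathstart g} \<union> (\<Union>h\<in>{g}. path_image h)" by auto
qed (use assms arc_inner_neq[OF assms] arc_distinct_ends[OF assms] in \<open>auto simp: arc_imp_simple_path\<close>)

lemma graph_with_leg: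
  assumes "arc g" "pathstart g = v"
  shows "graph_with (path_image g) {v} {v} {} {} (\<lambda>w. if w = v then 1 else 0)"
  unfolding graph_with_def
proof (intro exI conjI)
  show "finite_graph (path_image g) {v} {g}" using finite_graph_leg[OF assms(1)] assms(2) by simp
  have "{h \<in> {g}. pathstart h = w} = (if w = v then {g} else {})" for w using assms(2) by auto
  then show "(\<lambda>w. if w = v then 1 else 0) = (\<lambda>w. card {h \<in> {g}. pathstart h = w})" by auto
qed (use assms arc_distinct_ends[OF assms(1)] in auto)

lemma finite_graph_loop:
  fixes g :: "real \<Rightarrow> 'a::metric_space"
  assumes g: "simple_path g" "pathstart g = v" "pathfinish g = v"
  shows "finite_graph (path_image g) {v} {g, reversepath g}"
proof -
  have inner: "g u \<noteq> v" if "0 < u" "u < 1" for u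
    using g that unfolding simple_path_def loop_free_def pathstart_def by force
  show ?thesis
  proof
    fix h assume h: "h \<in> {g, reversepath g}"
    show "h u \<notin> {v}" if "0 < u" "u < 1" for u
      using h inner[of u] inner[of "1 - u"] that by (auto simp: reversepath_def)
  qed (use g in \<open>auto simp: simple_path_reversepath pathstart_in_path_image\<close>)
qed

lemma graph_with_loop:
  assumes "simple_path g" "pathstart g = v" "pathfinish g = v"
  shows "graph_with (path_image g) {v} {} {v} {} (\<lambda>w. if w = v then 2 else 0)"
proof -
  interpret finite_graph "path_image g" "{v}" "{g, reversepath g}"
    by (rule finite_graph_loop[OF assms])
  have "reversepath g \<noteq> g" using rev_neq by simp
  have "{h \<in> {g, reversepath g}. pathstart h = w} = (if w = v then {g, reversepath g} else {})" for w
    using assms by auto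
  then have "(\<lambda>w. if w = v then 2 else 0) = (\<lambda>w. card {h \<in> {g, reversepath g}. pathstart h = w})"
    using \<open>reversepath g \<noteq> g\<close> by auto
  then show ?thesis
    unfolding graph_with_def using assms finite_graph_axioms
    by (intro exI[of _ "{g, reversepath g}"]) auto
qed

lemma graph_with_edge:
  fixes g :: "real \<Rightarrow> 'a::metric_space"
  assumes g: "arc g" "pathstart g = v" "pathfinish g = w"
  shows "graph_with (path_image g) {v, w} {} {} {{v, w}} (\<lambda>x. if x \<in> {v, w} then 1 else 0)"
proof -
  have vw: "v \<noteq> w" using arc_distinct_ends[OF g(1)] g by simp
  have "finite_graph (path_image g) {v, w} {g, reversepath g}"
  proof
    fix h assume h: "h \<in> {g, reversepath g}"
    show "h u \<notin> {v, w}" if "0 < u" "u < 1" for u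
      using h arc_inner_neq[OF g(1), of u] arc_inner_neq[OF g(1), of "1 - u"] g that
      by (auto simp: reversepath_def)
  qed (use g in \<open>auto simp: arc_imp_simple_path simple_path_reversepath pathstart_in_path_image pathfinish_in_path_image\<close>)
  moreover have "{h \<in> {g, reversepath g}. pathstart h = x} = (if x = v then {g} else if x = w then {reversepath g} else {})" for x
    using g vw by auto
  then have "(\<lambda>x. if x \<in> {v, w} then 1 else 0) = (\<lambda>x. card {h \<in> {g, reversepath g}. pathstart h = x})"
    by auto
  moreover have "{{v, w}} = {{pathstart h, pathfinish h} | h. h \<in> {g, reversepath g} \<and> pathfinish h \<in> {v, w} \<and> pathstart h \<noteq> pathfinish h}"
    using g vw by (auto simp: insert_commute)
  ultimately show ?thesis
    unfolding graph_with_def using g vw by (intro exI[of _ "{g, reversepath g}"]) auto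
qed

section \<open>Circles, arcs and triods\<close>

lemma simple_closed_curve_at:
  fixes S :: "'a::metric_space set"
  assumes "is_simple_closed_curve S" "v \<in> S"
  shows "\<exists>g. simple_path g \<and> pathstart g = v \<and> pathfinish g = v \<and> path_image g = S"
proof -
  obtain g where g: "simple_path g" "pathfinish g = pathstart g" "path_image g = S"
    using assms(1) by (auto simp: is_simple_closed_curve_def)
  obtain a where a: "a \<in> {0..1}" "v = g a" using assms(2) g(3) by (auto simp: path_image_def)
  show ?thesis
    using g a by (intro exI[of _ "shiftpath a g"])
      (simp add: simple_path_shiftpath path_image_shiftpath endpoints_shiftpath)
qed

text \<open>With a third point as the only vertex, any two points are inner points of the same loop.\<close>

lemma KX_size_simple_closed_curve:
  fixes S :: "'a::metric_space set"
  assumes S: "is_simple_closed_curve S"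
  shows "KX_has_size S 1"
proof -
  have hom: "hyperspace_at x S homeomorphic_space hyperspace_at y S" if x: "x \<in> S" and y: "y \<in> S" for x y
  proof -
    obtain g0 where g0: "simple_path g0" "pathstart g0 = x" "path_image g0 = S"
      using simple_closed_curve_at[OF S x] by blast
    have ne: "g0 (1/3) \<noteq> g0 (2/3)" "g0 (1/3) \<noteq> x" "g0 (2/3) \<noteq> x"
      using g0 unfolding simple_path_def loop_free_def pathstart_def by force+
    have "g0 (1/3) \<in> S" "g0 (2/3) \<in> S" using g0(3) by (auto simp: path_image_def)
    then obtain v where v: "v \<in> S" "v \<noteq> x" "v \<noteq> y" using ne by metis
    obtain g where g: "simple_path g" "pathstart g = v" "pathfinish g = v" "path_image g = S"
      using simple_closed_curve_at[OF S v(1)] by blast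
    interpret finite_graph S "{v}" "{g, reversepath g}"
      using finite_graph_loop[OF g(1-3)] g(4) by simp
    have inner: "\<exists>u. 0 < u \<and> u < 1 \<and> z = g u" if z: "z \<in> S" "z \<noteq> v" for z
    proof -
      obtain u where u: "u \<in> {0..1}" "z = g u" using z(1) g(4) unfolding path_image_def by blast
      have "u \<noteq> 0" "u \<noteq> 1" using u z(2) g(2,3) by (auto simp: pathstart_def pathfinish_def)
      then show ?thesis using u by (intro exI[of _ u]) auto
    qed
    obtain s t where "0 < s" "s < 1" "x = g s" "0 < t" "t < 1" "y = g t"
      using inner[OF x] inner[OF y] v by metis
    then have "movable x y" using movable_twins(1)[of g g s t] by simp
    then show ?thesis
      unfolding movable_def using homeomorphic_hyperspace_at[OF compact_X _ x] by blast
  qed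
  have ne: "S \<noteq> {}"
    using S path_image_nonempty unfolding is_simple_closed_curve_def by blast
  have "KX_has_size S (card {()})"
    by (rule KX_has_size_classification[where R = "\<lambda>_ _. True"]) (use hom ne in auto)
  then show ?thesis by simp
qed

lemma lowest_dim_arc_end:
  fixes g :: "real \<Rightarrow> 'a::metric_space"
  assumes "arc g"
  shows "lowest_dim (hyperspace_at (pathstart g) (path_image g)) = 1"
proof -
  interpret finite_graph "path_image g" "{pathstart g}" "{g}" by (rule finite_graph_leg[OF assms])
  interpret graph_at "path_image g" "{pathstart g}" "{g}" "pathstart g" by unfold_locales auto
  have "{h \<in> {g}. pathstart h = pathstart g} = {g}" by auto
  then have "degree (pathstart g) = 1" by (simp add: degree_def)
  then show ?thesis using lowest_dim_Y by simp
qed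

lemma lowest_dim_arc_inner:
  fixes g :: "real \<Rightarrow> 'a::metric_space"
  assumes g: "arc g" and u: "0 < u" "u < 1"
  shows "lowest_dim (hyperspace_at (g u) (path_image g)) = 2"
proof -
  \<comment> \<open>Either half of the arc is a leg at the inner point.\<close>
  define a b where "a = subarc u 0 g" and "b = subarc u 1 g"
  have inj: "g s = g t \<longleftrightarrow> s = t" if "s \<in> {0..1}" "t \<in> {0..1}" for s t
    using g that unfolding arc_def by (meson inj_on_eq_iff)
  have simp_ab: "simple_path a" "simple_path b"
    unfolding a_def b_def using arc_imp_simple_path[OF g] u by (auto intro!: simple_path_subarc)
  have ends: "pathstart a = g u" "pathstart b = g u" "pathfinish a = g 0" "pathfinish b = g 1"
    by (simp_all add: a_def b_def)
  have "g 0 \<noteq> g u" "g 1 \<noteq> g u" using inj[of 0 u] inj[of 1 u] u by auto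
  then have arcs: "arc a" "arc b"
    using simp_ab ends by (auto simp: arc_simple_path)
  have im: "path_image a = g ` {0..u}" "path_image b = g ` {u..1}"
    using u by (simp_all add: a_def b_def path_image_subarc closed_segment_eq_real_ivl)
  have cover: "path_image g = path_image a \<union> path_image b"
  proof -
    have "{0..1} = {0..u} \<union> {u..1}" using u by auto
    then show ?thesis unfolding im path_image_def[of g] by (simp add: image_Un)
  qed
  have meet: "path_image a \<inter> path_image b \<subseteq> {g u} \<inter> {g u}"
  proof
    fix x assume "x \<in> path_image a \<inter> path_image b"
    then obtain s t where st: "s \<in> {0..u}" "t \<in> {u..1}" "x = g s" "g s = g t" unfolding im by blast
    then have "s = t" using inj[of s t] u by auto
    then show "x \<in> {g u} \<inter> {g u}" using st by auto
  qed
  obtain D where D: "finite_graph (path_image g) {g u} D" and deg: "card {h \<in> D. pathstart h = g u} = 2"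
  proof -
    have "graph_with (path_image a \<union> path_image b) ({g u} \<union> {g u}) ({g u} \<union> {g u}) ({} \<union> {}) ({} \<union> {})
        (\<lambda>w. (if w = g u then 1 else 0) + (if w = g u then 1 else 0))"
      by (rule graph_with_Un[OF graph_with_leg[OF arcs(1) ends(1)] graph_with_leg[OF arcs(2) ends(2)] meet])
    then obtain D where "finite_graph (path_image g) {g u} D"
      "(\<lambda>w. (if w = g u then 1 else 0) + (if w = g u then 1 else 0)) = (\<lambda>v. card {h \<in> D. pathstart h = v})"
      unfolding graph_with_def cover[symmetric] by auto
    then show thesis
      using that[of D] fun_cong[of _ _ "g u"] by fastforce
  qed
  interpret finite_graph "path_image g" "{g u}" D by (rule D)
  interpret graph_at "path_image g" "{g u}" D "g u" by unfold_locales auto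
  show ?thesis using lowest_dim_Y deg by (simp add: degree_def)
qed

text \<open>The lowest local dimension is one at the ends and two at the inner points. The ends are exchanged
  by reversing the arc.\<close>

lemma KX_size_arc:
  fixes S :: "'a::metric_space set"
  assumes "is_arc S"
  shows "KX_has_size S 2"
proof -
  obtain g where g: "arc g" and S: "S = path_image g" using assms by (auto simp: is_arc_def)
  interpret finite_graph S "{pathstart g}" "{g}" unfolding S by (rule finite_graph_leg[OF g])
  define R where "R b x = (if b then x = pathstart g \<or> x = pathfinish g else \<exists>u. 0 < u \<and> u < 1 \<and> x = g u)" for b x
  obtain k where k: "homeomorphism {0..1} S g k" using homeomorphism_arc[OF g] S by metis
  have "homeomorphism {0..1} {0..1} (\<lambda>t. 1 - t) (\<lambda>t. 1 - t :: real)"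
    by (rule homeomorphismI) (auto intro!: continuous_intros)
  then have flip: "homeomorphism S S (g \<circ> ((\<lambda>t. 1 - t) \<circ> k)) ((g \<circ> (\<lambda>t. 1 - t)) \<circ> k)"
    using homeomorphism_compose[OF homeomorphism_compose[OF homeomorphism_symD[OF k]] k]
    by (simp add: o_assoc)
  have "k (pathstart g) = 0" using k by (simp add: homeomorphism_def pathstart_def)
  then have "(g \<circ> ((\<lambda>t. 1 - t) \<circ> k)) (pathstart g) = pathfinish g" by (simp add: pathfinish_def)
  with flip have ends: "movable (pathstart g) (pathfinish g)"
    unfolding movable_def by blast
  have inS: "pathstart g \<in> S" "pathfinish g \<in> S" by (auto simp: S)
  have hom: "hyperspace_at x S homeomorphic_space hyperspace_at y S" if "movable x y" "x \<in> S" for x y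
    using that homeomorphic_hyperspace_at[OF compact_X _ that(2)] unfolding movable_def by blast
  have hom_ends: "hyperspace_at x S homeomorphic_space hyperspace_at (pathstart g) S" if "R True x" for x
    using that hom[OF ends inS(1)] homeomorphic_space_sym homeomorphic_space_refl by (fastforce simp: R_def)
  have low_end: "lowest_dim (hyperspace_at x S) = 1" if "R True x" for x
    using invariants_homeomorphic(1)[OF hom_ends[OF that]] lowest_dim_arc_end[OF g] S by simp
  have low_inner: "lowest_dim (hyperspace_at x S) = 2" if "R False x" for x
    using that lowest_dim_arc_inner[OF g] S by (auto simp: R_def)
  have "KX_has_size S (card (UNIV :: bool set))"
  proof (rule KX_has_size_classification[where R = R])
    fix x assume "x \<in> S"
    then obtain u where u: "u \<in> {0..1}" "x = g u" unfolding S path_image_def by blast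
    then have "u = 0 \<or> u = 1 \<or> 0 < u \<and> u < 1" by auto
    then have "R True x \<or> R False x" using u by (auto simp: R_def pathstart_def pathfinish_def)
    then show "\<exists>\<tau>\<in>UNIV. R \<tau> x" by blast
  next
    fix b :: bool
    have "g (1/2) \<in> S" by (auto simp: S path_image_def)
    moreover have "R False (g (1/2))" unfolding R_def by (simp, intro exI[of _ "1/2"]) simp
    moreover have "R True (pathstart g)" by (simp add: R_def)
    ultimately show "\<exists>x\<in>S. R b x" using inS by (cases b) auto
  next
    fix x y and b c :: bool
    assume x: "x \<in> S" and y: "y \<in> S" and R: "R b x" "R c y"
    show "hyperspace_at x S homeomorphic_space hyperspace_at y S \<longleftrightarrow> b = c"
    proof
      assume h: "hyperspace_at x S homeomorphic_space hyperspace_at y S"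
      have "lowest_dim (hyperspace_at x S) = (if b then 1 else 2)"
        using R(1) low_end[of x] low_inner[of x] by (cases b) simp_all
      moreover have "lowest_dim (hyperspace_at y S) = (if c then 1 else 2)"
        using R(2) low_end[of y] low_inner[of y] by (cases c) simp_all
      ultimately have "(if b then 1 else 2 :: nat) = (if c then 1 else 2)"
        using invariants_homeomorphic(1)[OF h] by metis
      then show "b = c" by (cases b; cases c) simp_all
    next
      assume "b = c"
      show "hyperspace_at x S homeomorphic_space hyperspace_at y S"
      proof (cases b)
        case True
        then have "R True x" "R True y" using R \<open>b = c\<close> by simp_all
        then have "hyperspace_at x S homeomorphic_space hyperspace_at (pathstart g) S"
          "hyperspace_at (pathstart g) S homeomorphic_space hyperspace_at y S"
          using hom_ends[of x] hom_ends[of y] homeomorphic_space_sym by blast+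
        then show ?thesis by (rule homeomorphic_space_trans)
      next
        case False
        then obtain s t where "0 < s" "s < 1" "x = g s" "0 < t" "t < 1" "y = g t"
          using R \<open>b = c\<close> by (auto simp: R_def)
        then have "movable x y" using movable_twins(1)[of g g s t] by simp
        then show ?thesis using hom x by blast
      qed
    qed
  qed simp
  then show ?thesis by simp
qed

lemma KX_size_simple_triod:
  fixes S :: "'a::metric_space set"
  assumes "is_simple_triod S"
  shows "KX_has_size S 3"
proof -
  obtain f g h v where arcs: "arc f" "arc g" "arc h" and v: "pathstart f = v" "pathstart g = v" "pathstart h = v"
    and meet: "path_image f \<inter> path_image g = {v}" "path_image f \<inter> path_image h = {v}" "path_image g \<inter> path_image h = {v}"
    and S: "S = path_image f \<union> path_image g \<union> path_image h"
    using assms unfolding is_simple_triod_def by blast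
  have "graph_with S ({v} \<union> {v} \<union> {v}) ({v} \<union> {v} \<union> {v}) ({} \<union> {} \<union> {}) ({} \<union> {} \<union> {})
      (\<lambda>w. (if w = v then 1 else 0) + (if w = v then 1 else 0) + (if w = v then 1 else 0))"
    unfolding S
    by (intro graph_with_Un graph_with_leg arcs v) (use meet in auto)
  from graph_with_size[OF this] show ?thesis by (simp add: eval_nat_numeral)
qed

section \<open>The graphs in the plane\<close>

definition vertex :: "nat \<Rightarrow> plane" where
  "vertex n = (real n, 0)"

lemma vertex_eq_iff [simp]: "vertex m = vertex n \<longleftrightarrow> m = n"
  by (simp add: vertex_def)

definition legs :: "nat \<Rightarrow> nat \<Rightarrow> plane set" where
  "legs n k = (\<Union>i\<in>{1..k}. leg n i)"

lemma circle_through_base_point: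
  fixes a r :: real
  assumes r: "r > 0"
  shows "\<exists>g. simple_path g \<and> pathstart g = (a, 0) \<and> pathfinish g = (a, 0) \<and> path_image g = sphere (a, r) r"
proof -
  define g where "g t = (a + r * sin (2 * pi * t), r - r * cos (2 * pi * t))" for t :: real
  have in_sphere: "(x, y) \<in> sphere (a, r) r \<longleftrightarrow> (x - a)\<^sup>2 + (y - r)\<^sup>2 = r\<^sup>2" for x y
  proof -
    have "(x, y) \<in> sphere (a, r) r \<longleftrightarrow> sqrt ((x - a)\<^sup>2 + (y - r)\<^sup>2) = r"
      by (simp add: dist_prod_def dist_real_def power2_commute)
    also have "\<dots> \<longleftrightarrow> (x - a)\<^sup>2 + (y - r)\<^sup>2 = r\<^sup>2"
      using r real_sqrt_unique[of r] by (metis less_imp_le real_sqrt_pow2 sum_power2_ge_zero)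
    finally show ?thesis .
  qed
  have "path g"
    unfolding path_def g_def by (intro continuous_intros)
  moreover have "s = t \<or> s = 0 \<and> t = 1 \<or> s = 1 \<and> t = 0"
    if st: "s \<in> {0..1}" "t \<in> {0..1}" and eq: "g s = g t" for s t
  proof -
    have "sin (2 * pi * s) = sin (2 * pi * t) \<and> cos (2 * pi * s) = cos (2 * pi * t)"
      using eq r by (simp add: g_def)
    then obtain n :: int where "2 * pi * s = 2 * pi * t + 2 * pi * n"
      using sin_cos_eq_iff by metis
    then have "2 * pi * s = 2 * pi * (t + n)" by (simp add: algebra_simps)
    then have n: "s = t + n" by simp
    then have "real_of_int n \<le> 1" "-1 \<le> real_of_int n" using st by auto
    then have "n = 0 \<or> n = 1 \<or> n = -1" by linarith
    then show ?thesis using n st by auto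
  qed
  ultimately have "simple_path g" unfolding simple_path_def loop_free_def by blast
  moreover have "path_image g = sphere (a, r) r"
  proof
    show "path_image g \<subseteq> sphere (a, r) r"
    proof
      fix z assume "z \<in> path_image g"
      then obtain t where z: "z = g t" unfolding path_image_def by blast
      have "(r * sin (2 * pi * t))\<^sup>2 + (- (r * cos (2 * pi * t)))\<^sup>2
          = r\<^sup>2 * ((sin (2 * pi * t))\<^sup>2 + (cos (2 * pi * t))\<^sup>2)"
        by (simp only: power_mult_distrib power2_minus distrib_left)
      then have "(r * sin (2 * pi * t))\<^sup>2 + (- (r * cos (2 * pi * t)))\<^sup>2 = r\<^sup>2" by simp
      then show "z \<in> sphere (a, r) r" unfolding z g_def in_sphere by simp
    qed
    show "sphere (a, r) r \<subseteq> path_image g"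
    proof
      fix z assume z: "z \<in> sphere (a, r) r"
      obtain x y where xy: "z = (x, y)" by (cases z)
      have "(x - a)\<^sup>2 + (y - r)\<^sup>2 = r\<^sup>2" using z in_sphere xy by simp
      then have "((r - y) / r)\<^sup>2 + ((x - a) / r)\<^sup>2 = 1"
        using r by (simp add: power_divide add_divide_distrib[symmetric] power2_commute add.commute)
      then obtain t where t: "0 \<le> t" "t < 2 * pi" "(r - y) / r = cos t" "(x - a) / r = sin t"
        using sincos_total_2pi by metis
      define s where "s = t / (2 * pi)"
      have "s \<in> {0..1}" "2 * pi * s = t" using t by (auto simp: s_def field_simps)
      moreover have "x = a + r * sin t" "y = r - r * cos t" using t(3,4) r by (simp_all add: field_simps)
      ultimately have "z = g s" unfolding g_def xy by simp
      then show "z \<in> path_image g" using \<open>s \<in> {0..1}\<close> unfolding path_image_def by blast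
    qed
  qed
  moreover have "pathstart g = (a, 0)" "pathfinish g = (a, 0)"
    by (simp_all add: g_def pathstart_def pathfinish_def)
  ultimately show ?thesis by blast
qed

lemma in_circle:
  fixes a r :: real
  assumes "r > 0" "(x, y) \<in> sphere (a, r) r"
  shows "(x - a)\<^sup>2 + y\<^sup>2 = 2 * r * y" "0 \<le> y" "y = 0 \<Longrightarrow> x = a" "a - r \<le> x" "x \<le> a + r"
proof -
  have "sqrt ((a - x)\<^sup>2 + (r - y)\<^sup>2) = r"
    using assms(2) by (simp add: dist_prod_def dist_real_def)
  then have "(a - x)\<^sup>2 + (r - y)\<^sup>2 = r\<^sup>2"
    by (metis real_sqrt_pow2 sum_power2_ge_zero)
  then show eq: "(x - a)\<^sup>2 + y\<^sup>2 = 2 * r * y"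
    by (simp add: power2_eq_square algebra_simps)
  have "0 \<le> 2 * r * y" using eq sum_power2_ge_zero[of "x - a" y] by simp
  then show "0 \<le> y" using assms(1) by (simp add: zero_le_mult_iff)
  show "x = a" if "y = 0" using eq that by simp
  have "(x - a)\<^sup>2 \<le> r\<^sup>2"
    using eq zero_le_power2[of "y - r"] by (simp add: power2_eq_square algebra_simps)
  then have "\<bar>x - a\<bar> \<le> r"
    using assms(1) abs_le_square_iff[of "x - a" r] by simp
  then show "a - r \<le> x" "x \<le> a + r" by linarith+
qed

lemmas in_loop = in_circle[of "1/4" _ _ "real n" for n, folded loop_def, simplified]
lemmas in_small_loop = in_circle[of "1/8" _ _ 2, folded small_loop_def, simplified]

lemma in_edge: "(x, y) \<in> edge n \<longleftrightarrow> real n - 1 \<le> x \<and> x \<le> real n \<and> y = 0"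
  by (auto simp: edge_def)

lemma in_leg: "(x, y) \<in> leg n i \<longleftrightarrow> (\<exists>t. 0 \<le> t \<and> t \<le> 1 \<and> x = real n - t / real i \<and> y = - t)"
  by (auto simp: leg_def closed_segment_def algebra_simps)

lemma in_legs:
  assumes "(x, y) \<in> legs n k"
  shows "y \<le> 0" "y = 0 \<Longrightarrow> x = real n" "y < 0 \<Longrightarrow> x < real n" "real n - 1 \<le> x"
proof -
  obtain i t where i: "1 \<le> i" and t: "0 \<le> t" "t \<le> 1" "x = real n - t / real i" "y = - t"
    using assms by (auto simp: legs_def in_leg)
  have "t / real i \<le> t / 1" using i t(1) by (intro divide_left_mono) auto
  then have "t / real i \<le> t" by simp
  then show "y \<le> 0" "y = 0 \<Longrightarrow> x = real n" "y < 0 \<Longrightarrow> x < real n" "real n - 1 \<le> x"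
    using t i by auto
qed

lemma graph_with_loop_n: "graph_with (loop n) {vertex n} {} {vertex n} {} (\<lambda>w. if w = vertex n then 2 else 0)"
proof -
  obtain g where g: "simple_path g" "pathstart g = vertex n" "pathfinish g = vertex n" "path_image g = loop n"
    using circle_through_base_point[of "1/4" "real n"] unfolding vertex_def loop_def by auto
  show ?thesis using graph_with_loop[OF g(1-3)] g(4) by simp
qed

lemma graph_with_small_loop: "graph_with small_loop {vertex 2} {} {vertex 2} {} (\<lambda>w. if w = vertex 2 then 2 else 0)"
proof -
  obtain g where g: "simple_path g" "pathstart g = vertex 2" "pathfinish g = vertex 2" "path_image g = small_loop"
    using circle_through_base_point[of "1/8" 2] unfolding vertex_def small_loop_def by auto
  show ?thesis using graph_with_loop[OF g(1-3)] g(4) by simp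
qed

lemma edge_segment: "edge (Suc n) = closed_segment (vertex (Suc n)) (vertex n)"
proof -
  have "z \<in> edge (Suc n) \<longleftrightarrow> z \<in> closed_segment (vertex (Suc n)) (vertex n)" for z
  proof -
    obtain x y where z: "z = (x, y)" by (cases z)
    have "z \<in> closed_segment (vertex (Suc n)) (vertex n) \<longleftrightarrow> (\<exists>u. 0 \<le> u \<and> u \<le> 1 \<and> x = real n + 1 - u \<and> y = 0)"
      unfolding z vertex_def closed_segment_def by (auto simp: algebra_simps)
    also have "\<dots> \<longleftrightarrow> real n \<le> x \<and> x \<le> real n + 1 \<and> y = 0"
      by (auto intro: exI[of _ "real n + 1 - x"])
    finally show ?thesis unfolding z in_edge by (simp add: add.commute)
  qed
  then show ?thesis by blast
qed

lemma graph_with_edge_n: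
  "graph_with (edge (Suc n)) {vertex n, vertex (Suc n)} {} {} {{vertex n, vertex (Suc n)}}
    (\<lambda>w. if w \<in> {vertex n, vertex (Suc n)} then 1 else 0)"
  using graph_with_edge[of "linepath (vertex n) (vertex (Suc n))" "vertex n" "vertex (Suc n)"]
  unfolding edge_segment by (simp add: closed_segment_commute)

text \<open>In \<open>P1\<close> the left end of the edge is not a branch point, so the edge counts as a leg.\<close>

lemma graph_with_edge_leg:
  "graph_with (edge (Suc n)) {vertex (Suc n)} {vertex (Suc n)} {} {} (\<lambda>w. if w = vertex (Suc n) then 1 else 0)"
  using graph_with_leg[of "linepath (vertex (Suc n)) (vertex n)" "vertex (Suc n)"]
  unfolding edge_segment by simp

lemma graph_with_leg_n:
  "graph_with (leg n i) {vertex n} {vertex n} {} {} (\<lambda>w. if w = vertex n then 1 else 0)"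
  using graph_with_leg[of "linepath (real n, 0) (real n - 1 / real i, -1)" "vertex n"]
  unfolding leg_def vertex_def by simp

lemma graph_with_legs:
  assumes "1 \<le> k"
  shows "graph_with (legs n k) {vertex n} {vertex n} {} {} (\<lambda>w. if w = vertex n then k else 0)"
  using assms
proof (induction k rule: dec_induct)
  case base
  then show ?case using graph_with_leg_n[of n 1] by (simp add: legs_def)
next
  case (step k)
  have "legs n k \<inter> leg n (Suc k) \<subseteq> {vertex n} \<inter> {vertex n}"
  proof
    fix z assume z: "z \<in> legs n k \<inter> leg n (Suc k)"
    obtain x y where xy: "z = (x, y)" by (cases z)
    obtain i s where i: "1 \<le> i" "i \<le> k" and s: "x = real n - s / real i" "y = - s"
      using z xy by (auto simp: legs_def in_leg)
    obtain t where t: "x = real n - t / real (Suc k)" "y = - t"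
      using z xy by (auto simp: in_leg)
    have "t = s" using s t by simp
    then have "real n - s / real i = real n - s / real (Suc k)" using s t by metis
    then have "s / real i = s / real (Suc k)" by linarith
    moreover have "real i \<noteq> real (Suc k)" using i by simp
    ultimately have "s = 0" using divide_cancel_left by metis
    then show "z \<in> {vertex n} \<inter> {vertex n}" using s xy by (simp add: vertex_def)
  qed
  from graph_with_Un[OF step.IH graph_with_leg_n this]
  have "graph_with (legs n k \<union> leg n (Suc k)) {vertex n} {vertex n} {} {}
      (\<lambda>w. (if w = vertex n then k else 0) + (if w = vertex n then 1 else 0))" by simp
  moreover have "legs n k \<union> leg n (Suc k) = legs n (Suc k)"
    by (auto simp: legs_def atLeastAtMostSuc_conv)
  moreover have "(\<lambda>w. (if w = vertex n then k else 0) + (if w = vertex n then 1 else 0)) = (\<lambda>w. if w = vertex n then Suc k else 0)"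
    by auto
  ultimately show ?case by simp
qed

lemma meet_subsetI:
  assumes "\<And>x y. (x, y) \<in> A \<Longrightarrow> (x, y) \<in> B \<Longrightarrow> (x, y) = v" "v \<in> V" "v \<in> W"
  shows "A \<inter> B \<subseteq> V \<inter> W"
  using assms by auto

lemma S_graph_alt: "S_graph n = edge n \<union> loop n \<union> legs n (2 * n)"
  by (simp add: S_graph_def legs_def)

lemma graph_with_S_graph:
  "graph_with (S_graph (Suc n)) {vertex n, vertex (Suc n)} {vertex (Suc n)} {vertex (Suc n)} {{vertex n, vertex (Suc n)}}
    (\<lambda>w. if w = vertex n then 1 else if w = vertex (Suc n) then 2 * n + 5 else 0)"
proof -
  have "graph_with (edge (Suc n) \<union> loop (Suc n)) ({vertex n, vertex (Suc n)} \<union> {vertex (Suc n)}) ({} \<union> {})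
      ({} \<union> {vertex (Suc n)}) ({{vertex n, vertex (Suc n)}} \<union> {})
      (\<lambda>w. (if w \<in> {vertex n, vertex (Suc n)} then 1 else 0) + (if w = vertex (Suc n) then 2 else 0))"
    by (rule graph_with_Un[OF graph_with_edge_n graph_with_loop_n], rule meet_subsetI)
       (auto simp: in_edge vertex_def dest: in_loop(3))
  then have "graph_with (edge (Suc n) \<union> loop (Suc n) \<union> legs (Suc n) (2 * Suc n))
      ({vertex n, vertex (Suc n)} \<union> {vertex (Suc n)} \<union> {vertex (Suc n)}) ({} \<union> {} \<union> {vertex (Suc n)})
      ({} \<union> {vertex (Suc n)} \<union> {}) ({{vertex n, vertex (Suc n)}} \<union> {} \<union> {})
      (\<lambda>w. (if w \<in> {vertex n, vertex (Suc n)} then 1 else 0) + (if w = vertex (Suc n) then 2 else 0)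
        + (if w = vertex (Suc n) then 2 * Suc n else 0))"
  proof (rule graph_with_Un[OF _ graph_with_legs])
    show "(edge (Suc n) \<union> loop (Suc n)) \<inter> legs (Suc n) (2 * Suc n)
        \<subseteq> ({vertex n, vertex (Suc n)} \<union> {vertex (Suc n)}) \<inter> {vertex (Suc n)}"
    proof (rule meet_subsetI)
      fix x y assume 1: "(x, y) \<in> edge (Suc n) \<union> loop (Suc n)" and 2: "(x, y) \<in> legs (Suc n) (2 * Suc n)"
      have "0 \<le> y" using 1 in_loop(2)[of x y "Suc n"] by (auto simp: in_edge)
      then have "y = 0" using in_legs(1)[OF 2] by simp
      then show "(x, y) = vertex (Suc n)" using in_legs(2)[OF 2] by (simp add: vertex_def)
    qed auto
  qed auto
  moreover have "(\<lambda>w. (if w \<in> {vertex n, vertex (Suc n)} then 1 else 0 :: nat) + (if w = vertex (Suc n) then 2 else 0)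
        + (if w = vertex (Suc n) then 2 * Suc n else 0)) =
      (\<lambda>w. if w = vertex n then 1 else if w = vertex (Suc n) then 2 * n + 5 else 0)"
    by (auto simp: fun_eq_iff)
  ultimately show ?thesis
    unfolding S_graph_alt by (simp add: insert_commute)
qed

text \<open>A region that contains all pieces up to the vertex \<open>m\<close> and meets the next piece only there. The
  value \<open>1/4\<close> is the radius of the loop.\<close>

definition left_of :: "nat \<Rightarrow> plane set" where
  "left_of m = {(x, y). (y = 0 \<longrightarrow> x \<le> real m) \<and> (0 < y \<longrightarrow> x \<le> real m + 1/4) \<and> (y < 0 \<longrightarrow> x < real m)}"

lemma pieces_left_of:
  assumes "n \<le> m"
  shows "edge n \<subseteq> left_of m" "loop n \<subseteq> left_of m" "legs n k \<subseteq> left_of m" "2 \<le> m \<Longrightarrow> small_loop \<subseteq> left_of m"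
proof -
  show "edge n \<subseteq> left_of m" using assms by (auto simp: left_of_def in_edge)
  have "(x, y) \<in> left_of m" if "(x, y) \<in> loop n" for x y
    using in_loop[OF that] assms by (auto simp: left_of_def)
  then show "loop n \<subseteq> left_of m" by auto
  have "(x, y) \<in> left_of m" if "(x, y) \<in> legs n k" for x y
    using in_legs[OF that] assms by (auto simp: left_of_def)
  then show "legs n k \<subseteq> left_of m" by auto
  have "(x, y) \<in> left_of m" if "(x, y) \<in> small_loop" "2 \<le> m" for x y
    using in_small_loop[OF that(1)] that(2) by (auto simp: left_of_def)
  then show "small_loop \<subseteq> left_of m" if "2 \<le> m" using that by auto
qed

lemma S_graph_left_of: "S_graph n \<subseteq> left_of n"
  unfolding S_graph_alt using pieces_left_of[of n n] by blast

lemma S_graph_meets_left_of: "left_of n \<inter> S_graph (Suc n) \<subseteq> {vertex n}"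
proof
  fix z assume z: "z \<in> left_of n \<inter> S_graph (Suc n)"
  obtain x y where xy: "z = (x, y)" by (cases z)
  have l: "y = 0 \<Longrightarrow> x \<le> real n" "0 < y \<Longrightarrow> x \<le> real n + 1/4" "y < 0 \<Longrightarrow> x < real n"
    using z xy by (auto simp: left_of_def)
  consider "(x, y) \<in> edge (Suc n)" | "(x, y) \<in> loop (Suc n)" | "(x, y) \<in> legs (Suc n) (2 * Suc n)"
    using z xy unfolding S_graph_alt by blast
  then show "z \<in> {vertex n}"
  proof cases
    case 1
    then show ?thesis using l xy by (auto simp: in_edge vertex_def)
  next
    case 2
    then show ?thesis using l in_loop[OF 2] by (cases "y = 0") auto
  next
    case 3
    then show ?thesis using l in_legs[OF 3] by (cases "y = 0") auto
  qed
qed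

text \<open>Attaching the next piece raises the degree of the last vertex by one and adds a vertex of still
  larger degree. The bound on the last degree keeps all degrees distinct.\<close>

definition chain_graph :: "nat \<Rightarrow> nat \<Rightarrow> plane set \<Rightarrow> bool" where
  "chain_graph m n X \<longleftrightarrow> X \<subseteq> left_of m \<and> (\<exists>V L K E d. graph_with X V L K E d \<and>
     card V + 2 * card L + card K + card E = n \<and> vertex m \<in> V \<and> (\<forall>v\<in>V. 3 \<le> d v) \<and> inj_on d V \<and>
     (\<forall>v\<in>V. v \<noteq> vertex m \<longrightarrow> d v < d (vertex m)) \<and> d (vertex m) \<le> 2 * m + 3)"

lemma chain_graph_size: "chain_graph m n X \<Longrightarrow> KX_has_size X n"
  unfolding chain_graph_def using graph_with_size by blast

lemma chain_graph_step:
  assumes "chain_graph m n X"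
  shows "chain_graph (Suc m) (n + 5) (X \<union> S_graph (Suc m))"
proof -
  obtain V L K E d where X: "X \<subseteq> left_of m" and G: "graph_with X V L K E d"
    and n: "card V + 2 * card L + card K + card E = n" and m: "vertex m \<in> V"
    and d: "\<And>v. v \<in> V \<Longrightarrow> 3 \<le> d v" "inj_on d V" "\<And>v. v \<in> V \<Longrightarrow> v \<noteq> vertex m \<Longrightarrow> d v < d (vertex m)"
      "d (vertex m) \<le> 2 * m + 3"
    using assms unfolding chain_graph_def by blast
  let ?v = "vertex m" and ?w = "vertex (Suc m)"
  note sub = graph_with_subsets[OF G]
  have meet: "X \<inter> S_graph (Suc m) \<subseteq> V \<inter> {?v, ?w}"
    using X S_graph_meets_left_of m by blast
  define d' where "d' = (\<lambda>x. d x + (if x = ?v then 1 else if x = ?w then 2 * m + 5 else 0))"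
  have G': "graph_with (X \<union> S_graph (Suc m)) (V \<union> {?v, ?w}) (L \<union> {?w}) (K \<union> {?w}) (E \<union> {{?v, ?w}}) d'"
    unfolding d'_def by (rule graph_with_Un[OF G graph_with_S_graph meet])
  have w: "?w \<notin> V"
  proof
    assume "?w \<in> V"
    then have "?w \<in> left_of m" using sub(2) X by blast
    then show False by (simp add: vertex_def left_of_def)
  qed
  have VV: "V \<union> {?v, ?w} = insert ?w V" using m by auto
  have fin: "finite V" "finite L" "finite K" "finite E"
    using sub(1,3,4,6) finite_subset by auto
  have "?w \<notin> L" "?w \<notin> K" "{?v, ?w} \<notin> E" using w sub(3,4,5) by auto
  then have "card (V \<union> {?v, ?w}) + 2 * card (L \<union> {?w}) + card (K \<union> {?w}) + card (E \<union> {{?v, ?w}}) = n + 5"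
    using fin w n unfolding VV by simp
  moreover have d'V: "d' x = (if x = ?v then d x + 1 else d x)" if "x \<in> V" for x
    using that w by (auto simp: d'_def)
  have d'w: "d' ?w = 2 * m + 5" using sub(7)[OF w] by (simp add: d'_def)
  have less: "d' x < d' ?w" if "x \<in> V" for x
    using d'V[OF that] d'w d(3)[OF that] d(4) by (cases "x = ?v") auto
  have "inj_on d' V"
  proof (rule inj_onI)
    fix x y assume xy: "x \<in> V" "y \<in> V" "d' x = d' y"
    show "x = y"
    proof (cases "x = ?v \<or> y = ?v")
      case True
      then show ?thesis using xy d'V[of x] d'V[of y] d(3)[of x] d(3)[of y] by (auto split: if_splits)
    next
      case False
      then have "d x = d y" using xy d'V by simp
      then show ?thesis using inj_onD[OF d(2)] xy by blast
    qed
  qed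
  moreover have "\<forall>x\<in>V \<union> {?v, ?w}. 3 \<le> d' x"
    unfolding VV using d'V d'w d(1) by force
  moreover have "inj_on d' (V \<union> {?v, ?w})"
    unfolding VV inj_on_insert using \<open>inj_on d' V\<close> less w by (metis Diff_empty Diff_insert0 imageE less_irrefl)
  moreover have "\<forall>x\<in>V \<union> {?v, ?w}. x \<noteq> ?w \<longrightarrow> d' x < d' ?w"
    unfolding VV using less by blast
  moreover have "X \<union> S_graph (Suc m) \<subseteq> left_of (Suc m)"
    using X S_graph_left_of[of "Suc m"] by (auto simp: left_of_def)
  ultimately show ?thesis
    unfolding chain_graph_def using G' d'w by (intro conjI exI[of _ "V \<union> {?v, ?w}"] exI[of _ "L \<union> {?w}"]
        exI[of _ "K \<union> {?w}"] exI[of _ "E \<union> {{?v, ?w}}"] exI[of _ d']) auto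
qed

subsection \<open>The initial graphs\<close>

lemma two_loops_meet: "loop 2 \<inter> small_loop \<subseteq> {vertex 2} \<inter> {vertex 2}"
proof (rule meet_subsetI)
  fix x y assume "(x, y) \<in> loop 2" "(x, y) \<in> small_loop"
  then have "(x - 2)\<^sup>2 + y\<^sup>2 = y / 2" "(x - 2)\<^sup>2 + y\<^sup>2 = y / 4" "y = 0 \<Longrightarrow> x = 2"
    using in_loop[of x y 2] in_small_loop[of x y] by auto
  then show "(x, y) = vertex 2" by (simp add: vertex_def)
qed auto

lemma graph_with_two_loops:
  "graph_with (loop 2 \<union> small_loop) {vertex 2} {} {vertex 2} {} (\<lambda>w. if w = vertex 2 then 4 else 0)"
proof -
  have "(\<lambda>w. (if w = vertex 2 then 2 else 0) + (if w = vertex 2 then 2 else 0)) = (\<lambda>w. if w = vertex 2 then 4 else 0 :: nat)"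
    by auto
  then show ?thesis
    using graph_with_Un[OF graph_with_loop_n graph_with_small_loop two_loops_meet] by simp
qed

lemma edge_two_loops_meet: "(x, y) \<in> edge 2 \<Longrightarrow> (x, y) \<in> loop 2 \<union> small_loop \<Longrightarrow> (x, y) = vertex 2"
  using in_loop(3)[of x y 2] in_small_loop(3)[of x y] by (auto simp: in_edge vertex_def)

lemma chain_graph_P1: "chain_graph 2 4 P1"
proof -
  have P: "P1 = edge 2 \<union> (loop 2 \<union> small_loop)" by (auto simp: P1_def)
  have "graph_with P1 ({vertex 2} \<union> {vertex 2}) ({vertex 2} \<union> {}) ({} \<union> {vertex 2}) ({} \<union> {})
      (\<lambda>w. (if w = vertex 2 then 1 else 0) + (if w = vertex 2 then 4 else 0))"
    unfolding P
    by (rule graph_with_Un[OF _ graph_with_two_loops])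
       (use graph_with_edge_leg[of 1] edge_two_loops_meet in \<open>auto simp: numeral_2_eq_2\<close>)
  then have G: "graph_with P1 {vertex 2} {vertex 2} {vertex 2} {}
      (\<lambda>w. (if w = vertex 2 then 1 else 0) + (if w = vertex 2 then 4 else 0))" by simp
  have "P1 \<subseteq> left_of 2" unfolding P using pieces_left_of[of 2 2] by simp
  then show ?thesis
    unfolding chain_graph_def
  proof (intro conjI exI)
    show "graph_with P1 {vertex 2} {vertex 2} {vertex 2} {}
      (\<lambda>w. (if w = vertex 2 then 1 else 0) + (if w = vertex 2 then 4 else 0))" by (rule G)
  qed auto
qed

text \<open>The common part of \<open>P2\<close>, \<open>P3\<close>, \<open>P4\<close> and \<open>P5\<close>, with the left end of the edge as a vertex: it has
  degree at least three in all of them.\<close>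

definition core :: "plane set" where
  "core = edge 2 \<union> (loop 2 \<union> small_loop)"

lemma graph_with_core:
  "graph_with core {vertex 1, vertex 2} {} {vertex 2} {{vertex 1, vertex 2}}
    (\<lambda>w. if w = vertex 1 then 1 else if w = vertex 2 then 5 else 0)"
proof -
  have e: "graph_with (edge 2) {vertex 1, vertex 2} {} {} {{vertex 1, vertex 2}}
    (\<lambda>w. if w \<in> {vertex 1, vertex 2} then 1 else 0)"
    using graph_with_edge_n[of 1] by (simp add: numeral_2_eq_2)
  have "graph_with core ({vertex 1, vertex 2} \<union> {vertex 2}) ({} \<union> {}) ({} \<union> {vertex 2}) ({{vertex 1, vertex 2}} \<union> {})
      (\<lambda>w. (if w \<in> {vertex 1, vertex 2} then 1 else 0) + (if w = vertex 2 then 4 else 0))"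
    unfolding core_def
    by (rule graph_with_Un[OF e graph_with_two_loops]) (use edge_two_loops_meet in auto)
  moreover have "(\<lambda>w. (if w \<in> {vertex 1, vertex 2} then 1 else 0) + (if w = vertex 2 then 4 else 0)) =
      (\<lambda>w. if w = vertex 1 then 1 else if w = vertex 2 then 5 else 0 :: nat)"
    by (auto simp: fun_eq_iff)
  ultimately show ?thesis by (simp add: insert_commute)
qed

lemma core_left_of: "core \<subseteq> left_of 2"
  unfolding core_def using pieces_left_of[of 2 2] by blast

lemma in_core:
  assumes "(x, y) \<in> core"
  shows "0 \<le> y" "y = 0 \<Longrightarrow> 1 \<le> x" "0 < y \<Longrightarrow> 7/4 \<le> x"
  using assms in_loop[of x y 2] in_small_loop[of x y] unfolding core_def in_edge Un_iff
  by (auto simp: in_edge)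

lemma graph_with_core_loop:
  "graph_with (core \<union> loop 1) {vertex 1, vertex 2} {} {vertex 1, vertex 2} {{vertex 1, vertex 2}}
    (\<lambda>w. if w = vertex 1 then 3 else if w = vertex 2 then 5 else 0)"
proof -
  have "core \<inter> loop 1 \<subseteq> {vertex 1, vertex 2} \<inter> {vertex 1}"
  proof (rule meet_subsetI)
    fix x y assume 1: "(x, y) \<in> core" and 2: "(x, y) \<in> loop 1"
    have "y = 0" using in_core[OF 1] in_loop[OF 2] by (cases "y = 0") auto
    then show "(x, y) = vertex 1" using in_loop[OF 2] by (simp add: vertex_def)
  qed auto
  from graph_with_Un[OF graph_with_core graph_with_loop_n this]
  have "graph_with (core \<union> loop 1) {vertex 1, vertex 2} {} {vertex 1, vertex 2} {{vertex 1, vertex 2}}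
      (\<lambda>w. (if w = vertex 1 then 1 else if w = vertex 2 then 5 else 0) + (if w = vertex 1 then 2 else 0))"
    by (simp add: insert_commute)
  moreover have "(\<lambda>w. (if w = vertex 1 then 1 else if w = vertex 2 then 5 else 0) + (if w = vertex 1 then 2 else 0)) =
      (\<lambda>w. if w = vertex 1 then 3 else if w = vertex 2 then 5 else 0 :: nat)"
    by (auto simp: fun_eq_iff)
  ultimately show ?thesis by simp
qed

lemma legs_1_meet:
  assumes "\<And>x y. (x, y) \<in> X \<Longrightarrow> 0 \<le> y"
  shows "X \<inter> legs 1 k \<subseteq> {vertex 1, vertex 2} \<inter> {vertex 1}"
proof (rule meet_subsetI)
  fix x y assume 1: "(x, y) \<in> X" and 2: "(x, y) \<in> legs 1 k"
  have "y = 0" using assms[OF 1] in_legs(1)[OF 2] by simp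
  then show "(x, y) = vertex 1" using in_legs(2)[OF 2] by (simp add: vertex_def)
qed auto

lemma chain_graphI:
  assumes "graph_with X {vertex 1, vertex 2} L K {{vertex 1, vertex 2}} d" "X \<subseteq> left_of 2"
    and "3 + 2 * card L + card K = n" "3 \<le> d (vertex 1)" "d (vertex 1) < d (vertex 2)" "d (vertex 2) \<le> 7"
  shows "chain_graph 2 n X"
  unfolding chain_graph_def
proof (intro conjI exI)
  show "graph_with X {vertex 1, vertex 2} L K {{vertex 1, vertex 2}} d" by (rule assms(1))
qed (use assms in auto)

lemma chain_graph_P2: "chain_graph 2 5 P2"
proof -
  have "P2 = core \<union> loop 1" by (auto simp: P2_def core_def)
  moreover have "core \<union> loop 1 \<subseteq> left_of 2" using core_left_of pieces_left_of[of 1 2] by simp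
  ultimately show ?thesis using chain_graphI[OF graph_with_core_loop] by simp
qed

lemma chain_graph_P3: "chain_graph 2 6 P3"
proof -
  have P: "P3 = core \<union> legs 1 3" by (auto simp: P3_def core_def legs_def)
  have "core \<inter> legs 1 3 \<subseteq> {vertex 1, vertex 2} \<inter> {vertex 1}"
    by (rule legs_1_meet) (rule in_core)
  from graph_with_Un[OF graph_with_core graph_with_legs this]
  have "graph_with P3 {vertex 1, vertex 2} {vertex 1} {vertex 2} {{vertex 1, vertex 2}}
      (\<lambda>w. (if w = vertex 1 then 1 else if w = vertex 2 then 5 else 0) + (if w = vertex 1 then 3 else 0))"
    unfolding P by (simp add: insert_commute)
  moreover have "P3 \<subseteq> left_of 2" unfolding P using core_left_of pieces_left_of[of 1 2] by simp
  ultimately show ?thesis by (rule chain_graphI) auto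
qed

lemma chain_graph_P4: "chain_graph 2 7 P4"
proof -
  have P: "P4 = (core \<union> loop 1) \<union> legs 1 1" by (auto simp: P4_def core_def legs_def)
  have "(core \<union> loop 1) \<inter> legs 1 1 \<subseteq> {vertex 1, vertex 2} \<inter> {vertex 1}"
    by (rule legs_1_meet) (use in_core(1) in_loop(2)[of _ _ 1] in auto)
  from graph_with_Un[OF graph_with_core_loop graph_with_legs this]
  have "graph_with P4 {vertex 1, vertex 2} {vertex 1} {vertex 1, vertex 2} {{vertex 1, vertex 2}}
      (\<lambda>w. (if w = vertex 1 then 3 else if w = vertex 2 then 5 else 0) + (if w = vertex 1 then 1 else 0))"
    unfolding P by (simp add: insert_commute)
  moreover have "P4 \<subseteq> left_of 2" unfolding P using core_left_of pieces_left_of[of 1 2] by simp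
  ultimately show ?thesis by (rule chain_graphI) auto
qed

lemma chain_graph_P5: "chain_graph 2 8 P5"
proof -
  have "{1..2::nat} = {1, 2}" by auto
  then have P: "P5 = (core \<union> legs 1 2) \<union> legs 2 2" by (auto simp: P5_def core_def legs_def)
  have "core \<inter> legs 1 2 \<subseteq> {vertex 1, vertex 2} \<inter> {vertex 1}"
    by (rule legs_1_meet) (rule in_core)
  from graph_with_Un[OF graph_with_core graph_with_legs this]
  have *: "graph_with (core \<union> legs 1 2) {vertex 1, vertex 2} {vertex 1} {vertex 2} {{vertex 1, vertex 2}}
      (\<lambda>w. (if w = vertex 1 then 1 else if w = vertex 2 then 5 else 0) + (if w = vertex 1 then 2 else 0))"
    by (simp add: insert_commute)
  have "(core \<union> legs 1 2) \<inter> legs 2 2 \<subseteq> {vertex 1, vertex 2} \<inter> {vertex 2}"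
  proof (rule meet_subsetI)
    fix x y assume 1: "(x, y) \<in> core \<union> legs 1 2" and 2: "(x, y) \<in> legs 2 2"
    have "y = 0"
    proof (rule ccontr)
      assume "y \<noteq> 0"
      then have y: "y < 0" using in_legs(1)[OF 2] by simp
      then have "(x, y) \<in> legs 1 2" using 1 in_core(1)[of x y] by auto
      then have "x < 1" using in_legs(3)[of x y 1 2] y by simp
      then show False using in_legs(4)[OF 2] by simp
    qed
    then show "(x, y) = vertex 2" using in_legs(2)[OF 2] by (simp add: vertex_def)
  qed auto
  from graph_with_Un[OF * graph_with_legs this]
  have "graph_with P5 {vertex 1, vertex 2} {vertex 1, vertex 2} {vertex 2} {{vertex 1, vertex 2}}
      (\<lambda>w. (if w = vertex 1 then 1 else if w = vertex 2 then 5 else 0) + (if w = vertex 1 then 2 else 0)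
        + (if w = vertex 2 then 2 else 0))"
    unfolding P by (simp add: insert_commute)
  moreover have "P5 \<subseteq> left_of 2" unfolding P using core_left_of pieces_left_of[of 1 2] pieces_left_of[of 2 2] by simp
  ultimately show ?thesis by (rule chain_graphI) auto
qed

text \<open>The number of the last vertex is two for \<open>n < 9\<close> and grows by one when \<open>n\<close> grows by five.\<close>

lemma graph_sequence_chain_graph:
  assumes X: "graph_sequence X" and n: "4 \<le> n"
  shows "chain_graph ((n + 1) div 5 + 1) n (X n)"
  using n
proof (induction n rule: less_induct)
  case (less n)
  show ?case
  proof (cases "n < 9")
    case True
    then have "n = 4 \<or> n = 5 \<or> n = 6 \<or> n = 7 \<or> n = 8" using less.prems by auto
    then show ?thesis
      using X chain_graph_P1 chain_graph_P2 chain_graph_P3 chain_graph_P4 chain_graph_P5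
      unfolding graph_sequence_def by (auto simp: numeral_2_eq_2)
  next
    case False
    define k where "k = (n + 1) div 5 - 1"
    define r where "r = int n - 5 * (int k + 1)"
    have k: "1 \<le> k" "(n + 1) div 5 = k + 1" using False by (auto simp: k_def)
    have "5 * ((n + 1) div 5) \<le> n + 1" "n + 1 < 5 * ((n + 1) div 5) + 5" by auto
    then have r: "r \<in> {-1..3}" using k by (auto simp: r_def)
    have nat: "nat (5 * int k + r) = n - 5" using False by (simp add: r_def)
    have "int n = 5 * (int k + 1) + r" by (simp add: r_def)
    then have Xn: "X n = X (n - 5) \<union> S_graph (k + 2)"
      using X False k(1) r nat unfolding graph_sequence_def by (metis not_less)
    have "(n - 5 + 1) div 5 + 1 = k + 1" using k False by (simp add: k_def)
    then have "chain_graph (k + 1) (n - 5) (X (n - 5))"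
      using less.IH[of "n - 5"] False by simp
    from chain_graph_step[OF this] show ?thesis
      using Xn k False by simp
  qed
qed

theorem theorem4p1:
  fixes X :: "nat \<Rightarrow> (real \<times> real) set" and n :: nat
  assumes "graph_sequence X" and "n \<ge> 1"
  shows "KX_has_size (X n) n"
proof (cases "4 \<le> n")
  case True
  then show ?thesis
    using graph_sequence_chain_graph[OF assms(1)] chain_graph_size by blast
next
  case False
  then consider "n = 1" | "n = 2" | "n = 3" using assms(2) by linarith
  then show ?thesis
    using assms(1) KX_size_simple_closed_curve KX_size_arc KX_size_simple_triod
    unfolding graph_sequence_def by cases auto
qed

end
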